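(* Let $g(x)=l-x$. Let $\alpha,\alpha'\in\mathbb R\setminus\{0\}$ and $v,v'\in L^2(0,l)$ with $\|v\|=\|v'\|=1$. Suppose that, counting multiplicities, $\sigma(L_\alpha(v))=\sigma(L_{\alpha'}(v'))$, $\sigma(L_\alpha(v+g))=\sigma(L_{\alpha'}(v'+g))$ and $\sigma(L_\alpha(v+ig))=\sigma(L_{\alpha'}(v'+ig))$. Then $\alpha=\alpha'$ and $v=v'$. That is, $\alpha$ and $v$ are uniquely recovered from the four spectra $\sigma(L_0)$, $\sigma(L_\alpha(v))$, $\sigma(L_\alpha(v+g))$, $\sigma(L_\alpha(v+ig))$.
   Context: Fix $0<l<\infty$. $\langle f,g\rangle=\int_0^lf\overline g$. $L_0y=iy'''$ on $L^2(0,l)$ with domain $\{y\in W^{3,2}(0,l): y(0)=0,\ y'(0)=y'(l),\ y(l)=0\}$. For $\alpha\in\mathbb R$ and $w\in L^2(0,l)$ (not necessarily normalized), $L_\alpha(w)$ is the operator $y\mapsto iy'''+\alpha\langle y,w\rangle w$ with the same domain. *)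

theory Defs
  imports "HOL-Analysis.Analysis"
begin

text \<open>Elements of L^2(0,l) are represented by functions real => complex;
  equality in L^2 is equality almost everywhere on [0,l].\<close>

definition L2 :: "real \<Rightarrow> (real \<Rightarrow> complex) \<Rightarrow> bool" where
  "L2 l f \<longleftrightarrow> f \<in> borel_measurable (lebesgue_on {0..l}) \<and>
     integrable (lebesgue_on {0..l}) (\<lambda>x. (cmod (f x))\<^sup>2)"

definition ae_eq :: "real \<Rightarrow> (real \<Rightarrow> complex) \<Rightarrow> (real \<Rightarrow> complex) \<Rightarrow> bool" where
  "ae_eq l f g \<longleftrightarrow> (AE x in lebesgue_on {0..l}. f x = g x)"

definition ip :: "real \<Rightarrow> (real \<Rightarrow> complex) \<Rightarrow> (real \<Rightarrow> complex) \<Rightarrow> complex" where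
  "ip l f g = integral\<^sup>L (lebesgue_on {0..l}) (\<lambda>x. f x * cnj (g x))"

definition L2norm :: "real \<Rightarrow> (real \<Rightarrow> complex) \<Rightarrow> real" where
  "L2norm l f = sqrt (Re (ip l f f))"

text \<open>y belongs to the domain (W^{3,2}(0,l) with y(0)=0, y'(0)=y'(l), y(l)=0),
  where y is the C^2 representative, y1, y2 its first two derivatives on [0,l],
  y2 absolutely continuous with derivative y3 in L^2 (the third weak derivative).\<close>

definition in_dom3 :: "real \<Rightarrow> (real \<Rightarrow> complex) \<Rightarrow> (real \<Rightarrow> complex) \<Rightarrow> bool" where
  "in_dom3 l y y3 \<longleftrightarrow> L2 l y3 \<and>
     (\<exists>y1 y2. (\<forall>x\<in>{0..l}. (y has_vector_derivative y1 x) (at x within {0..l})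
                       \<and> (y1 has_vector_derivative y2 x) (at x within {0..l})
                       \<and> (y3 has_integral (y2 x - y2 0)) {0..x})
             \<and> y 0 = 0 \<and> y1 0 = y1 l \<and> y l = 0)"

definition Lop :: "real \<Rightarrow> real \<Rightarrow> (real \<Rightarrow> complex) \<Rightarrow> (real \<Rightarrow> complex) \<Rightarrow> (real \<Rightarrow> complex) \<Rightarrow> bool" where
  "Lop l \<alpha> w y z \<longleftrightarrow> (\<exists>y3. in_dom3 l y y3 \<and>
     ae_eq l z (\<lambda>x. \<i> * y3 x + complex_of_real \<alpha> * ip l y w * w x))"

fun gen_eig :: "real \<Rightarrow> real \<Rightarrow> (real \<Rightarrow> complex) \<Rightarrow> complex \<Rightarrow> nat \<Rightarrow> (real \<Rightarrow> complex) \<Rightarrow> bool" where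
  "gen_eig l \<alpha> w lam 0 y = ae_eq l y (\<lambda>x. 0)"
| "gen_eig l \<alpha> w lam (Suc k) y =
     (\<exists>z u. Lop l \<alpha> w y u \<and> ae_eq l z (\<lambda>x. u x - lam * y x) \<and> gen_eig l \<alpha> w lam k z)"

definition root_space :: "real \<Rightarrow> real \<Rightarrow> (real \<Rightarrow> complex) \<Rightarrow> complex \<Rightarrow> (real \<Rightarrow> complex) set" where
  "root_space l \<alpha> w lam = {y. \<exists>k. gen_eig l \<alpha> w lam k y}"

definition lin_indep_L2 :: "real \<Rightarrow> (real \<Rightarrow> complex) set \<Rightarrow> bool" where
  "lin_indep_L2 l S \<longleftrightarrow> (\<forall>c. ae_eq l (\<lambda>x. \<Sum>s\<in>S. c s * s x) (\<lambda>x. 0) \<longrightarrow> (\<forall>s\<in>S. c s = 0))"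

text \<open>Algebraic multiplicity of lam as an eigenvalue of L_alpha(w)
  (0 if lam is not an eigenvalue).\<close>

definition alg_mult :: "real \<Rightarrow> real \<Rightarrow> (real \<Rightarrow> complex) \<Rightarrow> complex \<Rightarrow> enat" where
  "alg_mult l \<alpha> w lam =
     Sup {enat (card S) | S. finite S \<and> S \<subseteq> root_space l \<alpha> w lam \<and> lin_indep_L2 l S}"

definition same_spectrum :: "real \<Rightarrow> real \<Rightarrow> (real \<Rightarrow> complex) \<Rightarrow> real \<Rightarrow> (real \<Rightarrow> complex) \<Rightarrow> bool" where
  "same_spectrum l \<alpha> w \<alpha>' w' \<longleftrightarrow> (\<forall>lam. alg_mult l \<alpha> w lam = alg_mult l \<alpha>' w' lam)"

end

theory Submission
  imports Defs "HOL-Complex_Analysis.Complex_Analysis"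
begin

text \<open>Let R(lam) be the resolvent of the self-adjoint operator L_0 and F_w(lam) = <R(lam) w, w>. At a real
  point the order of the meromorphic function 1 + alpha F_w equals the multiplicity for L_alpha(w) minus the
  multiplicity for L_0. So if L_alpha(w) and L_alpha'(w') have the same spectrum, the quotient
  Q = (1 + alpha F_w) / (1 + alpha' F_w') is entire. The Herglotz inequality
  |Im lam| |F_w|^2 <= |w|^2 |Im F_w| bounds both 1 + alpha F_w and the inverse of 1 + alpha' F_w' by
  C (1 + 1/|Im lam|), which forces Q to be constant, and Q tends to 1 along the imaginary axis. Hence
  alpha F_w = alpha' F_w' for each of the three pairs. Since - lam F_v tends to |v|^2 = 1, this gives
  alpha = alpha', and polarisation then gives <R(lam) u, g> = 0 for u = v - v'. The eigenvalues of L_0 are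
  simple and no eigenfunction is orthogonal to g, so u is orthogonal to all eigenfunctions. Therefore F_u is
  entire, and being at most |u|^2 / |Im lam| it vanishes, so u = 0.\<close>

section \<open>Square-integrable functions\<close>

text \<open>All analytic input on \<open>L_0\<close> comes from solving its equation by power series
  in lam. This makes \<open>char_det\<close> and \<open>ip l (res_num l lam w) w\<close> entire, so
  F_w is a quotient of entire functions. Orders of zeros and poles are never counted:
  \<open>entire_quotient\<close> asks only for |A| <= K |B| on a short vertical segment above each
  real point r, because a pole would be felt there too. On that segment a dichotomy suffices. Either
  w has a component along the kernel of L_0 - r; then |F_w| is of exact order 1/eta and r is not an
  eigenvalue of L_alpha(w). Or w can be inverted twice; then F_w has a limit with error O(eta), and
  the multiplicity exceeds that of L_0 exactly when 1 + alpha F_w has limit 0. Both shifts, by g and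
  by i g, are needed because R(lam) is not symmetric off the real axis: one shift yields only a
  combination of <R u, g> and <R g, u>, two shifts separate them.\<close>

lemma ae_eq_refl [simp]: "ae_eq l f f"
  by (simp add: ae_eq_def)

lemma ae_eq_compose2:
  assumes "ae_eq l f f'" "ae_eq l h h'"
  shows "ae_eq l (\<lambda>x. G x (f x) (h x)) (\<lambda>x. G x (f' x) (h' x))"
  using assms unfolding ae_eq_def by (auto elim: eventually_elim2)

lemma L2_measurable: "L2 l f \<Longrightarrow> f \<in> borel_measurable (lebesgue_on {0..l})"
  by (simp add: L2_def)

lemma L2_continuous:
  assumes "continuous_on {0..l} f"
  shows "L2 l f"
proof -
  have c: "continuous_on {0..l} (\<lambda>x. (cmod (f x))\<^sup>2)"
    by (intro continuous_intros assms)
  show ?thesis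
    unfolding L2_def
  proof
    show "f \<in> borel_measurable (lebesgue_on {0..l})"
      by (rule continuous_imp_measurable_on_sets_lebesgue[OF assms]) simp
    show "integrable (lebesgue_on {0..l}) (\<lambda>x. (cmod (f x))\<^sup>2)"
      by (rule continuous_imp_integrable_real[OF c])
  qed
qed

lemma L2_zero [simp]: "L2 l (\<lambda>x. 0)"
  by (rule L2_continuous) simp

lemma L2_cmult [simp]:
  assumes "L2 l f" shows "L2 l (\<lambda>x. c * f x)"
proof -
  have "f \<in> borel_measurable (lebesgue_on {0..l})"
    "integrable (lebesgue_on {0..l}) (\<lambda>x. (cmod c)\<^sup>2 * (cmod (f x))\<^sup>2)"
    using assms by (auto simp: L2_def)
  then show ?thesis by (simp add: L2_def norm_mult power_mult_distrib)
qed

lemma L2_add [simp]: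
  assumes "L2 l f" "L2 l h" shows "L2 l (\<lambda>x. f x + h x)"
proof -
  have m: "f \<in> borel_measurable (lebesgue_on {0..l})" "h \<in> borel_measurable (lebesgue_on {0..l})"
    using assms by (auto simp: L2_def)
  have "integrable (lebesgue_on {0..l}) (\<lambda>x. (cmod (f x + h x))\<^sup>2)"
  proof (rule Bochner_Integration.integrable_bound)
    show "integrable (lebesgue_on {0..l}) (\<lambda>x. 2 * (cmod (f x))\<^sup>2 + 2 * (cmod (h x))\<^sup>2)"
      using assms by (auto simp: L2_def)
    show "(\<lambda>x. (cmod (f x + h x))\<^sup>2) \<in> borel_measurable (lebesgue_on {0..l})"
      using m by measurable
    have "(cmod (a + b))\<^sup>2 \<le> 2 * (cmod a)\<^sup>2 + 2 * (cmod b)\<^sup>2" for a b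
    proof -
      have "(cmod (a + b))\<^sup>2 \<le> (cmod a + cmod b)\<^sup>2"
        by (rule power_mono) (auto simp: norm_triangle_ineq)
      also have "\<dots> \<le> 2 * (cmod a)\<^sup>2 + 2 * (cmod b)\<^sup>2"
        using sum_squares_bound[of "cmod a" "cmod b"] by (simp add: power2_sum)
      finally show ?thesis .
    qed
    then show "AE x in lebesgue_on {0..l}. norm ((cmod (f x + h x))\<^sup>2)
        \<le> norm (2 * (cmod (f x))\<^sup>2 + 2 * (cmod (h x))\<^sup>2)"
      by (intro AE_I2) auto
  qed
  then show ?thesis using m by (auto simp: L2_def)
qed

lemma L2_diff [simp]:
  assumes "L2 l f" "L2 l h" shows "L2 l (\<lambda>x. f x - h x)"
  using L2_add[OF assms(1) L2_cmult[OF assms(2), of "-1"]] by simp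

lemma L2_prod_integrable:
  assumes "L2 l f" "L2 l h"
  shows "integrable (lebesgue_on {0..l}) (\<lambda>x. f x * cnj (h x))"
proof (rule Bochner_Integration.integrable_bound)
  show "integrable (lebesgue_on {0..l}) (\<lambda>x. (cmod (f x))\<^sup>2 + (cmod (h x))\<^sup>2)"
    using assms by (auto simp: L2_def)
  have m: "f \<in> borel_measurable (lebesgue_on {0..l})" "h \<in> borel_measurable (lebesgue_on {0..l})"
    using assms by (auto simp: L2_def)
  moreover have "(\<lambda>x. cnj (h x)) \<in> borel_measurable (lebesgue_on {0..l})"
    using borel_measurable_continuous_onI[of cnj] m
    by (rule_tac measurable_compose[of h]) (auto intro!: continuous_intros)
  ultimately show "(\<lambda>x. f x * cnj (h x)) \<in> borel_measurable (lebesgue_on {0..l})"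
    by (intro borel_measurable_times)
  have "cmod a * cmod b \<le> (cmod a)\<^sup>2 + (cmod b)\<^sup>2" for a b
    using sum_squares_bound[of "cmod a" "cmod b"] mult_nonneg_nonneg[OF norm_ge_zero[of a] norm_ge_zero[of b]]
    unfolding mult.assoc by linarith
  then show "AE x in lebesgue_on {0..l}. norm (f x * cnj (h x)) \<le> norm ((cmod (f x))\<^sup>2 + (cmod (h x))\<^sup>2)"
    by (intro AE_I2) (auto simp: norm_mult)
qed

lemma ip_add_left:
  assumes "L2 l f" "L2 l h" "L2 l k"
  shows "ip l (\<lambda>x. f x + h x) k = ip l f k + ip l h k"
  using L2_prod_integrable[OF assms(1,3)] L2_prod_integrable[OF assms(2,3)]
  by (simp add: ip_def ring_distribs)

lemma ip_cmult_left [simp]: "ip l (\<lambda>x. c * f x) k = c * ip l f k"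
  by (simp add: ip_def mult.assoc)

lemma ip_cnj: "ip l h f = cnj (ip l f h)"
  unfolding ip_def by (subst Bochner_Integration.integral_cnj[symmetric]) (simp add: mult.commute)

lemma ip_cmult_right [simp]: "ip l k (\<lambda>x. c * f x) = cnj c * ip l k f"
  by (simp add: ip_cnj[of l k])

lemma ip_add_right:
  assumes "L2 l f" "L2 l h" "L2 l k"
  shows "ip l k (\<lambda>x. f x + h x) = ip l k f + ip l k h"
  using ip_add_left[OF assms] by (simp add: ip_cnj[of l k])

lemma ip_diff_left:
  assumes "L2 l f" "L2 l h" "L2 l k"
  shows "ip l (\<lambda>x. f x - h x) k = ip l f k - ip l h k"
  using ip_add_left[OF assms(1) L2_cmult[OF assms(2), of "-1"] assms(3)] 
    ip_cmult_left[of l "-1" h k] by simp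

lemma ip_diff_right:
  assumes "L2 l f" "L2 l h" "L2 l k"
  shows "ip l k (\<lambda>x. f x - h x) = ip l k f - ip l k h"
  using ip_diff_left[OF assms] by (simp add: ip_cnj[of l k])

lemma ip_zero_left [simp]: "ip l (\<lambda>x. 0) k = 0"
  and ip_zero_right [simp]: "ip l k (\<lambda>x. 0) = 0"
  by (simp_all add: ip_def)

lemma ip_cong_left:
  assumes "ae_eq l f f'" "L2 l f" "L2 l f'" "L2 l h"
  shows "ip l f h = ip l f' h"
  unfolding ip_def
proof (rule integral_cong_AE)
  show "(\<lambda>x. f x * cnj (h x)) \<in> borel_measurable (lebesgue_on {0..l})"
    "(\<lambda>x. f' x * cnj (h x)) \<in> borel_measurable (lebesgue_on {0..l})"
    using L2_prod_integrable assms borel_measurable_integrable by blast+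
  show "AE x in lebesgue_on {0..l}. f x * cnj (h x) = f' x * cnj (h x)"
    using assms(1) unfolding ae_eq_def by (auto elim: eventually_mono)
qed

lemma ip_cong_right:
  assumes "ae_eq l f f'" "L2 l f" "L2 l f'" "L2 l h"
  shows "ip l h f = ip l h f'"
  using ip_cong_left[OF assms] by (simp add: ip_cnj[of l h])

text \<open>The squared norm as a real number; \<open>ip l f f\<close> is complex and cannot enter
  inequalities directly.\<close>

definition nsq :: "real \<Rightarrow> (real \<Rightarrow> complex) \<Rightarrow> real" where
  "nsq l f = (\<integral>x. (cmod (f x))\<^sup>2 \<partial>lebesgue_on {0..l})"

lemma ip_self: "ip l f f = of_real (nsq l f)"
  unfolding ip_def nsq_def
  by (simp only: complex_norm_square[symmetric] integral_complex_of_real)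

lemma nsq_nonneg [simp]: "0 \<le> nsq l f"
  unfolding nsq_def by (rule Bochner_Integration.integral_nonneg) simp

lemma nsq_eq_0_iff:
  assumes "L2 l f"
  shows "nsq l f = 0 \<longleftrightarrow> ae_eq l f (\<lambda>x. 0)"
  using assms integral_nonneg_eq_0_iff_AE[of "lebesgue_on {0..l}" "\<lambda>x. (cmod (f x))\<^sup>2"]
  by (auto simp: L2_def nsq_def ae_eq_def)

lemma nsq_eq_0_imp: "L2 l f \<Longrightarrow> nsq l f = 0 \<Longrightarrow> ae_eq l f (\<lambda>x. 0)"
  by (simp add: nsq_eq_0_iff)

lemma nsq_cmult [simp]: "nsq l (\<lambda>x. c * f x) = (cmod c)\<^sup>2 * nsq l f"
  by (simp add: nsq_def norm_mult power_mult_distrib)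

lemma Cauchy_Schwarz_ip:
  assumes "L2 l f" "L2 l h"
  shows "(cmod (ip l f h))\<^sup>2 \<le> nsq l f * nsq l h"
proof (cases "nsq l h = 0")
  case True
  then have "ip l f h = ip l f (\<lambda>x. 0)"
    using assms nsq_eq_0_imp by (intro ip_cong_right) auto
  then show ?thesis by simp
next
  case False
  define n where "n = nsq l h"
  define c where "c = ip l f h"
  have n: "n > 0" using False nsq_nonneg[of l h] unfolding n_def by linarith
  \<comment> \<open>This is |h|^2 times the component of f orthogonal to h; its squared norm is
    nonnegative, and the factor |h|^2 avoids a division.\<close>
  let ?k = "\<lambda>x. of_real n * f x - c * h x"
  have "of_real (nsq l ?k) = of_real n * (of_real n * of_real (nsq l f) - cnj c * c)"
  proof -
    have h: "ip l h f = cnj c" "ip l h h = of_real n" "ip l f f = of_real (nsq l f)"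
      by (simp_all add: ip_cnj[of l h f] c_def n_def ip_self)
    show ?thesis
      unfolding ip_self[symmetric] using assms
      by (simp add: ip_diff_left ip_diff_right h c_def[symmetric] algebra_simps)
  qed
  also have "\<dots> = of_real (n * (n * nsq l f - (cmod c)\<^sup>2))"
    by (simp add: complex_norm_square[symmetric] mult.commute[of "cnj c"])
  finally have "nsq l ?k = n * (n * nsq l f - (cmod c)\<^sup>2)"
    using of_real_eq_iff by blast
  then have "0 \<le> n * (n * nsq l f - (cmod c)\<^sup>2)"
    by (metis nsq_nonneg)
  then show ?thesis using n by (simp add: zero_le_mult_iff n_def c_def mult.commute)
qed

section \<open>Series solutions of the homogeneous equation\<close>

fun iint :: "(real \<Rightarrow> complex) \<Rightarrow> nat \<Rightarrow> real \<Rightarrow> complex" where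
  "iint u 0 = u"
| "iint u (Suc n) = (\<lambda>x. integral {0..x} (iint u n))"

text \<open>For y = ser u 2 lam one has y'' = ser u 0 lam = u - i lam (primitive of y), that is
  i y''' = lam y + i u'. Each value is an entire function of lam.\<close>

definition ser :: "(real \<Rightarrow> complex) \<Rightarrow> nat \<Rightarrow> complex \<Rightarrow> real \<Rightarrow> complex" where
  "ser u k lam x = (\<Sum>n. (- \<i> * lam) ^ n * iint u (3 * n + k) x)"

lemma iint_continuous:
  assumes "continuous_on {0..l} u"
  shows "continuous_on {0..l} (iint u n)"
proof (induction n)
  case (Suc n)
  then have "iint u n integrable_on {0..l}" by (rule integrable_continuous_real)
  then show ?case by (simp add: indefinite_integral_continuous_1)
qed (use assms in simp)

lemma iint_has_vector_derivative:
  assumes "continuous_on {0..l} u" "x \<in> {0..l}"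
  shows "(iint u (Suc n) has_vector_derivative iint u n x) (at x within {0..l})"
  using integral_has_vector_derivative[OF iint_continuous[OF assms(1)] assms(2)] by simp

lemma iint_bound:
  assumes "continuous_on {0..l} u" "\<And>x. x \<in> {0..l} \<Longrightarrow> cmod (u x) \<le> C" "x \<in> {0..l}"
  shows "cmod (iint u n x) \<le> C * (x ^ n / fact n)"
  using assms(3)
proof (induction n arbitrary: x)
  case (Suc n)
  have "((\<lambda>t. t ^ Suc n / fact (Suc n)) has_vector_derivative (t ^ n / fact n)) (at t within {0..x})" for t
    unfolding has_real_derivative_iff_has_vector_derivative[symmetric]
    by (auto intro!: derivative_eq_intros simp: field_simps simp del: power_Suc of_nat_Suc)
  then have "((\<lambda>t. t ^ n / fact n) has_integral (x ^ Suc n / fact (Suc n) - 0 ^ Suc n / fact (Suc n))) {0..x}"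
    using Suc.prems by (intro fundamental_theorem_of_calculus) auto
  then have i: "((\<lambda>t. C * (t ^ n / fact n)) has_integral (C * (x ^ Suc n / fact (Suc n)))) {0..x}"
    by (intro has_integral_mult_right) (simp del: power_Suc fact_Suc add: power_0_Suc)
  have "cmod (integral {0..x} (iint u n)) \<le> integral {0..x} (\<lambda>t. C * (t ^ n / fact n))"
  proof (rule integral_norm_bound_integral)
    show "iint u n integrable_on {0..x}"
      using Suc.prems
      by (intro integrable_continuous_real continuous_on_subset[OF iint_continuous[OF assms(1)]]) auto
    show "(\<lambda>t. C * (t ^ n / fact n)) integrable_on {0..x}"
      using i by blast
  qed (use Suc in auto)
  also have "\<dots> = C * (x ^ Suc n / fact (Suc n))"
    using i by (rule integral_unique)
  finally show ?case by simp
qed (use assms in simp)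

text \<open>Replacing (3 n + k)! by n! is wasteful but still leaves an exponential series in lam.
  One \<open>C\<close> serves all \<open>n\<close>, \<open>k\<close> and \<open>x\<close>.\<close>

lemma ser_coeff_bound:
  assumes "continuous_on {0..l} u"
  obtains C where "C \<ge> 0" "\<And>n k x. x \<in> {0..l} \<Longrightarrow> cmod (iint u (3 * n + k) x) \<le> C * l ^ k * ((l ^ 3) ^ n / fact n)"
proof -
  have "compact (u ` {0..l})"
    using assms by (intro compact_continuous_image) auto
  then obtain C where C: "C > 0" "\<And>x. x \<in> {0..l} \<Longrightarrow> cmod (u x) \<le> C"
    using compact_imp_bounded bounded_pos by (metis image_eqI)
  show ?thesis
  proof
    show "C \<ge> 0" using C by simp
    fix n k x assume x: "x \<in> {0..l}"
    have "cmod (iint u (3 * n + k) x) \<le> C * (x ^ (3 * n + k) / fact (3 * n + k))"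
      using assms C x by (intro iint_bound) auto
    also have "x ^ (3 * n + k) / fact (3 * n + k) \<le> l ^ (3 * n + k) / fact n"
      using x by (intro frac_le power_mono fact_mono) auto
    also have "C * (l ^ (3 * n + k) / fact n) = C * l ^ k * ((l ^ 3) ^ n / fact n)"
      unfolding power_add power_mult by simp
    finally show "cmod (iint u (3 * n + k) x) \<le> C * l ^ k * ((l ^ 3) ^ n / fact n)"
      using C by (simp add: mult_left_mono)
  qed
qed

lemma ser_term_bound:
  assumes "continuous_on {0..l} u"
  obtains B where "summable B"
    "\<And>n x. x \<in> {0..l} \<Longrightarrow> cmod ((- \<i> * lam) ^ n * iint u (3 * n + k) x) \<le> B n"
proof -
  obtain C where C: "C \<ge> 0" "\<And>n k x. x \<in> {0..l} \<Longrightarrow> cmod (iint u (3 * n + k) x) \<le> C * l ^ k * ((l ^ 3) ^ n / fact n)"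
    using ser_coeff_bound[OF assms] by blast
  define B where "B = (\<lambda>n. C * l ^ k * (inverse (fact n) * (cmod lam * l ^ 3) ^ n))"
  show ?thesis
  proof
    show "summable B" unfolding B_def
      by (intro summable_mult summable_exp)
    fix n x assume x: "x \<in> {0..l}"
    have "cmod ((- \<i> * lam) ^ n * iint u (3 * n + k) x) = cmod lam ^ n * cmod (iint u (3 * n + k) x)"
      by (simp add: norm_mult norm_power)
    also have "\<dots> \<le> cmod lam ^ n * (C * l ^ k * ((l ^ 3) ^ n / fact n))"
      using C x by (intro mult_left_mono) auto
    also have "\<dots> = B n" by (simp add: B_def power_mult_distrib field_simps)
    finally show "cmod ((- \<i> * lam) ^ n * iint u (3 * n + k) x) \<le> B n" .
  qed
qed

lemma ser_uniform_limit:
  assumes "continuous_on {0..l} u"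
  shows "uniform_limit {0..l} (\<lambda>n x. \<Sum>i<n. (- \<i> * lam) ^ i * iint u (3 * i + k) x) (ser u k lam) sequentially"
proof -
  obtain B where B: "summable B"
    "\<And>n x. x \<in> {0..l} \<Longrightarrow> cmod ((- \<i> * lam) ^ n * iint u (3 * n + k) x) \<le> B n"
    using ser_term_bound[OF assms] by blast
  show ?thesis
    unfolding ser_def by (rule Weierstrass_m_test[OF B(2,1)])
qed

lemma ser_sums:
  assumes "continuous_on {0..l} u" "x \<in> {0..l}"
  shows "(\<lambda>n. (- \<i> * lam) ^ n * iint u (3 * n + k) x) sums ser u k lam x"
  using tendsto_uniform_limitI[OF ser_uniform_limit[OF assms(1)] assms(2)] by (simp add: sums_def)

lemma ser_continuous:
  assumes "continuous_on {0..l} u"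
  shows "continuous_on {0..l} (ser u k lam)"
  by (rule uniform_limit_theorem[OF _ ser_uniform_limit[OF assms]])
    (auto intro!: always_eventually continuous_intros iint_continuous assms)

text \<open>Holds because the term with 3 n + k + 1 integrations differentiates to the one with 3 n
  + k, and the differentiated series converges uniformly.\<close>

lemma ser_has_vector_derivative:
  assumes "continuous_on {0..l} u" "x \<in> {0..l}"
  shows "(ser u (Suc k) lam has_vector_derivative ser u k lam x) (at x within {0..l})"
proof -
  have "\<exists>g. \<forall>x\<in>{0..l}. (\<lambda>n. (- \<i> * lam) ^ n * iint u (3 * n + Suc k) x) sums g x \<and>
      (g has_derivative (\<lambda>h. h *\<^sub>R ser u k lam x)) (at x within {0..l})"
  proof (rule has_derivative_series)
    show "((\<lambda>x. (- \<i> * lam) ^ n * iint u (3 * n + Suc k) x) has_derivative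
          (\<lambda>h. h *\<^sub>R ((- \<i> * lam) ^ n * iint u (3 * n + k) x))) (at x within {0..l})"
      if "x \<in> {0..l}" for n x
      using has_vector_derivative_mult_right[OF iint_has_vector_derivative[OF assms(1) that, of "3 * n + k"], of "(- \<i> * lam) ^ n"]
      unfolding has_vector_derivative_def by simp
    show "\<forall>\<^sub>F n in sequentially. \<forall>x\<in>{0..l}. \<forall>h. norm ((\<Sum>i<n. h *\<^sub>R ((- \<i> * lam) ^ i * iint u (3 * i + k) x)) - h *\<^sub>R ser u k lam x) \<le> e * norm h"
      if "e > 0" for e
      using uniform_limitD[OF ser_uniform_limit[OF assms(1)] that, of lam k]
    proof eventually_elim
      case (elim n)
      show ?case
      proof (intro ballI allI)
        fix x :: real and h :: real assume x: "x \<in> {0..l}"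
        have "norm ((\<Sum>i<n. h *\<^sub>R ((- \<i> * lam) ^ i * iint u (3 * i + k) x)) - h *\<^sub>R ser u k lam x)
          = norm ((\<Sum>i<n. ((- \<i> * lam) ^ i * iint u (3 * i + k) x)) - ser u k lam x) * norm h"
          unfolding scaleR_sum_right[symmetric] scaleR_diff_right[symmetric] by (simp add: mult.commute)
        also have "\<dots> \<le> e * norm h"
          using elim x by (intro mult_right_mono) (auto simp: dist_norm less_imp_le)
        finally show "norm ((\<Sum>i<n. h *\<^sub>R ((- \<i> * lam) ^ i * iint u (3 * i + k) x)) - h *\<^sub>R ser u k lam x) \<le> e * norm h" .
      qed
    qed
    show "x \<in> {0..l}" by fact
    show "(\<lambda>n. (- \<i> * lam) ^ n * iint u (3 * n + Suc k) x) sums ser u (Suc k) lam x"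
      by (rule ser_sums[OF assms])
  qed simp
  then obtain g where g: "\<And>x. x \<in> {0..l} \<Longrightarrow> (\<lambda>n. (- \<i> * lam) ^ n * iint u (3 * n + Suc k) x) sums g x"
     "\<And>x. x \<in> {0..l} \<Longrightarrow> (g has_derivative (\<lambda>h. h *\<^sub>R ser u k lam x)) (at x within {0..l})"
    by blast
  have "g y = ser u (Suc k) lam y" if "y \<in> {0..l}" for y
    using sums_unique2[OF g(1)[OF that] ser_sums[OF assms(1) that]] .
  with g(2)[OF assms(2)] show ?thesis
    unfolding has_vector_derivative_def
    by (rule_tac has_derivative_transform[OF assms(2)]) auto
qed

text \<open>The source of the third-order equation: without its term n = 0 the series is the same
  series with three more integrations and one more factor - i lam.\<close>

lemma ser_rec:
  assumes "continuous_on {0..l} u" "x \<in> {0..l}"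
  shows "ser u 0 lam x = u x - \<i> * lam * ser u 3 lam x"
proof -
  have "ser u 0 lam x = u x + (\<Sum>n. (- \<i> * lam) ^ Suc n * iint u (3 * Suc n + 0) x)"
    using suminf_split_head[OF sums_summable[OF ser_sums[OF assms, of lam 0]]]
    unfolding ser_def by (simp del: iint.simps add: iint.simps(1))
  also have "(\<lambda>n. (- \<i> * lam) ^ Suc n * iint u (3 * Suc n + 0) x) = (\<lambda>n. (- \<i> * lam) * ((- \<i> * lam) ^ n * iint u (3 * n + 3) x))"
    by (simp del: iint.simps add: algebra_simps)
  also have "suminf \<dots> = (- \<i> * lam) * ser u 3 lam x"
    unfolding ser_def by (rule suminf_mult) (rule sums_summable[OF ser_sums[OF assms]])
  finally show ?thesis by simp
qed

lemma ser_at_0 [simp]: "ser u (Suc k) lam 0 = 0"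
  by (simp add: ser_def)

lemma fact_series_holomorphic:
  fixes a :: "nat \<Rightarrow> complex"
  assumes "\<And>n. cmod (a n) \<le> K * (r ^ n / fact n)"
  shows "(\<lambda>lam. \<Sum>n. (- \<i> * lam) ^ n * a n) holomorphic_on UNIV"
proof -
  have s: "summable (\<lambda>n. a n * y ^ n)" for y
  proof (rule summable_comparison_test')
    show "summable (\<lambda>n. K * (inverse (fact n) * (r * cmod y) ^ n))"
      by (intro summable_mult summable_exp)
    show "norm (a n * y ^ n) \<le> K * (inverse (fact n) * (r * cmod y) ^ n)" for n
      using mult_right_mono[OF assms[of n], of "cmod y ^ n"]
      by (simp add: norm_mult norm_power power_mult_distrib field_simps)
  qed
  have "(\<lambda>z. \<Sum>n. a n * z ^ n) holomorphic_on UNIV"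
    using termdiffs_strong_converges_everywhere[OF s] by (auto simp: holomorphic_on_def field_differentiable_def)
  then have "(\<lambda>z. \<Sum>n. a n * z ^ n) \<circ> (\<lambda>lam. - \<i> * lam) holomorphic_on UNIV"
    by (rule holomorphic_on_compose_gen[rotated]) (auto intro!: holomorphic_intros)
  then show ?thesis by (simp add: o_def mult.commute)
qed

lemma ser_holomorphic:
  assumes "continuous_on {0..l} u" "x \<in> {0..l}"
  shows "(\<lambda>lam. ser u k lam x) holomorphic_on UNIV"
proof -
  obtain C where C: "C \<ge> 0" "\<And>n k x. x \<in> {0..l} \<Longrightarrow> cmod (iint u (3 * n + k) x) \<le> C * l ^ k * ((l ^ 3) ^ n / fact n)"
    using ser_coeff_bound[OF assms(1)] by blast
  show ?thesis
    unfolding ser_def by (rule fact_series_holomorphic[OF C(2)[OF assms(2)]])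
qed

lemma L2_ser: "continuous_on {0..l} u \<Longrightarrow> L2 l (ser u k lam)"
  by (intro L2_continuous ser_continuous)

lemma L2_iint: "continuous_on {0..l} u \<Longrightarrow> L2 l (iint u k)"
  by (intro L2_continuous iint_continuous)

lemma L2_integrable_norm:
  assumes "L2 l w"
  shows "integrable (lebesgue_on {0..l}) (\<lambda>x. cmod (w x))"
  using integrable_norm[OF L2_prod_integrable[OF assms L2_continuous[of l "\<lambda>x. 1"]]] by simp

text \<open>The uniform majorant of the series times |w| is integrable, so the pairing can be taken
  term by term. The result is a power series in lam whose coefficients decay like r^n / n!.\<close>

lemma ip_ser_holomorphic:
  assumes "continuous_on {0..l} u" "L2 l w"
  shows "(\<lambda>lam. ip l (ser u k lam) w) holomorphic_on UNIV"
proof -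
  let ?M = "lebesgue_on {0..l}"
  obtain C where C: "C \<ge> 0" "\<And>n k x. x \<in> {0..l} \<Longrightarrow> cmod (iint u (3 * n + k) x) \<le> C * l ^ k * ((l ^ 3) ^ n / fact n)"
    using ser_coeff_bound[OF assms(1)] by blast
  define W where "W = (\<integral>x. cmod (w x) \<partial>?M)"
  have i: "integrable ?M (\<lambda>x. K * cmod (w x))" for K :: real
    using L2_integrable_norm[OF assms(2)] by simp
  have a: "cmod (ip l (iint u (3 * n + k)) w) \<le> (C * l ^ k * W) * ((l ^ 3) ^ n / fact n)" for n
  proof -
    have "cmod (ip l (iint u (3 * n + k)) w) \<le> (\<integral>x. (C * l ^ k * ((l ^ 3) ^ n / fact n)) * cmod (w x) \<partial>?M)"
      unfolding ip_def
    proof (rule order_trans[OF integral_norm_bound integral_mono])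
      show "integrable ?M (\<lambda>x. cmod (iint u (3 * n + k) x * cnj (w x)))"
        by (intro integrable_norm L2_prod_integrable L2_iint assms)
      show "cmod (iint u (3 * n + k) x * cnj (w x)) \<le> (C * l ^ k * ((l ^ 3) ^ n / fact n)) * cmod (w x)"
        if "x \<in> space ?M" for x
        using mult_right_mono[OF C(2)[of x n k], of "cmod (w x)"] that
        by (simp only: norm_mult complex_mod_cnj space_lebesgue_on norm_ge_zero)
    qed (rule i)
    then show ?thesis by (simp add: W_def mult_ac)
  qed
  have "ip l (ser u k lam) w = (\<Sum>n. (- \<i> * lam) ^ n * ip l (iint u (3 * n + k)) w)" for lam
  proof -
    obtain B where B: "summable B"
      "\<And>n x. x \<in> {0..l} \<Longrightarrow> cmod ((- \<i> * lam) ^ n * iint u (3 * n + k) x) \<le> B n"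
      using ser_term_bound[OF assms(1)] by blast
    let ?f = "\<lambda>n x. ((- \<i> * lam) ^ n * iint u (3 * n + k) x) * cnj (w x)"
    have int: "integrable ?M (?f n)" for n
      by (intro L2_prod_integrable L2_cmult L2_iint assms)
    have bd: "cmod (?f n x) \<le> B n * cmod (w x)" if "x \<in> {0..l}" for n x
      using B(2)[OF that, of n] by (simp only: norm_mult[of _ "cnj (w x)"] complex_mod_cnj) (auto intro!: mult_right_mono)
    have "(\<lambda>n. integral\<^sup>L ?M (?f n)) sums (\<integral>x. (\<Sum>n. ?f n x) \<partial>?M)"
    proof (rule sums_integral[OF int])
      show "AE x in ?M. summable (\<lambda>n. norm (?f n x))"
      proof (rule AE_I2)
        fix x assume "x \<in> space ?M"
        then show "summable (\<lambda>n. norm (?f n x))"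
          using bd by (intro summable_comparison_test'[OF summable_mult2[OF B(1), of "cmod (w x)"]]) auto
      qed
      show "summable (\<lambda>n. \<integral>x. norm (?f n x) \<partial>?M)"
      proof (rule summable_comparison_test'[OF summable_mult2[OF B(1), of W]])
        fix n
        have "(\<integral>x. norm (?f n x) \<partial>?M) \<le> (\<integral>x. B n * cmod (w x) \<partial>?M)"
          using bd by (intro integral_mono integrable_norm int i) auto
        then show "norm (\<integral>x. norm (?f n x) \<partial>?M) \<le> B n * W"
          by (simp add: W_def)
      qed
    qed
    moreover have "(\<integral>x. (\<Sum>n. ?f n x) \<partial>?M) = ip l (ser u k lam) w"
      unfolding ip_def
    proof (rule Bochner_Integration.integral_cong[OF refl])
      fix x assume "x \<in> space ?M"
      then have x: "x \<in> {0..l}" by simp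
      show "(\<Sum>n. ?f n x) = ser u k lam x * cnj (w x)"
        using sums_unique[OF sums_mult2[OF ser_sums[OF assms(1) x]]] by metis
    qed
    moreover have "integral\<^sup>L ?M (?f n) = (- \<i> * lam) ^ n * ip l (iint u (3 * n + k)) w" for n
      unfolding ip_def by (simp add: mult.assoc)
    ultimately show ?thesis by (simp add: sums_iff)
  qed
  then show ?thesis using fact_series_holomorphic[OF a] by simp
qed

section \<open>Symmetry of the unperturbed operator\<close>

lemma has_vector_derivative_imp_continuous_on:
  assumes "\<And>x. x \<in> S \<Longrightarrow> (f has_vector_derivative f' x) (at x within S)"
  shows "continuous_on S f"
  using assms has_vector_derivative_continuous continuous_on_eq_continuous_within by blast

lemma L2_integrable_on:
  assumes "L2 l f" "L2 l h"
  shows "(\<lambda>x. f x * cnj (h x)) integrable_on {0..l}"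
  using integrable_on_lebesgue_on[OF L2_prod_integrable[OF assms]] by simp

lemma ip_eq_integral:
  assumes "L2 l f" "L2 l h"
  shows "ip l f h = integral {0..l} (\<lambda>x. f x * cnj (h x))"
  unfolding ip_def using lebesgue_integral_eq_integral[OF L2_prod_integrable[OF assms]] by simp

lemma L2_imp_integrable_on:
  assumes "L2 l f"
  shows "f integrable_on {0..l}" "(\<lambda>x. cmod (f x)) integrable_on {0..l}"
  using L2_integrable_on[OF assms L2_continuous[of l "\<lambda>x. 1"]]
    integrable_on_lebesgue_on[OF L2_integrable_norm[OF assms]] by auto

lemma L2_antiderivative_continuous:
  assumes "L2 l u'" "\<And>x. x \<in> {0..l} \<Longrightarrow> (u' has_integral (u x - u 0)) {0..x}"
  shows "continuous_on {0..l} u"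
proof (rule continuous_on_eq)
  show "continuous_on {0..l} (\<lambda>x. u 0 + integral {0..x} u')"
    by (intro continuous_intros indefinite_integral_continuous_1 L2_imp_integrable_on assms)
  show "u 0 + integral {0..x} u' = u x" if "x \<in> {0..l}" for x
    using integral_unique[OF assms(2)[OF that]] by simp
qed

lemma L2_cnj:
  assumes "L2 l f" shows "L2 l (\<lambda>x. cnj (f x))"
proof -
  have "(\<lambda>x. cnj (f x)) \<in> borel_measurable (lebesgue_on {0..l})"
    using borel_measurable_integrable[OF L2_prod_integrable[OF L2_continuous[of l "\<lambda>x. 1"] assms]] by simp
  then show ?thesis using assms by (simp add: L2_def)
qed

text \<open>The function u is only absolutely continuous. The defect of the product formula between a and b is
  at most 2 K (b - a) times the integral of |u'| over [a, b], so it has derivative zero everywhere.\<close>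

lemma ibp_L2:
  fixes u u' z z' :: "real \<Rightarrow> complex"
  assumes l: "0 \<le> l" and u': "L2 l u'"
    and u: "\<And>x. x \<in> {0..l} \<Longrightarrow> (u' has_integral (u x - u 0)) {0..x}"
    and z: "\<And>x. x \<in> {0..l} \<Longrightarrow> (z has_vector_derivative z' x) (at x within {0..l})"
    and z': "continuous_on {0..l} z'"
  shows "integral {0..l} (\<lambda>x. u' x * z x) = u l * z l - u 0 * z 0 - integral {0..l} (\<lambda>x. u x * z' x)"
proof -
  have cz: "continuous_on {0..l} z"
    using z has_vector_derivative_imp_continuous_on by blast
  have uint: "u' integrable_on {0..l}" and nint: "(\<lambda>x. cmod (u' x)) integrable_on {0..l}"
    using L2_imp_integrable_on[OF u'] by auto
  have ux: "u x = u 0 + integral {0..x} u'" if "x \<in> {0..l}" for x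
    using integral_unique[OF u[OF that]] by simp
  have cu: "continuous_on {0..l} u"
    using L2_antiderivative_continuous[OF u' u] .
  define V where "V = (\<lambda>x. integral {0..x} (\<lambda>t. cmod (u' t)))"
  have cV: "continuous_on {0..l} V"
    unfolding V_def by (rule indefinite_integral_continuous_1[OF nint])
  have prod: "(\<lambda>x. u' x * k x) integrable_on {0..l}" if "continuous_on {0..l} k" for k
    using L2_integrable_on[OF u' L2_cnj[OF L2_continuous[OF that]]] by simp
  obtain K where K: "K > 0" "\<And>x. x \<in> {0..l} \<Longrightarrow> cmod (z' x) \<le> K"
  proof -
    have "compact (z' ` {0..l})" using z' by (intro compact_continuous_image) auto
    then show ?thesis using compact_imp_bounded bounded_pos that by (metis image_eqI)
  qed
  define \<Phi> where "\<Phi> = (\<lambda>x. integral {0..x} (\<lambda>t. u' t * z t) - u x * z x + integral {0..x} (\<lambda>t. u t * z' t))"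
  have combine: "integral {0..b} f = integral {0..a} f + integral {a..b} f"
    if "f integrable_on {0..l}" "0 \<le> a" "a \<le> b" "b \<le> l" for f :: "real \<Rightarrow> 'x::banach" and a b
    using that by (intro Henstock_Kurzweil_Integration.integral_combine[symmetric])
      (auto intro: integrable_on_subinterval)
  have sub: "f integrable_on {a..b}"
    if "f integrable_on {0..l}" "0 \<le> a" "b \<le> l" for f :: "real \<Rightarrow> 'x::banach" and a b
    using that by (auto intro: integrable_on_subinterval)
  have Vdiff: "integral {a..b} (\<lambda>t. cmod (u' t)) = V b - V a" if "0 \<le> a" "a \<le> b" "b \<le> l" for a b
    using combine[OF nint that] by (simp add: V_def)
  have udiff: "integral {a..b} u' = u b - u a" if "0 \<le> a" "a \<le> b" "b \<le> l" for a b
    using combine[OF uint that] ux[of a] ux[of b] that by simp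
  have ubd: "cmod (u b - u a) \<le> V b - V a" if "0 \<le> a" "a \<le> b" "b \<le> l" for a b
    unfolding udiff[OF that, symmetric] Vdiff[OF that, symmetric]
    using that by (intro integral_norm_bound_integral sub[OF uint] sub[OF nint]) auto
  have Vmono: "V a \<le> V b" if "0 \<le> a" "a \<le> b" "b \<le> l" for a b
    using ubd[OF that] norm_ge_zero[of "u b - u a"] by linarith
  have zdiff: "cmod (z t - z a) \<le> K * (b - a)" if "0 \<le> a" "a \<le> t" "t \<le> b" "b \<le> l" for a b t
  proof -
    have "(z' has_integral (z t - z a)) {a..t}"
      using that by (intro fundamental_theorem_of_calculus has_vector_derivative_within_subset[OF z]) auto
    then have "cmod (z t - z a) \<le> K * (t - a)"
      using that K has_integral_bound_real[of K "{}" z' "z t - z a" a t] by auto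
    also have "\<dots> \<le> K * (b - a)" using that K by (intro mult_left_mono) auto
    finally show ?thesis .
  qed
  have key: "cmod (\<Phi> b - \<Phi> a) \<le> 2 * K * (b - a) * (V b - V a)" if ab: "0 \<le> a" "a \<le> b" "b \<le> l" for a b
  proof -
    have i1: "(\<lambda>t. u' t * z t) integrable_on {0..l}" by (rule prod[OF cz])
    have i2: "(\<lambda>t. u t * z' t) integrable_on {0..l}"
      by (intro integrable_continuous_real continuous_intros cu z')
    have i3: "z' integrable_on {0..l}" by (intro integrable_continuous_real z')
    have zab: "integral {a..b} z' = z b - z a"
      using ab by (intro integral_unique fundamental_theorem_of_calculus has_vector_derivative_within_subset[OF z]) auto
    \<comment> \<open>Freezing z at a and u at b makes all boundary terms of
      \<open>\<Phi> b - \<Phi> a\<close> cancel; what remains are two integrals, each containing an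
      increment of z or u besides the integrated derivative.\<close>
    have e1: "integral {a..b} (\<lambda>t. u' t * (z t - z a)) = integral {a..b} (\<lambda>t. u' t * z t) - (u b - u a) * z a"
      using Henstock_Kurzweil_Integration.integral_diff[OF sub[OF i1] integrable_on_mult_left[OF sub[OF uint]], of a b "z a"] ab
      by (simp add: right_diff_distrib udiff)
    have e2: "integral {a..b} (\<lambda>t. (u t - u b) * z' t) = integral {a..b} (\<lambda>t. u t * z' t) - u b * (z b - z a)"
      using Henstock_Kurzweil_Integration.integral_diff[OF sub[OF i2] integrable_on_mult_right[OF sub[OF i3]], of a b "u b"] ab
      by (simp add: left_diff_distrib zab)
    have "\<Phi> b - \<Phi> a = integral {a..b} (\<lambda>t. u' t * (z t - z a)) + integral {a..b} (\<lambda>t. (u t - u b) * z' t)"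
      unfolding e1 e2 \<Phi>_def combine[OF i1 ab] combine[OF i2 ab] by (simp add: algebra_simps)
    moreover have "cmod (integral {a..b} (\<lambda>t. u' t * (z t - z a))) \<le> integral {a..b} (\<lambda>t. cmod (u' t) * (K * (b - a)))"
    proof (rule integral_norm_bound_integral)
      show "(\<lambda>t. u' t * (z t - z a)) integrable_on {a..b}"
        using ab by (intro sub[OF prod] continuous_intros cz) auto
      show "(\<lambda>t. cmod (u' t) * (K * (b - a))) integrable_on {a..b}"
        using ab by (intro integrable_on_mult_left sub[OF nint]) auto
      show "cmod (u' t * (z t - z a)) \<le> cmod (u' t) * (K * (b - a))" if "t \<in> {a..b}" for t
        using zdiff[of a t b] ab that by (auto simp: norm_mult intro!: mult_left_mono)
    qed
    moreover have "integral {a..b} (\<lambda>t. cmod (u' t) * (K * (b - a))) = (V b - V a) * (K * (b - a))"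
      using Vdiff[OF ab] by (simp only: Henstock_Kurzweil_Integration.integral_mult_left)
    moreover have "cmod (integral {a..b} (\<lambda>t. (u t - u b) * z' t)) \<le> integral {a..b} (\<lambda>t. (V b - V a) * K)"
    proof (rule integral_norm_bound_integral)
      show "(\<lambda>t. (u t - u b) * z' t) integrable_on {a..b}"
        using ab by (intro sub[OF integrable_continuous_real] continuous_intros cu z') auto
      show "cmod ((u t - u b) * z' t) \<le> (V b - V a) * K" if t: "t \<in> {a..b}" for t
      proof -
        have "cmod (u t - u b) \<le> V b - V a"
          using ubd[of t b] Vmono[of a t] ab t by (auto simp: norm_minus_commute)
        then show ?thesis
          unfolding norm_mult using K ab t Vmono[OF ab] by (intro mult_mono) auto
      qed
    qed (rule integrable_const_ivl)
    moreover have "integral {a..b} (\<lambda>t. (V b - V a) * K) = (b - a) * ((V b - V a) * K)"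
      using ab by simp
    ultimately show ?thesis
      using norm_triangle_ineq[of "integral {a..b} (\<lambda>t. u' t * (z t - z a))" "integral {a..b} (\<lambda>t. (u t - u b) * z' t)"]
      by (simp add: algebra_simps)
  qed
  have sym: "cmod (\<Phi> y - \<Phi> x) \<le> 2 * K * \<bar>V y - V x\<bar> * \<bar>y - x\<bar>" if "x \<in> {0..l}" "y \<in> {0..l}" for x y
  proof (cases "x \<le> y")
    case True
    then show ?thesis using key[of x y] Vmono[of x y] that by (simp add: algebra_simps)
  next
    case False
    then show ?thesis using key[of y x] Vmono[of y x] that by (simp add: norm_minus_commute algebra_simps)
  qed
  have "(\<Phi> has_derivative (\<lambda>h. 0)) (at x within {0..l})" if x: "x \<in> {0..l}" for x
    unfolding has_derivative_iff_norm
  proof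
    show "((\<lambda>y. norm (\<Phi> y - \<Phi> x - 0) / norm (y - x)) \<longlongrightarrow> 0) (at x within {0..l})"
    proof (rule tendsto_sandwich[of "\<lambda>y. 0"])
      show "\<forall>\<^sub>F y in at x within {0..l}. norm (\<Phi> y - \<Phi> x - 0) / norm (y - x) \<le> 2 * K * \<bar>V y - V x\<bar>"
        using sym[OF x] unfolding eventually_at_filter
        by (intro always_eventually) (auto simp: divide_le_eq)
      have "((\<lambda>y. 2 * K * \<bar>V y - V x\<bar>) \<longlongrightarrow> 2 * K * \<bar>V x - V x\<bar>) (at x within {0..l})"
        using cV x by (intro tendsto_intros) (auto simp: continuous_on_def)
      then show "((\<lambda>y. 2 * K * \<bar>V y - V x\<bar>) \<longlongrightarrow> 0) (at x within {0..l})" by simp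
    qed auto
  qed simp
  then obtain c where "\<And>x. x \<in> {0..l} \<Longrightarrow> \<Phi> x = c"
    using has_derivative_zero_constant[of "{0..l}" \<Phi>] by auto
  then have "\<Phi> l = \<Phi> 0" using l by simp
  then show ?thesis by (simp add: \<Phi>_def algebra_simps)
qed

lemma in_dom3_continuous: "in_dom3 l y y3 \<Longrightarrow> continuous_on {0..l} y"
  unfolding in_dom3_def using has_vector_derivative_imp_continuous_on by blast

lemma in_dom3_L2: "in_dom3 l y y3 \<Longrightarrow> L2 l y" "in_dom3 l y y3 \<Longrightarrow> L2 l y3"
  using in_dom3_continuous L2_continuous by (auto simp: in_dom3_def)

lemma has_vector_derivative_cnj':
  "(f has_vector_derivative f') F \<Longrightarrow> ((\<lambda>x. cnj (f x)) has_vector_derivative cnj f') F"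
  using bounded_linear.has_vector_derivative[OF bounded_linear_cnj] .

text \<open>Three integrations by parts. The first and the last have boundary terms with a factor z
  or y, zero at both ends; the middle one has y' cnj z', with equal values at both ends. The total
  sign -1 is absorbed by cnj i = - i. In the last one the merely absolutely continuous factor is the
  conjugate of z'', so the roles in \<open>ibp_L2\<close> are exchanged.\<close>

lemma in_dom3_symmetric:
  assumes l: "0 \<le> l" and "in_dom3 l y y3" "in_dom3 l z z3"
  shows "ip l (\<lambda>x. \<i> * y3 x) z = ip l y (\<lambda>x. \<i> * z3 x)"
proof -
  obtain y1 y2 where y: "\<And>x. x \<in> {0..l} \<Longrightarrow> (y has_vector_derivative y1 x) (at x within {0..l})"
     "\<And>x. x \<in> {0..l} \<Longrightarrow> (y1 has_vector_derivative y2 x) (at x within {0..l})"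
     "\<And>x. x \<in> {0..l} \<Longrightarrow> (y3 has_integral (y2 x - y2 0)) {0..x}"
     "y 0 = 0" "y1 0 = y1 l" "y l = 0"
    using assms(2) unfolding in_dom3_def by blast
  obtain z1 z2 where z: "\<And>x. x \<in> {0..l} \<Longrightarrow> (z has_vector_derivative z1 x) (at x within {0..l})"
     "\<And>x. x \<in> {0..l} \<Longrightarrow> (z1 has_vector_derivative z2 x) (at x within {0..l})"
     "\<And>x. x \<in> {0..l} \<Longrightarrow> (z3 has_integral (z2 x - z2 0)) {0..x}"
     "z 0 = 0" "z1 0 = z1 l" "z l = 0"
    using assms(3) unfolding in_dom3_def by blast
  note L = in_dom3_L2[OF assms(2)] in_dom3_L2[OF assms(3)]
  have cy2: "continuous_on {0..l} y2" and cz2: "continuous_on {0..l} z2"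
    using L2_antiderivative_continuous L y(3) z(3) by blast+
  have cy1: "continuous_on {0..l} y1" and cz1: "continuous_on {0..l} z1"
    using y z has_vector_derivative_imp_continuous_on by blast+
  have 1: "integral {0..l} (\<lambda>x. y3 x * cnj (z x)) = - integral {0..l} (\<lambda>x. y2 x * cnj (z1 x))"
    using ibp_L2[of l y3 y2 "\<lambda>x. cnj (z x)" "\<lambda>x. cnj (z1 x)", OF l L(2) y(3) has_vector_derivative_cnj'[OF z(1)]]
      continuous_on_cnj[OF cz1] z by simp
  have y12: "(y2 has_integral (y1 x - y1 0)) {0..x}" if "x \<in> {0..l}" for x
    using that by (intro fundamental_theorem_of_calculus has_vector_derivative_within_subset[OF y(2)]) auto
  have 2: "integral {0..l} (\<lambda>x. y2 x * cnj (z1 x)) = - integral {0..l} (\<lambda>x. y1 x * cnj (z2 x))"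
    using ibp_L2[of l y2 y1 "\<lambda>x. cnj (z1 x)" "\<lambda>x. cnj (z2 x)", OF l L2_continuous[OF cy2] y12 has_vector_derivative_cnj'[OF z(2)]]
      continuous_on_cnj[OF cz2] z y by simp
  have z32: "((\<lambda>x. cnj (z3 x)) has_integral (cnj (z2 x) - cnj (z2 0))) {0..x}" if "x \<in> {0..l}" for x
    using has_integral_cnj[of z3 "z2 x - z2 0" "{0..x}"] z(3)[OF that] by (simp add: o_def)
  have 3: "integral {0..l} (\<lambda>x. cnj (z3 x) * y x) = - integral {0..l} (\<lambda>x. cnj (z2 x) * y1 x)"
    using ibp_L2[of l "\<lambda>x. cnj (z3 x)" "\<lambda>x. cnj (z2 x)" y y1, OF l L2_cnj[OF L(4)] z32 y(1) cy1] y by simp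
  have "ip l y3 z = - ip l y z3"
    unfolding ip_eq_integral[OF L(2,3)] ip_eq_integral[OF L(1,4)] using 1 2 3 by (simp add: mult.commute)
  then show ?thesis by simp
qed

section \<open>The resolvent\<close>

lemma continuous_ae_eq_0:
  fixes y :: "real \<Rightarrow> complex"
  assumes "0 < l" "continuous_on {0..l} y" "ae_eq l y (\<lambda>x. 0)" "x \<in> {0..l}"
  shows "y x = 0"
proof -
  have "nsq l y = 0"
    using assms nsq_eq_0_iff[OF L2_continuous] by blast
  then have "\<forall>x\<in>{0..l}. (cmod (y x))\<^sup>2 = 0"
    unfolding nsq_def using assms
    by (subst (asm) integralL_eq_0_iff) (auto intro!: continuous_intros)
  then show ?thesis using assms by auto
qed

text \<open>The equation (L_0 - lam) y = f with y in the domain.\<close>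

definition eqn :: "real \<Rightarrow> complex \<Rightarrow> (real \<Rightarrow> complex) \<Rightarrow> (real \<Rightarrow> complex) \<Rightarrow> bool" where
  "eqn l lam y f \<longleftrightarrow> (\<exists>y3. in_dom3 l y y3 \<and> ae_eq l f (\<lambda>x. \<i> * y3 x - lam * y x))"

lemma eqn_L2: "eqn l lam y f \<Longrightarrow> L2 l y"
  unfolding eqn_def using in_dom3_L2 by blast

lemma in_dom3_lincomb:
  assumes "in_dom3 l y y3" "in_dom3 l z z3"
  shows "in_dom3 l (\<lambda>x. c * y x + d * z x) (\<lambda>x. c * y3 x + d * z3 x)"
proof -
  obtain y1 y2 where y: "\<And>x. x \<in> {0..l} \<Longrightarrow> (y has_vector_derivative y1 x) (at x within {0..l})"
     "\<And>x. x \<in> {0..l} \<Longrightarrow> (y1 has_vector_derivative y2 x) (at x within {0..l})"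
     "\<And>x. x \<in> {0..l} \<Longrightarrow> (y3 has_integral (y2 x - y2 0)) {0..x}"
     "y 0 = 0" "y1 0 = y1 l" "y l = 0"
    using assms(1) unfolding in_dom3_def by blast
  obtain z1 z2 where z: "\<And>x. x \<in> {0..l} \<Longrightarrow> (z has_vector_derivative z1 x) (at x within {0..l})"
     "\<And>x. x \<in> {0..l} \<Longrightarrow> (z1 has_vector_derivative z2 x) (at x within {0..l})"
     "\<And>x. x \<in> {0..l} \<Longrightarrow> (z3 has_integral (z2 x - z2 0)) {0..x}"
     "z 0 = 0" "z1 0 = z1 l" "z l = 0"
    using assms(2) unfolding in_dom3_def by blast
  show ?thesis
    unfolding in_dom3_def
  proof (intro conjI exI ballI)
    fix x assume x: "x \<in> {0..l}"
    show "((\<lambda>x. c * y x + d * z x) has_vector_derivative c * y1 x + d * z1 x) (at x within {0..l})"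
      by (intro has_vector_derivative_add has_vector_derivative_mult_right y z x)
    show "((\<lambda>x. c * y1 x + d * z1 x) has_vector_derivative c * y2 x + d * z2 x) (at x within {0..l})"
      by (intro has_vector_derivative_add has_vector_derivative_mult_right y z x)
    show "((\<lambda>x. c * y3 x + d * z3 x) has_integral (c * y2 x + d * z2 x) - (c * y2 0 + d * z2 0)) {0..x}"
      using has_integral_add[OF has_integral_mult_right[OF y(3)[OF x], of c] has_integral_mult_right[OF z(3)[OF x], of d]]
      by (simp add: algebra_simps)
  qed (use y z in_dom3_L2[OF assms(1)] in_dom3_L2[OF assms(2)] in auto)
qed

lemma eqn_lincomb:
  assumes "eqn l lam y f" "eqn l lam z h"
  shows "eqn l lam (\<lambda>x. c * y x + d * z x) (\<lambda>x. c * f x + d * h x)"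
proof -
  obtain y3 z3 where y: "in_dom3 l y y3" "ae_eq l f (\<lambda>x. \<i> * y3 x - lam * y x)"
    and z: "in_dom3 l z z3" "ae_eq l h (\<lambda>x. \<i> * z3 x - lam * z x)"
    using assms unfolding eqn_def by blast
  have "ae_eq l (\<lambda>x. c * f x + d * h x) (\<lambda>x. c * (\<i> * y3 x - lam * y x) + d * (\<i> * z3 x - lam * z x))"
    using ae_eq_compose2[OF y(2) z(2), of "\<lambda>x a b. c * a + d * b"] .
  then show ?thesis
    unfolding eqn_def by (intro exI[of _ "\<lambda>x. c * y3 x + d * z3 x"] conjI in_dom3_lincomb y z)
      (simp add: algebra_simps)
qed

lemma eqn_cmult: "eqn l lam y f \<Longrightarrow> eqn l lam (\<lambda>x. c * y x) (\<lambda>x. c * f x)"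
  using eqn_lincomb[of l lam y f y f c 0] by simp

text \<open>The same y serves any other spectral parameter, with a corrected right-hand side.
  Expansions of the resolvent near a point are assembled from this.\<close>

lemma eqn_shift:
  assumes "eqn l lam y f"
  shows "eqn l mu y (\<lambda>x. f x + (lam - mu) * y x)"
proof -
  obtain y3 where y: "in_dom3 l y y3" "ae_eq l f (\<lambda>x. \<i> * y3 x - lam * y x)"
    using assms unfolding eqn_def by blast
  have "ae_eq l (\<lambda>x. f x + (lam - mu) * y x) (\<lambda>x. (\<i> * y3 x - lam * y x) + (lam - mu) * y x)"
    using ae_eq_compose2[OF y(2) ae_eq_refl, of "\<lambda>x a b. a + (lam - mu) * y x"] .
  then show ?thesis
    unfolding eqn_def using y by (intro exI[of _ y3]) (auto simp: algebra_simps)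
qed

text \<open>Green's identity with two spectral parameters. Taken twice with the same data it
  isolates Im lam; at a real parameter with one right-hand side 0 it makes kernel and range
  orthogonal.\<close>

lemma eqn_symmetric:
  assumes l: "0 \<le> l" and "eqn l lam y f" "eqn l mu z h" "L2 l f" "L2 l h"
  shows "ip l f z + lam * ip l y z = ip l y h + cnj mu * ip l y z"
proof -
  obtain y3 where y: "in_dom3 l y y3" "ae_eq l f (\<lambda>x. \<i> * y3 x - lam * y x)"
    using assms unfolding eqn_def by blast
  obtain z3 where z: "in_dom3 l z z3" "ae_eq l h (\<lambda>x. \<i> * z3 x - mu * z x)"
    using assms unfolding eqn_def by blast
  note L = in_dom3_L2[OF y(1)] in_dom3_L2[OF z(1)]
  have "ip l f z = ip l (\<lambda>x. \<i> * y3 x - lam * y x) z"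
    using L assms y by (intro ip_cong_left) auto
  also have "\<dots> = ip l (\<lambda>x. \<i> * y3 x) z - lam * ip l y z"
    using L by (subst ip_diff_left) auto
  finally have 1: "ip l f z + lam * ip l y z = ip l (\<lambda>x. \<i> * y3 x) z" by simp
  have "ip l y h = ip l y (\<lambda>x. \<i> * z3 x - mu * z x)"
    using L assms z by (intro ip_cong_right) auto
  also have "\<dots> = ip l y (\<lambda>x. \<i> * z3 x) - cnj mu * ip l y z"
    using L by (subst ip_diff_right) auto
  finally have 2: "ip l y h + cnj mu * ip l y z = ip l y (\<lambda>x. \<i> * z3 x)" by simp
  show ?thesis using 1 2 in_dom3_symmetric[OF l y(1) z(1)] by simp
qed

text \<open>The equation i y''' - lam y = f without boundary conditions, with y1 = y' and y2 = y''.\<close>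

definition ivp :: "real \<Rightarrow> complex \<Rightarrow> (real \<Rightarrow> complex) \<Rightarrow> (real \<Rightarrow> complex) \<Rightarrow> (real \<Rightarrow> complex) \<Rightarrow> (real \<Rightarrow> complex) \<Rightarrow> bool" where
  "ivp l lam f y y1 y2 \<longleftrightarrow> (\<forall>x\<in>{0..l}. (y has_vector_derivative y1 x) (at x within {0..l}) \<and>
     (y1 has_vector_derivative y2 x) (at x within {0..l}) \<and>
     ((\<lambda>t. - \<i> * f t - \<i> * lam * y t) has_integral (y2 x - y2 0)) {0..x})"

lemma ivp_lincomb:
  assumes "ivp l lam f y y1 y2" "ivp l lam h z z1 z2"
  shows "ivp l lam (\<lambda>x. c * f x + d * h x) (\<lambda>x. c * y x + d * z x)
    (\<lambda>x. c * y1 x + d * z1 x) (\<lambda>x. c * y2 x + d * z2 x)"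
  unfolding ivp_def
proof (intro ballI conjI)
  fix x assume x: "x \<in> {0..l}"
  note y = assms(1)[unfolded ivp_def, rule_format, OF x]
  note z = assms(2)[unfolded ivp_def, rule_format, OF x]
  show "((\<lambda>x. c * y x + d * z x) has_vector_derivative c * y1 x + d * z1 x) (at x within {0..l})"
    using y z by (intro has_vector_derivative_add has_vector_derivative_mult_right) auto
  show "((\<lambda>x. c * y1 x + d * z1 x) has_vector_derivative c * y2 x + d * z2 x) (at x within {0..l})"
    using y z by (intro has_vector_derivative_add has_vector_derivative_mult_right) auto
  have "((\<lambda>t. c * (- \<i> * f t - \<i> * lam * y t) + d * (- \<i> * h t - \<i> * lam * z t)) has_integral (c * (y2 x - y2 0) + d * (z2 x - z2 0))) {0..x}"
    using y z by (intro has_integral_add has_integral_mult_right) auto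
  then show "((\<lambda>t. - \<i> * (c * f t + d * h t) - \<i> * lam * (c * y t + d * z t)) has_integral
          c * y2 x + d * z2 x - (c * y2 0 + d * z2 0)) {0..x}"
    by (simp add: algebra_simps)
qed

lemma ivp_eqn:
  assumes "ivp l lam f y y1 y2" "L2 l f" "y 0 = 0" "y1 0 = y1 l" "y l = 0"
  shows "eqn l lam y f"
proof -
  have "continuous_on {0..l} y"
    by (rule has_vector_derivative_imp_continuous_on[of _ _ y1]) (use assms(1) in \<open>auto simp: ivp_def\<close>)
  then have "L2 l (\<lambda>t. - \<i> * f t - \<i> * lam * y t)"
    by (intro L2_diff L2_cmult L2_continuous assms(2))
  then have "in_dom3 l y (\<lambda>t. - \<i> * f t - \<i> * lam * y t)"
    unfolding in_dom3_def using assms unfolding ivp_def by blast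
  moreover have "f x = \<i> * (- \<i> * f x - \<i> * lam * y x) - lam * y x" for x
    by (simp add: algebra_simps)
  ultimately show ?thesis unfolding eqn_def by (metis (no_types, lifting) ae_eq_refl ext)
qed

section \<open>Fundamental solutions and the boundary value problem\<close>

abbreviation fund :: "nat \<Rightarrow> complex \<Rightarrow> real \<Rightarrow> complex" where
  "fund \<equiv> ser (\<lambda>x. 1)"

lemma fund_deriv: "x \<in> {0..l} \<Longrightarrow> (fund (Suc k) lam has_vector_derivative fund k lam x) (at x within {0..l})"
  by (rule ser_has_vector_derivative) auto

lemma fund0_eq: "0 \<le> x \<Longrightarrow> fund 0 lam x = 1 - \<i> * lam * fund 3 lam x"
  using ser_rec[of x "\<lambda>x. 1" x lam] by simp

text \<open>The values (y, y', y'') at 0 of \<open>fund 0\<close>, \<open>fund 1\<close>,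
  \<open>fund 2\<close> are the three unit vectors. Hence combinations of \<open>fund 1\<close> and
  \<open>fund 2\<close> satisfy y(0) = 0 from the start, and only two boundary conditions
  remain.\<close>

lemma fund_at_0 [simp]: "fund 0 lam 0 = 1" "fund (Suc k) lam 0 = 0"
  using fund0_eq[of 0 lam] by (simp_all add: numeral_3_eq_3)

lemma fund0_deriv:
  assumes "x \<in> {0..l}"
  shows "(fund 0 lam has_vector_derivative - \<i> * lam * fund 2 lam x) (at x within {0..l})"
proof (rule has_vector_derivative_transform[OF assms])
  show "fund 0 lam y = 1 + (- \<i> * lam) * fund 3 lam y" if "y \<in> {0..l}" for y
    using fund0_eq[of y lam] that by simp
  show "((\<lambda>y. 1 + (- \<i> * lam) * fund 3 lam y) has_vector_derivative - \<i> * lam * fund 2 lam x) (at x within {0..l})"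
    using has_vector_derivative_add[OF has_vector_derivative_const has_vector_derivative_mult_right[OF fund_deriv[OF assms, of 2 lam], of "- \<i> * lam"], of 1]
    by (simp add: numeral_3_eq_3 numeral_2_eq_2)
qed

lemma fund_derivs:
  assumes "x \<in> {0..l}"
  shows "(fund 1 lam has_vector_derivative fund 0 lam x) (at x within {0..l})"
    "(fund 2 lam has_vector_derivative fund 1 lam x) (at x within {0..l})"
  using fund_deriv[OF assms, of 0 lam] fund_deriv[OF assms, of 1 lam] by (simp_all add: numeral_2_eq_2)

lemma has_integral_FTC_0:
  fixes y :: "real \<Rightarrow> complex"
  assumes "\<And>x. x \<in> {0..l} \<Longrightarrow> (y has_vector_derivative y1 x) (at x within {0..l})" "x \<in> {0..l}"
  shows "(y1 has_integral (y x - y 0)) {0..x}"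
  using assms(2) by (intro fundamental_theorem_of_calculus has_vector_derivative_within_subset[OF assms(1)]) auto

lemma ivp_fund1: "ivp l lam (\<lambda>x. 0) (fund 1 lam) (fund 0 lam) (\<lambda>x. - \<i> * lam * fund 2 lam x)"
  unfolding ivp_def
proof (intro ballI conjI)
  fix x assume x: "x \<in> {0..l}"
  show "((\<lambda>t. - \<i> * 0 - \<i> * lam * fund 1 lam t) has_integral - \<i> * lam * fund 2 lam x - - \<i> * lam * fund 2 lam 0) {0..x}"
    using has_integral_FTC_0[of l "\<lambda>x. - \<i> * lam * fund 2 lam x" "\<lambda>x. - \<i> * lam * fund 1 lam x", OF has_vector_derivative_mult_right[OF fund_derivs(2)] x]
    by simp
qed (use fund_derivs fund0_deriv in auto)

lemma ivp_fund2: "ivp l lam (\<lambda>x. 0) (fund 2 lam) (fund 1 lam) (fund 0 lam)"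
  unfolding ivp_def
proof (intro ballI conjI)
  fix x assume x: "x \<in> {0..l}"
  show "((\<lambda>t. - \<i> * 0 - \<i> * lam * fund 2 lam t) has_integral fund 0 lam x - fund 0 lam 0) {0..x}"
    using has_integral_FTC_0[of l "fund 0 lam" "\<lambda>x. - \<i> * lam * fund 2 lam x", OF fund0_deriv x] by simp
qed (use fund_derivs in auto)

text \<open>The right-hand side f is only in L2, so the series is started from a continuous
  primitive of - i f; this is why y'' and not y''' is \<open>ser (prim f) 0\<close>.\<close>

definition prim :: "(real \<Rightarrow> complex) \<Rightarrow> real \<Rightarrow> complex" where
  "prim f x = integral {0..x} (\<lambda>t. - \<i> * f t)"

lemma prim_continuous: "L2 l f \<Longrightarrow> continuous_on {0..l} (prim f)"
  unfolding prim_def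
  by (intro indefinite_integral_continuous_1 L2_imp_integrable_on L2_cmult)

lemma ivp_particular:
  assumes "L2 l f"
  shows "ivp l lam f (ser (prim f) 2 lam) (ser (prim f) 1 lam) (ser (prim f) 0 lam)"
  unfolding ivp_def
proof (intro ballI conjI)
  note c = prim_continuous[OF assms]
  fix x assume x: "x \<in> {0..l}"
  show "(ser (prim f) 2 lam has_vector_derivative ser (prim f) 1 lam x) (at x within {0..l})"
    "(ser (prim f) 1 lam has_vector_derivative ser (prim f) 0 lam x) (at x within {0..l})"
    using ser_has_vector_derivative[OF c x, of 1 lam] ser_has_vector_derivative[OF c x, of 0 lam]
    by (simp_all add: numeral_2_eq_2)
  have "(\<lambda>t. - \<i> * f t) integrable_on {0..l}"
    by (intro L2_imp_integrable_on L2_cmult assms)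
  then have "(\<lambda>t. - \<i> * f t) integrable_on {0..x}"
    by (rule integrable_on_subinterval) (use x in auto)
  then have 1: "((\<lambda>t. - \<i> * f t) has_integral prim f x) {0..x}"
    unfolding prim_def by (rule integrable_integral)
  have 2: "((\<lambda>t. \<i> * lam * ser (prim f) 2 lam t) has_integral \<i> * lam * ser (prim f) 3 lam x) {0..x}"
    using has_integral_FTC_0[of l "\<lambda>x. \<i> * lam * ser (prim f) 3 lam x" "\<lambda>x. \<i> * lam * ser (prim f) 2 lam x", OF has_vector_derivative_mult_right x]
      ser_has_vector_derivative[OF c, of _ 2 lam] by (simp add: numeral_3_eq_3 numeral_2_eq_2)
  have "ser (prim f) 0 lam x - ser (prim f) 0 lam 0 = prim f x - \<i> * lam * ser (prim f) 3 lam x"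
    using ser_rec[OF c x] ser_rec[OF c, of 0] x by (simp add: prim_def numeral_3_eq_3)
  then show "((\<lambda>t. - \<i> * f t - \<i> * lam * ser (prim f) 2 lam t) has_integral ser (prim f) 0 lam x - ser (prim f) 0 lam 0) {0..x}"
    using has_integral_diff[OF 1 2] by simp
qed

text \<open>The two linear conditions are y(l) = 0 and y'(l) - y'(0) = 0. The -1 next to
  \<open>fund 0 lam l\<close> comes from y'(0) = a: the other two terms have derivative 0 at
  0.\<close>

lemma eqn_ansatz:
  assumes "0 \<le> l" "L2 l f"
    and "a * fund 1 lam l + b * fund 2 lam l + ser (prim f) 2 lam l = 0"
    and "a * (fund 0 lam l - 1) + b * fund 1 lam l + ser (prim f) 1 lam l = 0"
  shows "eqn l lam (\<lambda>x. a * fund 1 lam x + b * fund 2 lam x + ser (prim f) 2 lam x) f"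
proof -
  have i: "ivp l lam f (\<lambda>x. a * fund 1 lam x + b * fund 2 lam x + ser (prim f) 2 lam x)
    (\<lambda>x. a * fund 0 lam x + b * fund 1 lam x + ser (prim f) 1 lam x)
    (\<lambda>x. a * (- \<i> * lam * fund 2 lam x) + b * fund 0 lam x + ser (prim f) 0 lam x)"
    using ivp_lincomb[OF ivp_lincomb[OF ivp_fund1 ivp_fund2, where c=a and d=b] ivp_particular[OF assms(2)], where c=1 and d=1]
    by simp
  show ?thesis
    by (rule ivp_eqn[OF i assms(2)])
      (use assms(3,4) in \<open>auto simp: algebra_simps numeral_2_eq_2\<close>)
qed

lemma eqn_ansatz_homogeneous:
  assumes "0 \<le> l"
    and "a * fund 1 lam l + b * fund 2 lam l = 0" "a * (fund 0 lam l - 1) + b * fund 1 lam l = 0"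
  shows "eqn l lam (\<lambda>x. a * fund 1 lam x + b * fund 2 lam x) (\<lambda>x. 0)"
proof -
  have i: "ivp l lam (\<lambda>x. 0) (\<lambda>x. a * fund 1 lam x + b * fund 2 lam x)
    (\<lambda>x. a * fund 0 lam x + b * fund 1 lam x)
    (\<lambda>x. a * (- \<i> * lam * fund 2 lam x) + b * fund 0 lam x)"
    using ivp_lincomb[OF ivp_fund1 ivp_fund2, of l lam a b] by simp
  show ?thesis
    by (rule ivp_eqn[OF i])
      (use assms(2,3) in \<open>auto simp: algebra_simps numeral_2_eq_2\<close>)
qed

text \<open>If the combination y vanishes identically, so do y' and y'', and at 0 these equal a and
  b.\<close>

lemma fund_combination_nonnull:
  assumes "0 < l" "ae_eq l (\<lambda>x. a * fund 1 lam x + b * fund 2 lam x) (\<lambda>x. 0)"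
  shows "a = 0 \<and> b = 0"
proof -
  have i: "ivp l lam (\<lambda>x. 0) (\<lambda>x. a * fund 1 lam x + b * fund 2 lam x)
    (\<lambda>x. a * fund 0 lam x + b * fund 1 lam x)
    (\<lambda>x. a * (- \<i> * lam * fund 2 lam x) + b * fund 0 lam x)"
    using ivp_lincomb[OF ivp_fund1 ivp_fund2, of l lam a b] by simp
  have z: "w x = 0" if "\<And>x. x \<in> {0..l} \<Longrightarrow> (y has_vector_derivative w x) (at x within {0..l})"
    "\<And>x. x \<in> {0..l} \<Longrightarrow> y x = 0" "x \<in> {0..l}" for w y :: "real \<Rightarrow> complex" and x
  proof (rule vector_derivative_unique_within_closed_interval[of 0 l x y])
    show "(y has_vector_derivative w x) (at x within cbox 0 l)" using that by simp
    show "(y has_vector_derivative 0) (at x within cbox 0 l)"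
      by (rule has_vector_derivative_transform[OF _ _ has_vector_derivative_const]) (use that in auto)
  qed (use assms that in auto)
  have "continuous_on {0..l} (\<lambda>x. a * fund 1 lam x + b * fund 2 lam x)"
    by (intro continuous_intros ser_continuous)
  then have 0: "a * fund 1 lam x + b * fund 2 lam x = 0" if "x \<in> {0..l}" for x
    using continuous_ae_eq_0[OF assms(1) _ assms(2)] that by blast
  have 1: "a * fund 0 lam x + b * fund 1 lam x = 0" if "x \<in> {0..l}" for x
    using z[of "\<lambda>x. a * fund 1 lam x + b * fund 2 lam x" "\<lambda>x. a * fund 0 lam x + b * fund 1 lam x" x] 0 that i
    unfolding ivp_def by blast
  have 2: "a * (- \<i> * lam * fund 2 lam x) + b * fund 0 lam x = 0" if "x \<in> {0..l}" for x
    using z[of "\<lambda>x. a * fund 0 lam x + b * fund 1 lam x" "\<lambda>x. a * (- \<i> * lam * fund 2 lam x) + b * fund 0 lam x" x] 1 that i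
    unfolding ivp_def by blast
  show ?thesis using 1[of 0] 2[of 0] assms by (simp add: numeral_2_eq_2)
qed

text \<open>The determinant of the boundary conditions for the ansatz a fund 1 + b fund 2; its zeros are the
  eigenvalues of L_0.\<close>

definition char_det :: "real \<Rightarrow> complex \<Rightarrow> complex" where
  "char_det l lam = (fund 1 lam l)\<^sup>2 - fund 2 lam l * (fund 0 lam l - 1)"

text \<open>Cramer's rule for the conditions of \<open>eqn_ansatz\<close>, multiplied through by
  \<open>char_det\<close>. Without a division its pairings remain entire in lam, also at the
  eigenvalues of \<open>L_0\<close>.\<close>

definition res_num :: "real \<Rightarrow> complex \<Rightarrow> (real \<Rightarrow> complex) \<Rightarrow> real \<Rightarrow> complex" where
  "res_num l lam f x =
     (ser (prim f) 1 lam l * fund 2 lam l - ser (prim f) 2 lam l * fund 1 lam l) * fund 1 lam x +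
     ((fund 0 lam l - 1) * ser (prim f) 2 lam l - fund 1 lam l * ser (prim f) 1 lam l) * fund 2 lam x +
     char_det l lam * ser (prim f) 2 lam x"

text \<open>At a zero of \<open>char_det\<close> this is 0, since \<open>inverse 0 = 0\<close>; the
  equation of \<open>eqn_res\<close> is claimed only elsewhere.\<close>

definition res :: "real \<Rightarrow> complex \<Rightarrow> (real \<Rightarrow> complex) \<Rightarrow> real \<Rightarrow> complex" where
  "res l lam f x = inverse (char_det l lam) * res_num l lam f x"

lemma eqn_res:
  assumes "0 \<le> l" "L2 l f" "char_det l lam \<noteq> 0"
  shows "eqn l lam (res l lam f) f"
proof -
  let ?a = "inverse (char_det l lam) * (ser (prim f) 1 lam l * fund 2 lam l - ser (prim f) 2 lam l * fund 1 lam l)"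
  let ?b = "inverse (char_det l lam) * ((fund 0 lam l - 1) * ser (prim f) 2 lam l - fund 1 lam l * ser (prim f) 1 lam l)"
  have "res l lam f = (\<lambda>x. ?a * fund 1 lam x + ?b * fund 2 lam x + ser (prim f) 2 lam x)"
    using assms(3) by (auto simp: res_def res_num_def field_simps)
  moreover have "eqn l lam (\<lambda>x. ?a * fund 1 lam x + ?b * fund 2 lam x + ser (prim f) 2 lam x) f"
  proof (rule eqn_ansatz[OF assms(1,2)])
    have "char_det l lam * (?a * fund 1 lam l + ?b * fund 2 lam l + ser (prim f) 2 lam l) = 0"
      using assms(3) by (simp add: field_simps) (simp add: char_det_def power2_eq_square algebra_simps)
    then show "?a * fund 1 lam l + ?b * fund 2 lam l + ser (prim f) 2 lam l = 0" using assms by simp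
    have "char_det l lam * (?a * (fund 0 lam l - 1) + ?b * fund 1 lam l + ser (prim f) 1 lam l) = 0"
      using assms(3) by (simp add: field_simps) (simp add: char_det_def power2_eq_square algebra_simps)
    then show "?a * (fund 0 lam l - 1) + ?b * fund 1 lam l + ser (prim f) 1 lam l = 0" using assms by simp
  qed
  ultimately show ?thesis by simp
qed

lemma fund_holomorphic: "0 \<le> l \<Longrightarrow> (\<lambda>lam. fund k lam l) holomorphic_on UNIV"
  by (rule ser_holomorphic[of l]) auto

lemma char_det_holomorphic: "0 \<le> l \<Longrightarrow> char_det l holomorphic_on UNIV"
  unfolding char_det_def by (intro holomorphic_intros fund_holomorphic)

lemma ip_res_num_holomorphic:
  assumes "0 \<le> l" "L2 l f" "L2 l w"
  shows "(\<lambda>lam. ip l (res_num l lam f) w) holomorphic_on UNIV"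
proof -
  note c = prim_continuous[OF assms(2)]
  have L: "L2 l (fund k lam)" "L2 l (ser (prim f) k lam)" for k lam
    by (auto intro!: L2_ser c)
  have eq: "ip l (res_num l lam f) w = 
     (ser (prim f) 1 lam l * fund 2 lam l - ser (prim f) 2 lam l * fund 1 lam l) * ip l (fund 1 lam) w +
     ((fund 0 lam l - 1) * ser (prim f) 2 lam l - fund 1 lam l * ser (prim f) 1 lam l) * ip l (fund 2 lam) w +
     char_det l lam * ip l (ser (prim f) 2 lam) w" for lam
    unfolding res_num_def using L assms(3) by (simp add: ip_add_left)
  have "(\<lambda>lam. ip l (fund k lam) w) holomorphic_on UNIV" for k
    by (intro ip_ser_holomorphic assms) auto
  moreover have "(\<lambda>lam. ser (prim f) k lam l) holomorphic_on UNIV" for k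
    using assms by (intro ser_holomorphic[OF c]) auto
  ultimately show ?thesis
    unfolding eq using assms by (intro holomorphic_intros fund_holomorphic char_det_holomorphic ip_ser_holomorphic c continuous_on_const)
qed

text \<open>The vector orthogonal to the first row of a singular matrix also annihilates the second
  row. If the first row is zero, the second is a multiple of (1, 0) and the vector (0, 1)
  works.\<close>

lemma char_det_eq_0_kernel:
  assumes "char_det l lam = 0"
  obtains a b where "a \<noteq> 0 \<or> b \<noteq> 0" "a * fund 1 lam l + b * fund 2 lam l = 0"
    "a * (fund 0 lam l - 1) + b * fund 1 lam l = 0"
proof (cases "fund 1 lam l = 0 \<and> fund 2 lam l = 0")
  case True
  then show ?thesis using that[of 0 1] by simp
next
  case False
  then show ?thesis
    using that[of "fund 2 lam l" "- fund 1 lam l"] assms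
    by (auto simp: char_det_def power2_eq_square algebra_simps)
qed

section \<open>Rank of the boundary matrix at real points\<close>

lemma ser_lam_0: "ser u k 0 x = iint u k x"
  using powser_zero[of "\<lambda>n. iint u (3 * n + k) x"] by (simp add: ser_def mult.commute)

lemma fund1_lam_0: "0 \<le> l \<Longrightarrow> fund 1 0 l = of_real l"
  by (simp add: ser_lam_0 scaleR_conv_of_real)

text \<open>For a cube root k of - i lam the function exp (k x) solves the homogeneous equation with
  initial data 1, k, k^2. The proof divides the right-hand side by exp (k x) and finds derivative
  0.\<close>

lemma exp_eq_fund:
  assumes "k ^ 3 = - \<i> * lam" "0 \<le> l"
  shows "exp (k * of_real l) = fund 0 lam l + k * fund 1 lam l + k\<^sup>2 * fund 2 lam l"
proof -
  let ?G = "\<lambda>x. (fund 0 lam x + k * fund 1 lam x + k\<^sup>2 * fund 2 lam x) * exp (- k * of_real x)"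
  have "(?G has_vector_derivative 0) (at x within {0..l})" if x: "x \<in> {0..l}" for x
  proof -
    have d: "((\<lambda>x. exp (- k * of_real x)) has_vector_derivative exp (- k * of_real x) * (- k)) (at x within {0..l})"
      by (rule has_vector_derivative_real_field) (auto intro!: derivative_eq_intros)
    have "((\<lambda>x. fund 0 lam x + k * fund 1 lam x + k\<^sup>2 * fund 2 lam x) has_vector_derivative
        (- \<i> * lam * fund 2 lam x + k * fund 0 lam x + k\<^sup>2 * fund 1 lam x)) (at x within {0..l})"
      by (intro has_vector_derivative_add has_vector_derivative_mult_right fund_derivs fund0_deriv x)
    also have "- \<i> * lam * fund 2 lam x + k * fund 0 lam x + k\<^sup>2 * fund 1 lam x = k * (fund 0 lam x + k * fund 1 lam x + k\<^sup>2 * fund 2 lam x)"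
      unfolding assms(1)[symmetric] by (simp add: power2_eq_square power3_eq_cube algebra_simps)
    finally show ?thesis
      using has_vector_derivative_mult[OF _ d] by (force simp: algebra_simps)
  qed
  then obtain c where c: "\<And>x. x \<in> {0..l} \<Longrightarrow> ?G x = c"
    using has_vector_derivative_zero_constant[of "{0..l}" ?G] by auto
  have "?G l = ?G 0" using c[of l] c[of 0] assms by simp
  also have "?G 0 = 1" by (simp add: numeral_2_eq_2)
  finally have "?G l = 1" .
  moreover have "exp (- k * of_real l) * exp (k * of_real l) = 1"
    by (simp add: exp_add[symmetric])
  ultimately have "1 * exp (k * of_real l) = (fund 0 lam l + k * fund 1 lam l + k\<^sup>2 * fund 2 lam l) * 1"
    by (metis mult.assoc)
  then show ?thesis by simp
qed

text \<open>Otherwise exp (k l) = 1 for every cube root k of - i lam, but one of these roots is not imaginary.\<close>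

lemma fund_not_all_periodic:
  assumes "0 < l" "lam = complex_of_real r"
  shows "\<not> (fund 1 lam l = 0 \<and> fund 2 lam l = 0 \<and> fund 0 lam l = 1)"
proof
  assume *: "fund 1 lam l = 0 \<and> fund 2 lam l = 0 \<and> fund 0 lam l = 1"
  show False
  proof (cases "r = 0")
    case True
    then show False using * fund1_lam_0[of l] assms by simp
  next
    case False
    define \<mu> where "\<mu> = root 3 r"
    have \<mu>: "\<mu> ^ 3 = r" "\<mu> \<noteq> 0" using False by (auto simp: \<mu>_def odd_real_root_pow)
    \<comment> \<open>The cube root \<open>\<mu>\<close> exp (7 pi i / 6) of - i r. Its real part is
      not 0, so exp (k l) cannot have modulus 1.\<close>
    define k where "k = Complex (- \<mu> * sqrt 3 / 2) (- \<mu> / 2)"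
    have "k ^ 3 = - \<i> * complex_of_real (\<mu> ^ 3)"
      unfolding k_def power3_eq_cube by (simp add: complex_eq_iff field_simps)
    then have "k ^ 3 = - \<i> * lam" using \<mu> assms by simp
    then have "exp (k * of_real l) = 1"
      using exp_eq_fund[of k lam l] * assms by simp
    then have "exp (Re (k * of_real l)) = 1"
      by (metis norm_exp_eq_Re norm_one)
    then show False using \<mu> assms by (simp add: k_def)
  qed
qed

text \<open>A nonzero matrix has cokernel of dimension at most one in C^2, so of two right-hand
  sides some nontrivial combination is solvable. One nonzero column already suffices; the other
  unknown is set to 0.\<close>

lemma linear_system_solvable_combination:
  fixes A B C p p1 q q1 :: complex
  assumes "\<not> (A = 0 \<and> B = 0 \<and> C = 0)"
  obtains a b s t where "s \<noteq> 0 \<or> t \<noteq> 0" "a * A + b * B + (s * p + t * q) = 0" "a * C + b * A + (s * p1 + t * q1) = 0"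
proof -
  have gen: "\<exists>a s t. (s \<noteq> 0 \<or> t \<noteq> 0) \<and> a * u + (s * p + t * q) = 0 \<and> a * v + (s * p1 + t * q1) = 0"
    if "u \<noteq> 0 \<or> v \<noteq> 0" for u v
  proof -
    \<comment> \<open>A right-hand side is a multiple of the nonzero column (u, v) iff this
      determinant vanishes; two numbers always have a nontrivial combination equal to 0.\<close>
    define df dh where "df = p * v - p1 * u" and "dh = q * v - q1 * u"
    obtain s t where st: "s \<noteq> 0 \<or> t \<noteq> 0" "s * df + t * dh = 0"
    proof (cases "df = 0 \<and> dh = 0")
      case True then show ?thesis using that[of 1 0] by simp
    next
      case False then show ?thesis using that[of dh "- df"] by (auto simp: algebra_simps)
    qed
    then have e: "v * (s * p + t * q) = u * (s * p1 + t * q1)"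
      by (simp add: df_def dh_def algebra_simps)
    show ?thesis
    proof (cases "u = 0")
      case False
      then show ?thesis using st e
        by (intro exI[of _ "- (s * p + t * q) / u"] exI[of _ s] exI[of _ t]) (auto simp: field_simps)
    next
      case True
      then have v: "v \<noteq> 0" using that by simp
      then have "s * p + t * q = 0" using e True by simp
      then show ?thesis using st v True
        by (intro exI[of _ "- (s * p1 + t * q1) / v"] exI[of _ s] exI[of _ t]) (auto simp: field_simps)
    qed
  qed
  show ?thesis
  proof (cases "A \<noteq> 0 \<or> C \<noteq> 0")
    case True
    then show ?thesis using gen[of A C] that[of _ _ _ 0] by auto
  next
    case False
    then show ?thesis using gen[of B A] that[of _ _ 0] assms by auto
  qed
qed

text \<open>The boundary matrix has rank at least one at real points, so the range of L_0 - r has codimension at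
  most one.\<close>

lemma eqn_range_codim:
  assumes l: "0 < l" and "L2 l f" "L2 l h"
  obtains s t y where "s \<noteq> 0 \<or> t \<noteq> 0" "eqn l (complex_of_real r) y (\<lambda>x. s * f x + t * h x)"
proof -
  let ?r = "complex_of_real r"
  obtain a b s t where st: "s \<noteq> 0 \<or> t \<noteq> 0"
    "a * fund 1 ?r l + b * fund 2 ?r l + (s * ser (prim f) 2 ?r l + t * ser (prim h) 2 ?r l) = 0"
    "a * (fund 0 ?r l - 1) + b * fund 1 ?r l + (s * ser (prim f) 1 ?r l + t * ser (prim h) 1 ?r l) = 0"
    using linear_system_solvable_combination[of "fund 1 ?r l" "fund 2 ?r l" "fund 0 ?r l - 1"] fund_not_all_periodic[OF l refl, of r]
    by (metis (no_types, lifting) eq_iff_diff_eq_0)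
  have i: "ivp l ?r (\<lambda>x. s * f x + t * h x)
     (\<lambda>x. (a * fund 1 ?r x + b * fund 2 ?r x) + (s * ser (prim f) 2 ?r x + t * ser (prim h) 2 ?r x))
     (\<lambda>x. (a * fund 0 ?r x + b * fund 1 ?r x) + (s * ser (prim f) 1 ?r x + t * ser (prim h) 1 ?r x))
     (\<lambda>x. (a * (- \<i> * ?r * fund 2 ?r x) + b * fund 0 ?r x) + (s * ser (prim f) 0 ?r x + t * ser (prim h) 0 ?r x))"
    using ivp_lincomb[OF ivp_lincomb[OF ivp_fund1 ivp_fund2, where c=a and d=b]
        ivp_lincomb[OF ivp_particular[OF assms(2)] ivp_particular[OF assms(3)], where c=s and d=t], where c=1 and d=1]
    by simp
  have "eqn l ?r (\<lambda>x. (a * fund 1 ?r x + b * fund 2 ?r x) + (s * ser (prim f) 2 ?r x + t * ser (prim h) 2 ?r x)) (\<lambda>x. s * f x + t * h x)"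
    by (rule ivp_eqn[OF i]) (use st assms in \<open>auto simp: algebra_simps numeral_2_eq_2\<close>)
  then show ?thesis using that st by blast
qed

section \<open>Kernel and range of L_0 - r for real r\<close>

lemma eqn_range_perp_kernel:
  assumes "0 \<le> l" "eqn l (complex_of_real r) \<phi> (\<lambda>x. 0)" "eqn l (complex_of_real r) y f" "L2 l f"
  shows "ip l f \<phi> = 0" "ip l \<phi> f = 0"
proof -
  show "ip l f \<phi> = 0"
    using eqn_symmetric[OF assms(1,3,2,4)] by simp
  then show "ip l \<phi> f = 0" by (simp add: ip_cnj[of l \<phi>])
qed

text \<open>A Fredholm alternative: some nontrivial \<open>s * w + t * \<phi>\<close> lies in the
  range, and pairing with \<open>\<phi>\<close> forces \<open>t = 0\<close>. Removing the component
  along \<open>\<phi>\<close> from the solution allows the lemma to be applied again to the solution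
  itself.\<close>

lemma eqn_perp_kernel_solvable:
  assumes l: "0 < l" and \<phi>: "eqn l (complex_of_real r) \<phi> (\<lambda>x. 0)" "nsq l \<phi> \<noteq> 0"
    and w: "L2 l w" "ip l w \<phi> = 0"
  obtains z where "eqn l (complex_of_real r) z w" "ip l z \<phi> = 0"
proof -
  have L: "L2 l \<phi>" using \<phi> eqn_L2 by blast
  obtain s t y where st: "s \<noteq> 0 \<or> t \<noteq> 0" "eqn l (complex_of_real r) y (\<lambda>x. s * w x + t * \<phi> x)"
    using eqn_range_codim[OF l w(1) L] by blast
  have "ip l (\<lambda>x. s * w x + t * \<phi> x) \<phi> = 0"
    using eqn_range_perp_kernel(1)[OF _ \<phi>(1) st(2)] l w L by simp
  then have "t = 0" using w L \<phi> by (simp add: ip_add_left ip_self)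
  then have s: "s \<noteq> 0" using st by simp
  have 1: "eqn l (complex_of_real r) (\<lambda>x. inverse s * y x) w"
    using eqn_cmult[OF st(2), of "inverse s"] s \<open>t = 0\<close> by (simp add: mult.assoc[symmetric])
  define z0 where "z0 = (\<lambda>x. inverse s * y x)"
  define c where "c = ip l z0 \<phi> / nsq l \<phi>"
  have z0: "eqn l (complex_of_real r) z0 w" "L2 l z0" using 1 eqn_L2 by (auto simp: z0_def)
  show ?thesis
  proof
    show "eqn l (complex_of_real r) (\<lambda>x. z0 x + (- c) * \<phi> x) w"
      using eqn_lincomb[OF z0(1) \<phi>(1), of 1 "- c"] by simp
    have "ip l (\<lambda>x. z0 x + (- c) * \<phi> x) \<phi> = ip l z0 \<phi> + (- c) * ip l \<phi> \<phi>"
      using ip_add_left[OF z0(2) L2_cmult[OF L] L] ip_cmult_left by metis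
    then show "ip l (\<lambda>x. z0 x + (- c) * \<phi> x) \<phi> = 0"
      using \<phi>(2) by (simp add: ip_self c_def)
  qed
qed

text \<open>Eigenvalues are simple: if the component of \<open>\<psi>\<close> orthogonal to
  \<open>\<phi>\<close> were not null, the range would be orthogonal to two independent functions,
  against \<open>eqn_range_codim\<close>.\<close>

lemma kernel_dim_le_1:
  assumes l: "0 < l" and \<phi>: "eqn l (complex_of_real r) \<phi> (\<lambda>x. 0)" "nsq l \<phi> \<noteq> 0"
    and \<psi>: "eqn l (complex_of_real r) \<psi> (\<lambda>x. 0)"
  obtains c where "ae_eq l \<psi> (\<lambda>x. c * \<phi> x)"
proof -
  have L: "L2 l \<phi>" "L2 l \<psi>" using \<phi> \<psi> eqn_L2 by blast+
  define c where "c = ip l \<psi> \<phi> / nsq l \<phi>"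
  define \<xi> where "\<xi> = (\<lambda>x. \<psi> x + (- c) * \<phi> x)"
  have X: "eqn l (complex_of_real r) \<xi> (\<lambda>x. 0)"
    unfolding \<xi>_def using eqn_lincomb[OF \<psi> \<phi>(1), of 1 "- c"] by simp
  have LX: "L2 l \<xi>" using X eqn_L2 by blast
  have "ip l \<xi> \<phi> = ip l \<psi> \<phi> + (- c) * ip l \<phi> \<phi>"
    unfolding \<xi>_def using ip_add_left[OF L(2) L2_cmult[OF L(1)] L(1)] ip_cmult_left by metis
  then have p: "ip l \<xi> \<phi> = 0" "ip l \<phi> \<xi> = 0"
    using \<phi>(2) by (auto simp: ip_self c_def ip_cnj[of l \<phi> \<xi>])
  have "nsq l \<xi> = 0"
  proof (rule ccontr)
    assume n: "nsq l \<xi> \<noteq> 0"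
    obtain s t y where st: "s \<noteq> 0 \<or> t \<noteq> 0" "eqn l (complex_of_real r) y (\<lambda>x. s * \<phi> x + t * \<xi> x)"
      using eqn_range_codim[OF l L(1) LX] by blast
    have "ip l (\<lambda>x. s * \<phi> x + t * \<xi> x) \<phi> = 0" "ip l (\<lambda>x. s * \<phi> x + t * \<xi> x) \<xi> = 0"
      using eqn_range_perp_kernel(1)[OF _ \<phi>(1) st(2)] eqn_range_perp_kernel(1)[OF _ X st(2)] l L LX by simp_all
    then show False using st n \<phi>(2) p L LX by (simp add: ip_add_left ip_self)
  qed
  then have "ae_eq l \<xi> (\<lambda>x. 0)" using nsq_eq_0_imp[OF LX] by simp
  then have "ae_eq l \<psi> (\<lambda>x. c * \<phi> x)"
    unfolding \<xi>_def ae_eq_def by (auto elim: eventually_mono)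
  then show ?thesis by (rule that)
qed

lemma char_det_eq_0_eigenfunction:
  assumes "0 < l" "char_det l lam = 0"
  obtains a b where "a \<noteq> 0 \<or> b \<noteq> 0" "a * fund 1 lam l + b * fund 2 lam l = 0"
    "a * (fund 0 lam l - 1) + b * fund 1 lam l = 0"
    "eqn l lam (\<lambda>x. a * fund 1 lam x + b * fund 2 lam x) (\<lambda>x. 0)"
    "nsq l (\<lambda>x. a * fund 1 lam x + b * fund 2 lam x) \<noteq> 0"
proof -
  obtain a b where ab: "a \<noteq> 0 \<or> b \<noteq> 0" "a * fund 1 lam l + b * fund 2 lam l = 0"
    "a * (fund 0 lam l - 1) + b * fund 1 lam l = 0"
    using char_det_eq_0_kernel[OF assms(2)] by blast
  have e: "eqn l lam (\<lambda>x. a * fund 1 lam x + b * fund 2 lam x) (\<lambda>x. 0)"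
    using assms ab by (intro eqn_ansatz_homogeneous) auto
  have "nsq l (\<lambda>x. a * fund 1 lam x + b * fund 2 lam x) \<noteq> 0"
    using fund_combination_nonnull[OF assms(1)] nsq_eq_0_imp[OF eqn_L2[OF e]] ab(1) by blast
  then show ?thesis using that ab e by blast
qed

section \<open>Estimates off the real axis\<close>

lemma eqn_Im_ip:
  assumes "0 \<le> l" "eqn l lam y f" "L2 l f"
  shows "Im (ip l y f) = Im lam * nsq l y"
proof -
  have "ip l f y + lam * of_real (nsq l y) = ip l y f + cnj lam * of_real (nsq l y)"
    using eqn_symmetric[OF assms(1,2,2,3,3)] by (simp add: ip_self)
  moreover have "ip l f y = cnj (ip l y f)" by (rule ip_cnj)
  ultimately show ?thesis by (simp add: complex_eq_iff)
qed

text \<open>\<open>eqn_Im_ip\<close> is squared and combined with Cauchy-Schwarz; one factor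
  \<open>nsq l y\<close> is then divided out, which is why null y is treated apart.\<close>

lemma eqn_nsq_bound:
  assumes "0 \<le> l" "eqn l lam y f" "L2 l f"
  shows "(Im lam)\<^sup>2 * nsq l y \<le> nsq l f"
proof (cases "nsq l y = 0")
  case False
  then have p: "nsq l y > 0" using nsq_nonneg[of l y] by linarith
  have "(Im lam)\<^sup>2 * nsq l y * nsq l y = (Im (ip l y f))\<^sup>2"
    using eqn_Im_ip[OF assms] by (simp add: power2_eq_square)
  also have "\<dots> \<le> (cmod (ip l y f))\<^sup>2"
    using abs_Im_le_cmod abs_le_square_iff by (metis abs_norm_cancel)
  also have "\<dots> \<le> nsq l y * nsq l f"
    by (rule Cauchy_Schwarz_ip[OF eqn_L2[OF assms(2)] assms(3)])
  finally show ?thesis using p by (simp add: mult.commute)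
qed simp

lemma eqn_ip_bound:
  assumes "0 \<le> l" "eqn l lam y f" "L2 l f" "L2 l w"
  shows "\<bar>Im lam\<bar> * cmod (ip l y w) \<le> sqrt (nsq l f * nsq l w)"
proof (rule real_le_rsqrt)
  have "(\<bar>Im lam\<bar> * cmod (ip l y w))\<^sup>2 = (Im lam)\<^sup>2 * (cmod (ip l y w))\<^sup>2"
    by (simp add: power_mult_distrib)
  also have "\<dots> \<le> (Im lam)\<^sup>2 * (nsq l y * nsq l w)"
    using Cauchy_Schwarz_ip[OF eqn_L2[OF assms(2)] assms(4)] by (intro mult_left_mono) auto
  also have "\<dots> \<le> nsq l f * nsq l w"
    using mult_right_mono[OF eqn_nsq_bound[OF assms(1-3)], of "nsq l w"] by simp
  finally show "(\<bar>Im lam\<bar> * cmod (ip l y w))\<^sup>2 \<le> nsq l f * nsq l w" .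
qed

lemma char_det_nonreal:
  assumes "0 < l" "Im lam \<noteq> 0"
  shows "char_det l lam \<noteq> 0"
proof
  assume "char_det l lam = 0"
  then obtain a b where "eqn l lam (\<lambda>x. a * fund 1 lam x + b * fund 2 lam x) (\<lambda>x. 0)"
    "nsq l (\<lambda>x. a * fund 1 lam x + b * fund 2 lam x) \<noteq> 0"
    using char_det_eq_0_eigenfunction[OF assms(1)] by blast
  then show False
    using eqn_Im_ip[of l lam _ "\<lambda>x. 0"] assms by auto
qed

lemma eqn_res_nonreal:
  "0 < l \<Longrightarrow> Im lam \<noteq> 0 \<Longrightarrow> L2 l f \<Longrightarrow> eqn l lam (res l lam f) f"
  using eqn_res[of l f lam] char_det_nonreal[of l lam] by simp

text \<open>The difference of two solutions has right-hand side 0, and \<open>eqn_ip_bound\<close>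
  then bounds its pairing by 0. Any solution found by hand can thus replace \<open>res\<close>
  inside a pairing.\<close>

lemma eqn_unique_ip:
  assumes "0 < l" "Im lam \<noteq> 0" "eqn l lam y f" "eqn l lam z f" "L2 l w"
  shows "ip l y w = ip l z w"
proof -
  have "eqn l lam (\<lambda>x. 1 * y x + (- 1) * z x) (\<lambda>x. 0)"
    using eqn_lincomb[OF assms(3,4), of 1 "- 1"] by simp
  from eqn_ip_bound[OF _ this _ assms(5)] have "ip l (\<lambda>x. y x - z x) w = 0"
    using assms nsq_cmult[of l 0] by (simp add: mult_le_0_iff)
  then show ?thesis using eqn_L2[OF assms(3)] eqn_L2[OF assms(4)] assms by (simp add: ip_diff_left)
qed

text \<open>Integration by parts turns orthogonality to l - x into y''(0) = 0, and |y''|^2 - 2 lam Im (y cnj y') is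
  constant, so also y''(l) = 0; then every solution would be periodic.\<close>

lemma ip_eigenfunction_linear_nonzero:
  assumes l: "0 < l" and lam: "lam = complex_of_real r"
    and ab: "a \<noteq> 0 \<or> b \<noteq> 0" "a * fund 1 lam l + b * fund 2 lam l = 0" "a * (fund 0 lam l - 1) + b * fund 1 lam l = 0"
  shows "ip l (\<lambda>x. a * fund 1 lam x + b * fund 2 lam x) (\<lambda>x. complex_of_real (l - x)) \<noteq> 0"
proof
  assume 0: "ip l (\<lambda>x. a * fund 1 lam x + b * fund 2 lam x) (\<lambda>x. complex_of_real (l - x)) = 0"
  define y y1 y2 where "y = (\<lambda>x. a * fund 1 lam x + b * fund 2 lam x)"
    and "y1 = (\<lambda>x. a * fund 0 lam x + b * fund 1 lam x)"
    and "y2 = (\<lambda>x. a * (- \<i> * lam * fund 2 lam x) + b * fund 0 lam x)"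
  have dy: "(y has_vector_derivative y1 x) (at x within {0..l})"
    "(y1 has_vector_derivative y2 x) (at x within {0..l})"
    "(y2 has_vector_derivative - \<i> * lam * y x) (at x within {0..l})" if x: "x \<in> {0..l}" for x
  proof -
    show "(y has_vector_derivative y1 x) (at x within {0..l})"
      "(y1 has_vector_derivative y2 x) (at x within {0..l})"
      unfolding y_def y1_def y2_def
      by (intro has_vector_derivative_add has_vector_derivative_mult_right fund_derivs fund0_deriv x)+
    have "(y2 has_vector_derivative a * (- \<i> * lam * fund 1 lam x) + b * (- \<i> * lam * fund 2 lam x)) (at x within {0..l})"
      unfolding y2_def
      by (intro has_vector_derivative_add has_vector_derivative_mult_right fund_derivs fund0_deriv x)
    then show "(y2 has_vector_derivative - \<i> * lam * y x) (at x within {0..l})"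
      by (simp add: y_def algebra_simps)
  qed
  have cy: "continuous_on {0..l} y" "continuous_on {0..l} y2"
    using dy has_vector_derivative_imp_continuous_on[of "{0..l}" y y1]
      has_vector_derivative_imp_continuous_on[of "{0..l}" y2 "\<lambda>x. - \<i> * lam * y x"] by auto
  have v: "y 0 = 0" "y l = 0" "y1 0 = y1 l" "y2 0 = b"
    using ab by (simp_all add: y_def y1_def y2_def numeral_2_eq_2 algebra_simps)
  have "integral {0..l} (\<lambda>x. (- \<i> * lam * y x) * complex_of_real (l - x)) =
      y2 l * complex_of_real (l - l) - y2 0 * complex_of_real (l - 0) - integral {0..l} (\<lambda>x. y2 x * (- 1))"
  proof (rule ibp_L2)
    show "L2 l (\<lambda>x. - \<i> * lam * y x)" by (intro L2_cmult L2_continuous cy)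
    show "((\<lambda>x. - \<i> * lam * y x) has_integral y2 x - y2 0) {0..x}" if "x \<in> {0..l}" for x
      by (rule has_integral_FTC_0[OF dy(3) that])
    show "((\<lambda>x. complex_of_real (l - x)) has_vector_derivative - 1) (at x within {0..l})" for x
      by (rule has_vector_derivative_eq_rhs)
         (auto intro!: derivative_eq_intros has_vector_derivative_of_real simp: has_real_derivative_iff_has_vector_derivative[symmetric])
  qed (use l in auto)
  moreover have "integral {0..l} y2 = y1 l - y1 0"
    using has_integral_FTC_0[OF dy(2), of l] l by (intro integral_unique) auto
  moreover have "integral {0..l} (\<lambda>x. (- \<i> * lam * y x) * complex_of_real (l - x)) = 0"
  proof -
    have "integral {0..l} (\<lambda>x. (- \<i> * lam * y x) * complex_of_real (l - x))
      = ip l (\<lambda>x. - \<i> * lam * y x) (\<lambda>x. complex_of_real (l - x))"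
      by (subst ip_eq_integral) (auto intro!: L2_cmult L2_continuous cy continuous_intros simp del: of_real_diff)
    also have "\<dots> = - \<i> * lam * ip l y (\<lambda>x. complex_of_real (l - x))" by (rule ip_cmult_left)
    finally show ?thesis using 0 by (simp add: y_def)
  qed
  ultimately have b: "b = 0" using v l by simp
  then have a: "a \<noteq> 0" "fund 1 lam l = 0" "fund 0 lam l = 1" using ab by auto
  let ?G = "\<lambda>x. y2 x * cnj (y2 x) + \<i> * lam * (y x * cnj (y1 x) - cnj (y x) * y1 x)"
  have "(?G has_vector_derivative 0) (at x within {0..l})" if x: "x \<in> {0..l}" for x
  proof -
    note d = dy[OF x] has_vector_derivative_cnj'[OF dy(1)[OF x]] has_vector_derivative_cnj'[OF dy(2)[OF x]]
      has_vector_derivative_cnj'[OF dy(3)[OF x]]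
    show ?thesis
      by (rule has_vector_derivative_eq_rhs[OF has_vector_derivative_add[OF has_vector_derivative_mult[OF d(3,6)]
            has_vector_derivative_mult_right[OF has_vector_derivative_diff[OF has_vector_derivative_mult[OF d(1,5)]
                has_vector_derivative_mult[OF d(4,2)]]]]])
        (simp add: lam algebra_simps)
  qed
  then obtain c where c: "\<And>x. x \<in> {0..l} \<Longrightarrow> ?G x = c"
    using has_vector_derivative_zero_constant[of "{0..l}" ?G] by auto
  \<comment> \<open>As y vanishes at both ends, \<open>?G\<close> reduces there to |y''|^2, and
    y''(0) = b = 0.\<close>
  have "?G l = ?G 0" using c[of l] c[of 0] l by simp
  then have "y2 l = 0" using v b by simp
  then have "lam * fund 2 lam l = 0" using a b by (simp add: y2_def)
  moreover have "lam \<noteq> 0" using a fund1_lam_0[of l] l by auto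
  ultimately show False using fund_not_all_periodic[OF l lam] a by simp
qed

section \<open>The quadratic form of the resolvent\<close>

definition rform :: "real \<Rightarrow> (real \<Rightarrow> complex) \<Rightarrow> complex \<Rightarrow> complex" where
  "rform l w lam = ip l (res l lam w) w"

lemma rform_eq: "rform l w lam = ip l (res_num l lam w) w / char_det l lam"
  by (simp add: rform_def res_def[abs_def] divide_inverse mult.commute)

text \<open>Cauchy-Schwarz bounds |F_w|^2 by |R(lam) w|^2 |w|^2, and |Im lam| |R(lam) w|^2 equals
  |Im F_w|.\<close>

lemma rform_Herglotz:
  assumes "0 < l" "Im lam \<noteq> 0" "L2 l w"
  shows "\<bar>Im lam\<bar> * (cmod (rform l w lam))\<^sup>2 \<le> nsq l w * \<bar>Im (rform l w lam)\<bar>"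
proof -
  note e = eqn_res_nonreal[OF assms]
  have "\<bar>Im lam\<bar> * (cmod (rform l w lam))\<^sup>2 \<le> \<bar>Im lam\<bar> * (nsq l (res l lam w) * nsq l w)"
    unfolding rform_def by (intro mult_left_mono Cauchy_Schwarz_ip eqn_L2[OF e] assms) auto
  also have "\<dots> = nsq l w * \<bar>Im (rform l w lam)\<bar>"
    unfolding rform_def eqn_Im_ip[OF less_imp_le[OF assms(1)] e assms(3)] by (simp add: abs_mult)
  finally show ?thesis .
qed

lemma rform_bound:
  assumes "0 < l" "Im lam \<noteq> 0" "L2 l w"
  shows "cmod (rform l w lam) \<le> nsq l w / \<bar>Im lam\<bar>"
  using eqn_ip_bound[OF less_imp_le[OF assms(1)] eqn_res_nonreal[OF assms] assms(3,3)] assms(2)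
  by (simp add: rform_def pos_le_divide_eq mult.commute)

text \<open>If |alpha F_w| <= 1/2 then |1 + alpha F_w| >= 1/2, whence the 2. Otherwise F_w is not
  small, the Herglotz inequality makes |Im F_w| at least a multiple of |Im lam|, and as alpha is
  real this bounds |Im (1 + alpha F_w)| from below. The 4 is the inverse of (1/2)^2.\<close>

lemma one_plus_rform:
  fixes \<alpha> :: real
  assumes "0 < l" "Im lam \<noteq> 0" "L2 l w"
  shows "1 + \<alpha> * rform l w lam \<noteq> 0"
    "1 \<le> (2 + 4 * \<bar>\<alpha>\<bar> * nsq l w / \<bar>Im lam\<bar>) * cmod (1 + \<alpha> * rform l w lam)"
proof -
  define F where "F = rform l w lam"
  define N where "N = nsq l w"
  define \<eta> where "\<eta> = \<bar>Im lam\<bar>"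
  have \<eta>: "\<eta> > 0" using assms by (simp add: \<eta>_def)
  have N: "N \<ge> 0" by (simp add: N_def)
  have H: "\<eta> * (cmod F)\<^sup>2 \<le> N * \<bar>Im F\<bar>"
    using rform_Herglotz[OF assms] by (simp add: F_def N_def \<eta>_def)
  have "1 \<le> (2 + 4 * \<bar>\<alpha>\<bar> * N / \<eta>) * cmod (1 + \<alpha> * F)"
  proof (cases "\<bar>\<alpha>\<bar> * cmod F \<le> 1/2")
    case True
    have "1 - cmod (of_real \<alpha> * F) \<le> cmod (1 + of_real \<alpha> * F)"
      using norm_diff_ineq[of 1 "of_real \<alpha> * F"] by simp
    then have "1/2 \<le> cmod (1 + of_real \<alpha> * F)"
      using True by (simp add: norm_mult)
    moreover have "0 \<le> 4 * \<bar>\<alpha>\<bar> * N / \<eta> * cmod (1 + of_real \<alpha> * F)"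
      using N \<eta> by simp
    ultimately show ?thesis by (simp add: distrib_right)
  next
    case False
    have "\<eta> * (1/2)\<^sup>2 \<le> \<eta> * (\<bar>\<alpha>\<bar> * cmod F)\<^sup>2"
      using False \<eta> by (intro mult_left_mono power_mono) auto
    also have "\<dots> = \<alpha>\<^sup>2 * (\<eta> * (cmod F)\<^sup>2)"
      by (simp add: power_mult_distrib)
    also have "\<dots> \<le> \<alpha>\<^sup>2 * (N * \<bar>Im F\<bar>)"
      using H by (intro mult_left_mono) auto
    also have "\<dots> = \<bar>\<alpha>\<bar> * N * \<bar>Im (1 + of_real \<alpha> * F)\<bar>"
      by (simp add: power2_eq_square abs_mult)
    also have "\<dots> \<le> \<bar>\<alpha>\<bar> * N * cmod (1 + of_real \<alpha> * F)"
      using N by (intro mult_left_mono abs_Im_le_cmod) auto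
    finally have "1 \<le> 4 * \<bar>\<alpha>\<bar> * N / \<eta> * cmod (1 + of_real \<alpha> * F)"
      using \<eta> by (simp add: power2_eq_square field_simps)
    then show ?thesis
      unfolding distrib_right using norm_ge_zero[of "1 + complex_of_real \<alpha> * F"] by linarith
  qed
  then show "1 \<le> (2 + 4 * \<bar>\<alpha>\<bar> * nsq l w / \<bar>Im lam\<bar>) * cmod (1 + \<alpha> * rform l w lam)"
    "1 + \<alpha> * rform l w lam \<noteq> 0"
    unfolding F_def N_def \<eta>_def by auto
qed

text \<open>Two successive preimages are possible because the first can be chosen orthogonal to the
  kernel. The second preimage controls the error in \<open>rform_near_regular\<close>.\<close>

lemma real_point_dichotomy:
  assumes l: "0 < l" and w: "L2 l w"
  obtains \<phi> where "char_det l (complex_of_real r) = 0" "eqn l (complex_of_real r) \<phi> (\<lambda>x. 0)" "ip l w \<phi> \<noteq> 0"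
  | z z2 where "eqn l (complex_of_real r) z w" "eqn l (complex_of_real r) z2 z"
proof (cases "char_det l (complex_of_real r) = 0")
  case False
  have "eqn l (complex_of_real r) (res l (complex_of_real r) w) w"
    using eqn_res[OF _ w False] l by simp
  moreover from this have "eqn l (complex_of_real r) (res l (complex_of_real r) (res l (complex_of_real r) w)) (res l (complex_of_real r) w)"
    using eqn_res[OF _ eqn_L2 False] l by simp
  ultimately show ?thesis using that(2) by blast
next
  case True
  obtain \<phi> where \<phi>: "eqn l (complex_of_real r) \<phi> (\<lambda>x. 0)" "nsq l \<phi> \<noteq> 0"
    using char_det_eq_0_eigenfunction[OF l True] by blast
  show ?thesis
  proof (cases "ip l w \<phi> = 0")
    case True
    obtain z where z: "eqn l (complex_of_real r) z w" "ip l z \<phi> = 0"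
      using eqn_perp_kernel_solvable[OF l \<phi> w True] .
    obtain z2 where "eqn l (complex_of_real r) z2 z"
      using eqn_perp_kernel_solvable[OF l \<phi> eqn_L2[OF z(1)] z(2)] .
    then show ?thesis using that(2) z by blast
  qed (use that(1) \<phi> True in blast)
qed

text \<open>With d = lam - r the resolvent expands as R(lam) w = z + d z2 + d^2 R(lam) z2. On the
  vertical ray |d| = |Im lam|, so d R(lam) z2 stays bounded and the error is O(eta).\<close>

lemma rform_near_regular:
  assumes l: "0 < l" and w: "L2 l w"
    and z: "eqn l (complex_of_real r) z w" and z2: "eqn l (complex_of_real r) z2 z" and \<eta>: "\<eta> > 0"
  shows "cmod (rform l w (Complex r \<eta>) - ip l z w) \<le> (cmod (ip l z2 w) + sqrt (nsq l z2 * nsq l w)) * \<eta>"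
proof -
  let ?lam = "Complex r \<eta>"
  have Im: "Im ?lam \<noteq> 0" using \<eta> by simp
  have L: "L2 l z" "L2 l z2" using z z2 eqn_L2 by auto
  define \<delta> where "\<delta> = ?lam - complex_of_real r"
  have \<delta>: "cmod \<delta> = \<eta>" "?lam = complex_of_real r + \<delta>" using \<eta> by (auto simp: \<delta>_def cmod_def)
  define Y where "Y = res l ?lam z2"
  have Y: "eqn l ?lam Y z2" unfolding Y_def by (rule eqn_res_nonreal[OF l Im L(2)])
  have LY: "L2 l Y" using Y eqn_L2 by blast
  have 1: "eqn l ?lam z (\<lambda>x. w x - \<delta> * z x)" and 2: "eqn l ?lam z2 (\<lambda>x. z x - \<delta> * z2 x)"
    using eqn_shift[OF z, of ?lam] eqn_shift[OF z2, of ?lam] by (simp_all add: \<delta>_def algebra_simps)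
  have "eqn l ?lam (\<lambda>x. 1 * z x + \<delta> * (1 * z2 x + \<delta> * Y x)) w"
    using eqn_lincomb[OF 1 eqn_lincomb[OF 2 Y, of 1 \<delta>], of 1 \<delta>] by (simp add: algebra_simps)
  then have "rform l w ?lam = ip l (\<lambda>x. 1 * z x + \<delta> * (1 * z2 x + \<delta> * Y x)) w"
    unfolding rform_def by (intro eqn_unique_ip[OF l Im eqn_res_nonreal[OF l Im w] _ w])
  also have "\<dots> = ip l z w + \<delta> * (ip l z2 w + \<delta> * ip l Y w)"
    using L LY w ip_cmult_left[of l 1] by (simp add: ip_add_left del: ip_cmult_left) (simp add: ip_add_left)
  finally have "cmod (rform l w ?lam - ip l z w) = \<eta> * cmod (ip l z2 w + \<delta> * ip l Y w)"
    by (simp add: norm_mult \<delta>)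
  also have "\<dots> \<le> \<eta> * (cmod (ip l z2 w) + \<eta> * cmod (ip l Y w))"
    using \<eta> norm_triangle_ineq[of "ip l z2 w" "\<delta> * ip l Y w"] by (intro mult_left_mono) (auto simp: norm_mult \<delta>)
  also have "\<dots> \<le> \<eta> * (cmod (ip l z2 w) + sqrt (nsq l z2 * nsq l w))"
    using eqn_ip_bound[OF _ Y L(2) w] l \<eta> by (intro mult_left_mono) auto
  finally show ?thesis by (simp add: mult.commute)
qed

text \<open>Pairing the equation of y = R(lam) w with \<open>\<phi>\<close> gives <w, phi> = - i eta
  <y, phi>, so |y| is at least of order 1/eta. Since Im F_w = eta |y|^2, the function F_w grows at
  least like 1/eta.\<close>

lemma rform_near_singular:
  assumes l: "0 < l" and w: "L2 l w"
    and \<phi>: "eqn l (complex_of_real r) \<phi> (\<lambda>x. 0)" and \<eta>: "\<eta> > 0"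
  shows "(cmod (ip l w \<phi>))\<^sup>2 \<le> nsq l \<phi> * \<eta> * cmod (rform l w (Complex r \<eta>))"
proof -
  let ?lam = "Complex r \<eta>"
  have Im: "Im ?lam \<noteq> 0" using \<eta> by simp
  note e = eqn_res_nonreal[OF l Im w]
  define y where "y = res l ?lam w"
  define c where "c = ip l y \<phi>"
  have "ip l w \<phi> + ?lam * c = complex_of_real r * c"
    using eqn_symmetric[OF _ e \<phi> w] l by (simp add: y_def c_def)
  then have "ip l w \<phi> = (complex_of_real r - ?lam) * c" by (simp add: algebra_simps)
  also have "complex_of_real r - ?lam = - \<i> * \<eta>" by (simp add: complex_eq_iff)
  finally have "ip l w \<phi> = - \<i> * \<eta> * c" .
  then have "cmod (ip l w \<phi>) = \<eta> * cmod c" using \<eta> by (simp add: norm_mult)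
  then have "(cmod (ip l w \<phi>))\<^sup>2 = \<eta>\<^sup>2 * (cmod c)\<^sup>2" by (simp add: power_mult_distrib)
  also have "\<dots> \<le> \<eta>\<^sup>2 * (nsq l y * nsq l \<phi>)"
    unfolding c_def y_def by (intro mult_left_mono Cauchy_Schwarz_ip eqn_L2[OF e] eqn_L2[OF \<phi>]) auto
  also have "\<dots> = nsq l \<phi> * \<eta> * Im (rform l w ?lam)"
    using eqn_Im_ip[OF _ e w] l by (simp add: rform_def y_def power2_eq_square)
  also have "\<dots> \<le> nsq l \<phi> * \<eta> * cmod (rform l w ?lam)"
    using \<eta> complex_Re_le_cmod abs_Im_le_cmod[of "rform l w ?lam"] by (intro mult_left_mono) auto
  finally show ?thesis .
qed

section \<open>Two facts on entire functions\<close>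

text \<open>On the circle of radius R one has |z^2 - R^2| = 2 R |Im z|, so the factor (z^2 - R^2)^2 absorbs the
  singular bound near the real axis.\<close>

lemma entire_Im_bound_constant:
  assumes hol: "H holomorphic_on UNIV" and "0 \<le> a" "0 \<le> b"
    and bd: "\<And>z. Im z \<noteq> 0 \<Longrightarrow> cmod (H z) \<le> (a + b / \<bar>Im z\<bar>)\<^sup>2"
  obtains c where "\<And>z. H z = c"
proof -
  have "cmod (H z0) \<le> 64 / 9 * (a + b)\<^sup>2" for z0
  proof -
    \<comment> \<open>R >= 1 lets b be absorbed into b R, and |z0| <= R/2 gives |z0^2 - R^2| >= 3/4
      R^2. The final constant is 64/9 = 4 / (3/4)^2.\<close>
    define R where "R = 1 + 2 * cmod z0"
    have R: "R \<ge> 1" "cmod z0 \<le> R / 2" by (auto simp: R_def)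
    let ?G = "\<lambda>z. (z\<^sup>2 - (complex_of_real R)\<^sup>2)\<^sup>2 * H z"
    have "cmod (?G z0) \<le> 4 * R\<^sup>2 * (a * R + b)\<^sup>2"
    proof (rule maximum_modulus_frontier[where S = "cball 0 R" and f = ?G and \<xi> = z0])
      show "?G holomorphic_on interior (cball 0 R)"
        by (intro holomorphic_intros holomorphic_on_subset[OF hol]) auto
      show "continuous_on (closure (cball 0 R)) ?G"
        by (intro holomorphic_on_imp_continuous_on holomorphic_intros holomorphic_on_subset[OF hol]) auto
      show "z0 \<in> cball 0 R" using R by auto
      fix z :: complex assume "z \<in> frontier (cball 0 R)"
      then have z: "cmod z = R" by simp
      have "(complex_of_real R)\<^sup>2 = z * cnj z"
        using z complex_norm_square[of z] by simp
      then have "z\<^sup>2 - (complex_of_real R)\<^sup>2 = z * (z - cnj z)"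
        by (simp add: power2_eq_square algebra_simps)
      then have n: "cmod (z\<^sup>2 - (complex_of_real R)\<^sup>2) = 2 * R * \<bar>Im z\<bar>"
        using z by (simp add: norm_mult complex_diff_cnj)
      show "cmod (?G z) \<le> 4 * R\<^sup>2 * (a * R + b)\<^sup>2"
      proof (cases "Im z = 0")
        case True
        then show ?thesis using n by (simp add: norm_mult norm_power)
      next
        case False
        have "cmod (?G z) = (2 * R * \<bar>Im z\<bar>)\<^sup>2 * cmod (H z)"
          by (simp only: norm_mult norm_power n)
        also have "\<dots> \<le> (2 * R * \<bar>Im z\<bar>)\<^sup>2 * (a + b / \<bar>Im z\<bar>)\<^sup>2"
          by (intro mult_left_mono bd False) auto
        also have "\<dots> = 4 * R\<^sup>2 * (a * \<bar>Im z\<bar> + b)\<^sup>2"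
        proof -
          have "\<bar>Im z\<bar> * (a + b / \<bar>Im z\<bar>) = a * \<bar>Im z\<bar> + b"
            using False by (simp add: field_simps)
          then show ?thesis by (metis (no_types, opaque_lifting) four_x_squared mult.assoc power_mult_distrib)
        qed
        also have "\<dots> \<le> 4 * R\<^sup>2 * (a * R + b)\<^sup>2"
          using assms(2,3) abs_Im_le_cmod[of z] z
          by (intro mult_left_mono power_mono add_right_mono) auto
        finally show ?thesis .
      qed
    qed simp
    moreover have "(3 / 4 * R\<^sup>2)\<^sup>2 * cmod (H z0) \<le> cmod (?G z0)"
    proof -
      have "(cmod z0)\<^sup>2 \<le> (R / 2)\<^sup>2" using R by (intro power_mono) auto
      moreover have "cmod ((complex_of_real R)\<^sup>2) - cmod (z0\<^sup>2) \<le> cmod ((complex_of_real R)\<^sup>2 - z0\<^sup>2)"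
        by (rule norm_triangle_ineq2)
      ultimately have "3 / 4 * R\<^sup>2 \<le> cmod (z0\<^sup>2 - (complex_of_real R)\<^sup>2)"
        by (simp add: norm_power norm_minus_commute power_divide)
      then show ?thesis
        unfolding norm_mult norm_power by (intro mult_right_mono power_mono) auto
    qed
    ultimately have "(3 / 4 * R\<^sup>2)\<^sup>2 * cmod (H z0) \<le> 4 * R\<^sup>2 * (a * R + b)\<^sup>2" by linarith
    also have "\<dots> \<le> 4 * R\<^sup>2 * (a * R + b * R)\<^sup>2"
      using assms R mult_left_mono[of 1 R b] by (intro mult_left_mono power_mono add_left_mono) auto
    also have "\<dots> = (3 / 4 * R\<^sup>2)\<^sup>2 * (64 / 9 * (a + b)\<^sup>2)"
      by (simp add: power2_eq_square algebra_simps)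
    finally show ?thesis
      using R by (simp add: mult_le_cancel_left)
  qed
  then have "bounded (range H)" unfolding bounded_iff by blast
  then have "H constant_on UNIV" by (rule Liouville_theorem[OF hol])
  then show ?thesis using that by (auto simp: constant_on_def)
qed

text \<open>The quotient is meromorphic and its singularities can only be real. At a pole |A / B|
  would tend to infinity along every approach, in particular from straight above, where it is at
  most K. So every singularity is removable; \<open>K\<close> may vary with r.\<close>

lemma entire_quotient:
  assumes A: "A holomorphic_on UNIV" and B: "B holomorphic_on UNIV"
    and nz: "\<And>z. Im z \<noteq> 0 \<Longrightarrow> B z \<noteq> 0"
    and bd: "\<And>r. \<exists>K. \<forall>\<^sub>F \<eta> in at_right 0. cmod (A (Complex r \<eta>)) \<le> K * cmod (B (Complex r \<eta>))"
  obtains H where "H holomorphic_on UNIV" "\<And>z. Im z \<noteq> 0 \<Longrightarrow> H z = A z / B z"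
proof
  define f where "f = (\<lambda>z. A z / B z)"
  have an: "A analytic_on S" "B analytic_on S" for S
    using A B analytic_on_subset[of _ UNIV S] by (auto simp: analytic_on_open)
  have mero: "f meromorphic_on {z}" for z
    unfolding f_def by (intro meromorphic_on_divide analytic_on_imp_meromorphic_on an)
  have fan: "f analytic_on {z}" if "Im z \<noteq> 0" for z
    unfolding f_def using nz[OF that] by (intro analytic_on_divide an) auto
  show "remove_sings f z = A z / B z" if "Im z \<noteq> 0" for z
    using remove_sings_at_analytic[OF fan[OF that]] by (simp add: f_def)
  have "remove_sings f analytic_on {z}" for z
  proof (cases "Im z = 0")
    case False
    then show ?thesis by (intro remove_sings_analytic_on fan)
  next
    case True
    then have z: "z = Complex (Re z) 0" by (simp add: complex_eq_iff)
    have "\<not> is_pole f z"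
    proof
      assume "is_pole f z"
      then have inf: "filterlim f at_infinity (at z)" by (simp add: is_pole_def)
      have "filterlim (\<lambda>\<eta>. Complex (Re z) \<eta>) (at z) (at_right 0)"
        unfolding filterlim_at
      proof
        have "((\<lambda>\<eta>. of_real (Re z) + \<i> * complex_of_real \<eta>) \<longlongrightarrow> of_real (Re z) + \<i> * complex_of_real 0) (at_right 0)"
          by (intro tendsto_intros)
        then show "((\<lambda>\<eta>. Complex (Re z) \<eta>) \<longlongrightarrow> z) (at_right 0)"
          using z by (simp add: Complex_eq)
        show "\<forall>\<^sub>F \<eta> in at_right 0. Complex (Re z) \<eta> \<in> UNIV \<and> Complex (Re z) \<eta> \<noteq> z"
          using eventually_at_right_less[of "0::real"] by eventually_elim (use z in \<open>auto simp: complex_eq_iff\<close>)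
      qed
      from filterlim_compose[OF inf this]
      have "\<forall>r>0. \<forall>\<^sub>F \<eta> in at_right 0. r \<le> cmod (f (Complex (Re z) \<eta>))"
        unfolding filterlim_at_infinity[OF order_refl] .
      then have fl: "\<forall>\<^sub>F \<eta> in at_right 0. r \<le> cmod (f (Complex (Re z) \<eta>))" if "r > 0" for r
        using that by simp
      have K1: "\<bar>K\<bar> + 1 > 0" for K :: real by simp
      obtain K where "\<forall>\<^sub>F \<eta> in at_right 0. cmod (A (Complex (Re z) \<eta>)) \<le> K * cmod (B (Complex (Re z) \<eta>))"
        using bd by blast
      then have "\<forall>\<^sub>F \<eta> in at_right (0::real). False"
        using fl[OF K1[of K]] eventually_at_right_less[of "0::real"]
      proof eventually_elim
        case (elim \<eta>)
        have "cmod (B (Complex (Re z) \<eta>)) > 0" using nz[of "Complex (Re z) \<eta>"] elim by simp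
        then have "cmod (f (Complex (Re z) \<eta>)) \<le> K"
          using elim by (simp add: f_def norm_divide divide_le_eq)
        then show False using elim(2) by auto
      qed
      then show False by simp
    qed
    moreover have "not_essential f z" "isolated_singularity_at f z"
      using mero meromorphic_at_iff by blast+
    ultimately show ?thesis
      using remove_sings_analytic_at by (auto simp: not_essential_def)
  qed
  then show "remove_sings f holomorphic_on UNIV"
    using analytic_imp_holomorphic analytic_on_analytic_at by blast
qed

section \<open>Density of the domain\<close>

lemma nsq_add_le:
  assumes "L2 l f" "L2 l h"
  shows "nsq l (\<lambda>x. f x + h x) \<le> 2 * nsq l f + 2 * nsq l h"
proof -
  have "nsq l (\<lambda>x. f x + h x) \<le> (\<integral>x. 2 * (cmod (f x))\<^sup>2 + 2 * (cmod (h x))\<^sup>2 \<partial>lebesgue_on {0..l})"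
    unfolding nsq_def
  proof (rule integral_mono)
    show "integrable (lebesgue_on {0..l}) (\<lambda>x. (cmod (f x + h x))\<^sup>2)"
      using L2_add[OF assms] by (simp add: L2_def)
    show "integrable (lebesgue_on {0..l}) (\<lambda>x. 2 * (cmod (f x))\<^sup>2 + 2 * (cmod (h x))\<^sup>2)"
      using assms by (simp add: L2_def)
    fix x
    have "(cmod (f x + h x))\<^sup>2 \<le> (cmod (f x) + cmod (h x))\<^sup>2"
      by (rule power_mono) (auto simp: norm_triangle_ineq)
    also have "\<dots> \<le> 2 * (cmod (f x))\<^sup>2 + 2 * (cmod (h x))\<^sup>2"
      using sum_squares_bound[of "cmod (f x)" "cmod (h x)"] by (simp add: power2_sum)
    finally show "(cmod (f x + h x))\<^sup>2 \<le> 2 * (cmod (f x))\<^sup>2 + 2 * (cmod (h x))\<^sup>2" .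
  qed
  also have "\<dots> = 2 * nsq l f + 2 * nsq l h"
    unfolding nsq_def using assms by (simp add: L2_def)
  finally show ?thesis .
qed

lemma nsq_dominated_convergence:
  assumes "L2 l w" "\<And>n. L2 l (f n)" "integrable (lebesgue_on {0..l}) b"
    and "AE x in lebesgue_on {0..l}. (\<lambda>n. f n x) \<longlonglongrightarrow> w x"
    and "\<And>n. AE x in lebesgue_on {0..l}. (cmod (w x - f n x))\<^sup>2 \<le> b x"
  shows "(\<lambda>n::nat. nsq l (\<lambda>x. w x - f n x)) \<longlonglongrightarrow> 0"
proof -
  have "(\<lambda>n. nsq l (\<lambda>x. w x - f n x)) \<longlonglongrightarrow> (\<integral>x. 0 \<partial>lebesgue_on {0..l})"
    unfolding nsq_def
  proof (rule integral_dominated_convergence[where w = b])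
    show "(\<lambda>x. (cmod (w x - f n x))\<^sup>2) \<in> borel_measurable (lebesgue_on {0..l})" for n
      using L2_diff[OF assms(1,2)] by (simp add: L2_def borel_measurable_integrable)
    show "AE x in lebesgue_on {0..l}. (\<lambda>n. (cmod (w x - f n x))\<^sup>2) \<longlonglongrightarrow> 0"
      using assms(4)
    proof eventually_elim
      case (elim x)
      have "(\<lambda>n. (cmod (w x - f n x))\<^sup>2) \<longlonglongrightarrow> (cmod (w x - w x))\<^sup>2"
        by (intro tendsto_intros elim)
      then show ?case by simp
    qed
    show "AE x in lebesgue_on {0..l}. norm ((cmod (w x - f n x))\<^sup>2) \<le> b x" for n
      using assms(5)[of n] by simp
  qed (use assms in auto)
  then show ?thesis by simp
qed

definition dom_approx :: "real \<Rightarrow> (real \<Rightarrow> complex) \<Rightarrow> bool" where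
  "dom_approx l w \<longleftrightarrow> (\<forall>e>0. \<exists>d d3. in_dom3 l d d3 \<and> nsq l (\<lambda>x. w x - d x) < e)"

text \<open>The closure of the domain contains its sequential L2 limits. Each of the four following
  density lemmas applies this once: to polynomials, continuous functions, bounded functions and all
  of L2. The quarter of e offsets the factor 2 in \<open>nsq_add_le\<close>.\<close>

lemma dom_approx_closed:
  assumes "L2 l w" "\<And>n. L2 l (f n)" "\<And>n. dom_approx l (f n)"
    and "(\<lambda>n::nat. nsq l (\<lambda>x. w x - f n x)) \<longlonglongrightarrow> 0"
  shows "dom_approx l w"
  unfolding dom_approx_def
proof (intro allI impI)
  fix e :: real assume e: "e > 0"
  then have "\<forall>\<^sub>F n in sequentially. nsq l (\<lambda>x. w x - f n x) < e / 4"
    using order_tendstoD(2)[OF assms(4), of "e / 4"] by simp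
  then obtain n where n: "nsq l (\<lambda>x. w x - f n x) < e / 4"
    by (auto simp: eventually_sequentially)
  obtain d d3 where d: "in_dom3 l d d3" "nsq l (\<lambda>x. f n x - d x) < e / 4"
    using assms(3)[of n] e unfolding dom_approx_def by (meson divide_pos_pos zero_less_numeral)
  have "nsq l (\<lambda>x. (w x - f n x) + (f n x - d x)) \<le> 2 * nsq l (\<lambda>x. w x - f n x) + 2 * nsq l (\<lambda>x. f n x - d x)"
    by (intro nsq_add_le L2_diff assms in_dom3_L2[OF d(1)])
  then have "nsq l (\<lambda>x. w x - d x) < e" using n d by simp
  then show "\<exists>d d3. in_dom3 l d d3 \<and> nsq l (\<lambda>x. w x - d x) < e" using d by blast
qed

text \<open>The square gives double zeros at 0 and l, so both y and y' vanish there and all three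
  boundary conditions hold.\<close>

lemma in_dom3_polynomial:
  fixes p :: "real \<Rightarrow> complex" and h :: "real \<Rightarrow> real"
  assumes p: "polynomial_function p" and h: "real_polynomial_function h" "h 0 = 0" "h l = 0" and l: "0 < l"
  obtains d3 where "in_dom3 l (\<lambda>x. (h x)\<^sup>2 *\<^sub>R p x) d3"
proof -
  let ?d = "\<lambda>x. (h x)\<^sup>2 *\<^sub>R p x"
  have "polynomial_function h" using h by (simp add: real_polynomial_function_eq)
  then have d: "polynomial_function ?d"
    using p h by (intro polynomial_function_mult) (auto simp: real_polynomial_function_eq[symmetric] intro!: real_polynomial_function_power)
  obtain d1 where d1: "polynomial_function d1" "\<And>x. (?d has_vector_derivative d1 x) (at x)"
    using has_vector_derivative_polynomial_function[OF d] by blast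
  obtain d2 where d2: "polynomial_function d2" "\<And>x. (d1 has_vector_derivative d2 x) (at x)"
    using has_vector_derivative_polynomial_function[OF d1(1)] by blast
  obtain d3 where d3: "polynomial_function d3" "\<And>x. (d2 has_vector_derivative d3 x) (at x)"
    using has_vector_derivative_polynomial_function[OF d2(1)] by blast
  obtain p1 where p1: "\<And>x. (p has_vector_derivative p1 x) (at x)"
    using has_vector_derivative_polynomial_function[OF p] by blast
  obtain h1 where h1: "\<And>x. (h has_real_derivative h1 x) (at x)"
    using has_real_derivative_polynomial_function[OF h(1)] by blast
  have z: "d1 x = 0" if "h x = 0" for x
  proof -
    have "((\<lambda>x. (h x)\<^sup>2) has_real_derivative 2 * h x * h1 x) (at x)"
      by (rule derivative_eq_intros h1 refl)+ simp
    from has_vector_derivative_scaleR[OF this p1[of x]]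
    have "(?d has_vector_derivative 0) (at x)" using that by simp
    then show ?thesis using d1(2) vector_derivative_unique_at by blast
  qed
  have "in_dom3 l ?d d3"
    unfolding in_dom3_def
  proof (intro conjI exI ballI)
    show "L2 l d3"
      by (intro L2_continuous continuous_on_polymonial_function d3)
    fix x assume x: "x \<in> {0..l}"
    show "(?d has_vector_derivative d1 x) (at x within {0..l})"
      "(d1 has_vector_derivative d2 x) (at x within {0..l})"
      using d1(2) d2(2) has_vector_derivative_at_within by blast+
    show "(d3 has_integral d2 x - d2 0) {0..x}"
      using x d3(2) by (intro fundamental_theorem_of_calculus) (auto intro: has_vector_derivative_at_within)
  qed (use d1 d2 h z in \<open>auto intro: has_vector_derivative_at_within\<close>)
  then show ?thesis by (rule that)
qed

lemma AE_lebesgue_on_interior: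
  "AE x in lebesgue_on {0..l::real}. 0 < x \<and> x < l"
proof -
  have "{0, l} \<in> null_sets (lebesgue :: real measure)"
    by (intro finite_imp_null_set_lborel[THEN null_sets_completionI]) auto
  then have "AE x in lebesgue. x \<notin> {0, l}" by (rule AE_not_in)
  then have "AE x in lebesgue. x \<in> {0..l} \<longrightarrow> 0 < x \<and> x < l"
    by eventually_elim auto
  then show ?thesis by (subst AE_restrict_space_iff) auto
qed

lemma dom_approx_polynomial:
  fixes p :: "real \<Rightarrow> complex"
  assumes l: "0 < l" and p: "polynomial_function p"
  shows "dom_approx l p"
proof -
  define s where "s = (\<lambda>x. 4 * (x * (l - x)) / l\<^sup>2)"
  have s: "0 \<le> s x" "s x \<le> 1" if "x \<in> {0..l}" for x
  proof -
    show "0 \<le> s x" using that by (simp add: s_def)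
    have "4 * (x * (l - x)) = l\<^sup>2 - (l - 2 * x)\<^sup>2"
      by (simp add: power2_eq_square algebra_simps)
    also have "\<dots> \<le> l\<^sup>2" by simp
    finally show "s x \<le> 1" using l by (simp add: s_def)
  qed
  have s0: "0 < s x" if "0 < x" "x < l" for x using that by (simp add: s_def)
  \<comment> \<open>A polynomial cut-off: 0 at both ends, between 0 and 1, and tending to 1 on the
    open interval, where 0 < s <= 1. The factor 4 / l^2 in s makes the maximum, at l/2, equal to
    1.\<close>
  define h where "h = (\<lambda>n x. 1 - (1 - s x) ^ n)"
  have rs: "real_polynomial_function (h n)" for n
  proof -
    have "real_polynomial_function (\<lambda>x. 1 - (1 - (4 / l\<^sup>2) * (x * (l - x))) ^ n)"
      by (intro real_polynomial_function_diff real_polynomial_function_power real_polynomial_function.intros) auto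
    then show ?thesis by (simp add: h_def s_def)
  qed
  have h01: "0 \<le> h n x" "h n x \<le> 1" if "x \<in> {0..l}" for n x
    using s[OF that] by (auto simp: h_def power_le_one)
  have cp: "continuous_on {0..l} p" by (rule continuous_on_polymonial_function[OF p])
  have ch: "continuous_on {0..l} (h n)" for n
    unfolding h_def s_def using l by (intro continuous_intros) auto
  let ?f = "\<lambda>n x. (h (Suc n) x)\<^sup>2 *\<^sub>R p x"
  show ?thesis
  proof (rule dom_approx_closed)
    show Lp: "L2 l p" by (rule L2_continuous[OF cp])
    show Lf: "L2 l (?f n)" for n
      by (intro L2_continuous continuous_intros ch cp)
    show "dom_approx l (?f n)" for n
    proof -
      have "h (Suc n) 0 = 0" "h (Suc n) l = 0" by (auto simp: h_def s_def)
      then obtain d3 where "in_dom3 l (?f n) d3"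
        using in_dom3_polynomial[OF p rs _ _ l] by blast
      moreover have "nsq l (\<lambda>x. ?f n x - ?f n x) = 0" by (simp add: nsq_def)
      ultimately show ?thesis unfolding dom_approx_def by metis
    qed
    show "(\<lambda>n. nsq l (\<lambda>x. p x - ?f n x)) \<longlonglongrightarrow> 0"
    proof (rule nsq_dominated_convergence[OF Lp Lf])
      show "integrable (lebesgue_on {0..l}) (\<lambda>x. (cmod (p x))\<^sup>2)" using Lp by (simp add: L2_def)
      show "AE x in lebesgue_on {0..l}. (\<lambda>n. ?f n x) \<longlonglongrightarrow> p x"
        using AE_lebesgue_on_interior
      proof eventually_elim
        case (elim x)
        have "(\<lambda>n. (1 - s x) ^ n) \<longlonglongrightarrow> 0"
          using s[of x] s0[of x] elim by (intro LIMSEQ_realpow_zero) auto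
        then have "(\<lambda>n. (1 - s x) ^ Suc n) \<longlonglongrightarrow> 0" by (rule LIMSEQ_Suc)
        then have "(\<lambda>n. (1 - (1 - s x) ^ Suc n)\<^sup>2 *\<^sub>R p x) \<longlonglongrightarrow> (1 - 0)\<^sup>2 *\<^sub>R p x"
          by (intro tendsto_intros)
        then show ?case by (simp add: h_def)
      qed
      show "AE x in lebesgue_on {0..l}. (cmod (p x - ?f n x))\<^sup>2 \<le> (cmod (p x))\<^sup>2" for n
      proof (rule AE_I2)
        fix x assume "x \<in> space (lebesgue_on {0..l})"
        then have x: "x \<in> {0..l}" by simp
        have "p x - ?f n x = (1 - (h (Suc n) x)\<^sup>2) *\<^sub>R p x" by (simp add: scaleR_diff_left)
        moreover have "(h (Suc n) x)\<^sup>2 \<le> 1" "0 \<le> (h (Suc n) x)\<^sup>2"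
          using h01[OF x] by (auto simp: power_le_one)
        ultimately show "(cmod (p x - ?f n x))\<^sup>2 \<le> (cmod (p x))\<^sup>2"
          by (intro power_mono) (auto intro!: mult_left_le_one_le)
      qed
    qed
  qed
qed

lemma dom_approx_continuous:
  assumes l: "0 < l" and c: "continuous_on {0..l} c"
  shows "dom_approx l c"
proof -
  have "\<exists>g. polynomial_function g \<and> (\<forall>x\<in>{0..l}. norm (c x - g x) < inverse (real (Suc n)))" for n
    using Stone_Weierstrass_polynomial_function[OF compact_Icc c, of "inverse (real (Suc n))"] by simp
  then obtain g where g: "\<And>n. polynomial_function (g n)"
    "\<And>n x. x \<in> {0..l} \<Longrightarrow> cmod (c x - g n x) < inverse (real (Suc n))" by metis
  show ?thesis
  proof (rule dom_approx_closed)
    show Lc: "L2 l c" by (rule L2_continuous[OF c])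
    show Lg: "L2 l (g n)" for n by (intro L2_continuous continuous_on_polymonial_function g)
    show "dom_approx l (g n)" for n by (rule dom_approx_polynomial[OF l g(1)])
    show "(\<lambda>n. nsq l (\<lambda>x. c x - g n x)) \<longlonglongrightarrow> 0"
    proof (rule nsq_dominated_convergence[OF Lc Lg])
      show "integrable (lebesgue_on {0..l}) (\<lambda>x. 1::real)" by (rule continuous_imp_integrable_real) simp
      show "AE x in lebesgue_on {0..l}. (\<lambda>n. g n x) \<longlonglongrightarrow> c x"
      proof (rule AE_I2)
        fix x assume "x \<in> space (lebesgue_on {0..l})"
        then have x: "x \<in> {0..l}" by simp
        have "(\<lambda>n. c x - g n x) \<longlonglongrightarrow> 0"
          by (rule Lim_null_comparison[OF _ LIMSEQ_inverse_real_of_nat]) (use g(2)[OF x] in \<open>auto intro!: always_eventually less_imp_le\<close>)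
        then have "(\<lambda>n. c x - (c x - g n x)) \<longlonglongrightarrow> c x - 0" by (intro tendsto_intros)
        then show "(\<lambda>n. g n x) \<longlonglongrightarrow> c x" by simp
      qed
      show "AE x in lebesgue_on {0..l}. (cmod (c x - g n x))\<^sup>2 \<le> 1" for n
      proof (rule AE_I2)
        fix x assume "x \<in> space (lebesgue_on {0..l})"
        then have "cmod (c x - g n x) < inverse (real (Suc n))" using g(2) by simp
        also have "\<dots> \<le> 1" by (simp add: inverse_le_1_iff)
        finally show "(cmod (c x - g n x))\<^sup>2 \<le> 1" by (simp add: power_le_one)
      qed
    qed
  qed
qed

text \<open>Measurability provides continuous functions converging to w almost everywhere, but
  without a common bound. The nearest-point projection \<open>T\<close> onto the disc of radius M is
  continuous and fixes the values of w, so the clipped functions still converge and are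
  dominated.\<close>

lemma dom_approx_bounded:
  assumes l: "0 < l" and w: "L2 l w" and M: "M > 0" "\<And>x. cmod (w x) \<le> M"
  shows "dom_approx l w"
proof -
  have "w measurable_on {0..l}"
    using w by (simp add: L2_def measurable_on_iff_borel_measurable)
  then obtain N g where N: "negligible N" and g: "\<And>n. continuous_on UNIV (g n)"
    "\<And>x. x \<notin> N \<Longrightarrow> (\<lambda>n. g n x) \<longlonglongrightarrow> (if x \<in> {0..l} then w x else 0)"
    unfolding measurable_on_def by blast
  define T where "T = closest_point (cball (0::complex) M)"
  have cT: "continuous_on UNIV T"
    unfolding T_def using M by (intro continuous_on_closest_point) auto
  have T: "cmod (T z) \<le> M" for z
    using closest_point_in_set[of "cball (0::complex) M" z] M by (auto simp: T_def)
  have Tw: "T (w x) = w x" for x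
    unfolding T_def using M by (intro closest_point_self) auto
  have cf: "continuous_on S (\<lambda>x. T (g n x))" for S n
    by (rule continuous_on_compose2[OF cT continuous_on_subset[OF g(1)]]) auto
  show ?thesis
  proof (rule dom_approx_closed[OF w])
    show Lf: "L2 l (\<lambda>x. T (g n x))" for n by (intro L2_continuous cf)
    show "dom_approx l (\<lambda>x. T (g n x))" for n by (intro dom_approx_continuous l cf)
    show "(\<lambda>n. nsq l (\<lambda>x. w x - T (g n x))) \<longlonglongrightarrow> 0"
    proof (rule nsq_dominated_convergence[OF w Lf])
      show "integrable (lebesgue_on {0..l}) (\<lambda>x. (2 * M)\<^sup>2)" by (rule continuous_imp_integrable_real) simp
      show "AE x in lebesgue_on {0..l}. (\<lambda>n. T (g n x)) \<longlonglongrightarrow> w x"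
      proof -
        have "AE x in lebesgue. x \<notin> N"
          using N by (intro AE_not_in) (simp add: negligible_iff_null_sets)
        then have "AE x in lebesgue. x \<in> {0..l} \<longrightarrow> x \<notin> N" by eventually_elim auto
        then have "AE x in lebesgue_on {0..l}. x \<notin> N" by (subst AE_restrict_space_iff) auto
        moreover have "AE x in lebesgue_on {0..l}. x \<in> {0..l}" by (rule AE_I2) simp
        ultimately show ?thesis
        proof eventually_elim
          case (elim x)
          then have "(\<lambda>n. g n x) \<longlonglongrightarrow> w x" using g(2)[of x] by simp
          moreover have "isCont T (w x)" using cT by (simp add: continuous_on_eq_continuous_at)
          ultimately have "(\<lambda>n. T (g n x)) \<longlonglongrightarrow> T (w x)" by (rule isCont_tendsto_compose[rotated])
          then show ?case by (simp add: Tw)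
        qed
      qed
      have "(cmod (w x - T (g n x)))\<^sup>2 \<le> (2 * M)\<^sup>2" for n x
      proof (rule power_mono)
        show "cmod (w x - T (g n x)) \<le> 2 * M"
          using norm_triangle_ineq4[of "w x" "T (g n x)"] T[of "g n x"] M(2)[of x] by linarith
      qed simp
      then show "AE x in lebesgue_on {0..l}. (cmod (w x - T (g n x)))\<^sup>2 \<le> (2 * M)\<^sup>2" for n by simp
    qed
  qed
qed

lemma dom_dense:
  assumes l: "0 < l" and w: "L2 l w"
  shows "dom_approx l w"
proof (rule dom_approx_closed[OF w])
  let ?M = "lebesgue_on {0..l}"
  let ?f = "\<lambda>n x. if cmod (w x) \<le> real n then w x else 0"
  note m[measurable] = L2_measurable[OF w]
  show L: "L2 l (?f n)" for n
  proof -
    have fm: "?f n \<in> borel_measurable ?M" by measurable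
    have "integrable ?M (\<lambda>x. (cmod (?f n x))\<^sup>2)"
    proof (rule Bochner_Integration.integrable_bound)
      show "integrable ?M (\<lambda>x. (cmod (w x))\<^sup>2)" using w by (simp add: L2_def)
      show "(\<lambda>x. (cmod (?f n x))\<^sup>2) \<in> borel_measurable ?M" using fm by measurable
    qed simp
    then show ?thesis using fm by (simp add: L2_def)
  qed
  \<comment> \<open>The bound is n + 1 and not n because \<open>dom_approx_bounded\<close> needs it
    positive also for n = 0.\<close>
  show "dom_approx l (?f n)" for n
    by (rule dom_approx_bounded[OF l L, of "real n + 1"]) auto
  show "(\<lambda>n. nsq l (\<lambda>x. w x - ?f n x)) \<longlonglongrightarrow> 0"
  proof (rule nsq_dominated_convergence[OF w L])
    show "integrable ?M (\<lambda>x. (cmod (w x))\<^sup>2)" using w by (simp add: L2_def)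
    show "AE x in ?M. (\<lambda>n. ?f n x) \<longlonglongrightarrow> w x"
    proof (rule AE_I2)
      fix x
      obtain n where "cmod (w x) \<le> real n" using real_arch_simple by blast
      then have "\<forall>\<^sub>F k in sequentially. ?f k x = w x"
        unfolding eventually_sequentially by (intro exI[of _ n]) auto
      then show "(\<lambda>n. ?f n x) \<longlonglongrightarrow> w x" by (rule tendsto_eventually)
    qed
  qed auto
qed

text \<open>For d in the domain and f = L_0 d one has lam R(lam) d = R(lam) f - d. With w = d + u
  this gives lam F_w + |w|^2 = <R f, w> + <u, w> + lam <R u, w>. The first term is O(1/eta), the
  other two are at most |u| |w|, and density makes u small.\<close>

lemma rform_asymptotics:
  assumes l: "0 < l" and w: "L2 l w"
  shows "((\<lambda>\<eta>. Complex 0 \<eta> * rform l w (Complex 0 \<eta>)) \<longlongrightarrow> - of_real (nsq l w)) at_top"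
proof (rule tendstoI)
  fix e :: real assume e: "e > 0"
  define W where "W = sqrt (nsq l w)"
  have W: "W \<ge> 0" by (simp add: W_def)
  \<comment> \<open>Each of the three error terms is to be at most e / 4; the + 1 keeps the
    denominator positive when W = 0.\<close>
  define e' where "e' = e / (4 * (W + 1))"
  have e': "e' > 0" using e W by (simp add: e'_def)
  obtain d d3 where d: "in_dom3 l d d3" "nsq l (\<lambda>x. w x - d x) < e'\<^sup>2"
    using dom_dense[OF assms] e' unfolding dom_approx_def by (meson zero_less_power)
  define f where "f = (\<lambda>x. \<i> * d3 x)"
  define u where "u = (\<lambda>x. w x - d x)"
  have Ld: "L2 l d" "L2 l f" using in_dom3_L2[OF d(1)] by (auto simp: f_def)
  then have Lu: "L2 l u" using w by (simp add: u_def)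
  have ef: "eqn l 0 d f" unfolding eqn_def f_def using d by auto
  define K where "K = sqrt (nsq l f * nsq l w)"
  have su: "sqrt (nsq l u * nsq l w) \<le> e' * W"
  proof -
    have "sqrt (nsq l u) \<le> e'"
      using d(2) e' by (intro real_le_lsqrt) (auto simp: u_def)
    then show ?thesis using W by (simp add: real_sqrt_mult W_def mult_right_mono)
  qed
  have "cmod (Complex 0 \<eta> * rform l w (Complex 0 \<eta>) - - of_real (nsq l w)) < e"
    if \<eta>: "\<eta> > 0" "\<eta> \<ge> 4 * (K + 1) / e" for \<eta>
  proof -
    define lam where "lam = Complex 0 \<eta>"
    have lam: "Im lam \<noteq> 0" "lam \<noteq> 0" "cmod lam = \<eta>" "\<bar>Im lam\<bar> = \<eta>"
      using \<eta> by (auto simp: lam_def complex_eq_iff cmod_def)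
    define Rf Ru where "Rf = res l lam f" and "Ru = res l lam u"
    have R: "eqn l lam Rf f" "eqn l lam Ru u"
      unfolding Rf_def Ru_def by (intro eqn_res_nonreal l lam Ld Lu)+
    have LR: "L2 l Rf" "L2 l Ru" using R eqn_L2 by auto
    have ed: "eqn l lam d (\<lambda>x. f x - lam * d x)" using eqn_shift[OF ef, of lam] by simp
    have "eqn l lam (\<lambda>x. 1 * (inverse lam * Rf x + (- inverse lam) * d x) + 1 * Ru x)
        (\<lambda>x. 1 * (inverse lam * f x + (- inverse lam) * (f x - lam * d x)) + 1 * u x)"
      by (intro eqn_lincomb R ed)
    also have "(\<lambda>x. 1 * (inverse lam * f x + (- inverse lam) * (f x - lam * d x)) + 1 * u x) = w"
      using lam by (auto simp: u_def algebra_simps)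
    finally have e1: "eqn l lam (\<lambda>x. 1 * (inverse lam * Rf x + (- inverse lam) * d x) + 1 * Ru x) w" .
    have "rform l w lam = ip l (\<lambda>x. 1 * (inverse lam * Rf x + (- inverse lam) * d x) + 1 * Ru x) w"
      unfolding rform_def by (rule eqn_unique_ip[OF l lam(1) eqn_res_nonreal[OF l lam(1) w] e1 w])
    also have "\<dots> = ip l (\<lambda>x. inverse lam * Rf x + (- inverse lam) * d x) w + ip l Ru w"
      using ip_add_left[OF L2_add[OF L2_cmult[OF LR(1), of "inverse lam"] L2_cmult[OF Ld(1), of "- inverse lam"]] LR(2) w]
      by simp
    also have "ip l (\<lambda>x. inverse lam * Rf x + (- inverse lam) * d x) w = inverse lam * ip l Rf w + (- inverse lam) * ip l d w"
      unfolding ip_add_left[OF L2_cmult[OF LR(1)] L2_cmult[OF Ld(1)] w] ip_cmult_left by simp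
    finally have F: "rform l w lam = inverse lam * ip l Rf w + (- inverse lam) * ip l d w + ip l Ru w" .
    have "lam * rform l w lam = (lam * inverse lam) * (ip l Rf w - ip l d w) + lam * ip l Ru w"
      unfolding F by (simp add: algebra_simps)
    then have "lam * rform l w lam = ip l Rf w - ip l d w + lam * ip l Ru w"
      using lam by simp
    moreover have "ip l u w = of_real (nsq l w) - ip l d w"
      unfolding u_def ip_diff_left[OF w Ld(1) w] ip_self ..
    ultimately have "lam * rform l w lam - - of_real (nsq l w) = ip l Rf w + ip l u w + lam * ip l Ru w"
      by simp
    then have "cmod (lam * rform l w lam - - of_real (nsq l w)) \<le> cmod (ip l Rf w) + cmod (ip l u w) + \<eta> * cmod (ip l Ru w)"
      using norm_triangle_ineq[of "ip l Rf w + ip l u w" "lam * ip l Ru w"] norm_triangle_ineq[of "ip l Rf w" "ip l u w"]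
      by (simp add: norm_mult lam)
    moreover have "cmod (ip l Rf w) \<le> e / 4"
    proof -
      have "\<eta> * cmod (ip l Rf w) \<le> K"
        using eqn_ip_bound[OF _ R(1) Ld(2) w] l lam by (simp add: K_def)
      also have "K \<le> \<eta> * (e / 4)" using \<eta> e by (simp add: field_simps)
      finally show ?thesis using \<eta> by simp
    qed
    moreover have "cmod (ip l u w) \<le> e' * W"
    proof -
      have "cmod (ip l u w) \<le> sqrt (nsq l u * nsq l w)"
        by (intro real_le_rsqrt Cauchy_Schwarz_ip Lu w)
      then show ?thesis using su by linarith
    qed
    moreover have "\<eta> * cmod (ip l Ru w) \<le> e' * W"
      using eqn_ip_bound[OF _ R(2) Lu w] l lam su by simp
    moreover have "e' * W \<le> e / 4"
      using e W by (simp add: e'_def field_simps)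
    ultimately show ?thesis using e by (simp add: lam_def)
  qed
  then show "\<forall>\<^sub>F \<eta> in at_top. dist (Complex 0 \<eta> * rform l w (Complex 0 \<eta>)) (- of_real (nsq l w)) < e"
    unfolding dist_norm eventually_at_top_linorder
    by (intro exI[of _ "max 1 (4 * (K + 1) / e)"]) auto
qed

section \<open>Algebraic multiplicities\<close>

text \<open>Moving the rank-one term to the right turns the eigenvalue equation of L_alpha(w) into
  an inhomogeneous equation for \<open>L_0\<close> with right-hand side a multiple of w.\<close>

lemma gen_eig_1_iff:
  "gen_eig l \<alpha> w lam (Suc 0) y \<longleftrightarrow> eqn l lam y (\<lambda>x. - (of_real \<alpha> * ip l y w) * w x)"
proof
  assume "gen_eig l \<alpha> w lam (Suc 0) y"
  then obtain z u y3 where *: "in_dom3 l y y3" "ae_eq l u (\<lambda>x. \<i> * y3 x + complex_of_real \<alpha> * ip l y w * w x)"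
    "ae_eq l z (\<lambda>x. u x - lam * y x)" "ae_eq l z (\<lambda>x. 0)"
    by (auto simp: Lop_def)
  have "ae_eq l (\<lambda>x. - (of_real \<alpha> * ip l y w) * w x) (\<lambda>x. \<i> * y3 x - lam * y x)"
    unfolding ae_eq_def using *(2-4)[unfolded ae_eq_def] by eventually_elim (simp add: algebra_simps)
  then show "eqn l lam y (\<lambda>x. - (of_real \<alpha> * ip l y w) * w x)"
    unfolding eqn_def using *(1) by blast
next
  assume "eqn l lam y (\<lambda>x. - (of_real \<alpha> * ip l y w) * w x)"
  then obtain y3 where y: "in_dom3 l y y3" "ae_eq l (\<lambda>x. - (of_real \<alpha> * ip l y w) * w x) (\<lambda>x. \<i> * y3 x - lam * y x)"
    unfolding eqn_def by blast
  let ?u = "\<lambda>x. \<i> * y3 x + complex_of_real \<alpha> * ip l y w * w x"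
  have "ae_eq l (\<lambda>x. ?u x - lam * y x) (\<lambda>x. 0)"
    unfolding ae_eq_def using y(2)[unfolded ae_eq_def] by eventually_elim (simp add: algebra_simps)
  moreover have "Lop l \<alpha> w y ?u" unfolding Lop_def using y by auto
  ultimately show "gen_eig l \<alpha> w lam (Suc 0) y"
    by (simp only: gen_eig.simps) (metis ae_eq_refl)
qed

text \<open>For real spectral parameters the operator is symmetric, so root vectors are eigenvectors.\<close>

lemma gen_eig_imp_eigenvector:
  assumes l: "0 < l" and w: "L2 l w"
  shows "gen_eig l \<alpha> w (complex_of_real r) k y \<Longrightarrow>
    ae_eq l y (\<lambda>x. 0) \<or> gen_eig l \<alpha> w (complex_of_real r) (Suc 0) y"
proof (induction k arbitrary: y)
  case (Suc k)
  then obtain z u y3 where *: "in_dom3 l y y3" "ae_eq l u (\<lambda>x. \<i> * y3 x + complex_of_real \<alpha> * ip l y w * w x)"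
    "ae_eq l z (\<lambda>x. u x - complex_of_real r * y x)" "gen_eig l \<alpha> w (complex_of_real r) k z"
    by (auto simp: Lop_def)
  \<comment> \<open>Here z = (L - r) y is null or an eigenvector. In the latter case |z|^2 = <(L -
    r) y, z> = <y, (L - r) z> = 0, where the rank-one terms on the two sides cancel because alpha is
    real.\<close>
  have "ae_eq l z (\<lambda>x. 0)"
    using Suc.IH[OF *(4)]
  proof
    assume "gen_eig l \<alpha> w (complex_of_real r) (Suc 0) z"
    then have z: "eqn l (complex_of_real r) z (\<lambda>x. - (of_real \<alpha> * ip l z w) * w x)"
      unfolding gen_eig_1_iff .
    have Lz: "L2 l z" using z eqn_L2 by blast
    let ?f = "\<lambda>x. z x + (- (of_real \<alpha> * ip l y w)) * w x"
    have "ae_eq l ?f (\<lambda>x. \<i> * y3 x - complex_of_real r * y x)"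
      unfolding ae_eq_def using *(2,3)[unfolded ae_eq_def] by eventually_elim (simp add: algebra_simps)
    then have y: "eqn l (complex_of_real r) y ?f" unfolding eqn_def using *(1) by blast
    have Lf: "L2 l ?f" by (intro L2_add L2_cmult Lz w)
    have "ip l ?f z = ip l y (\<lambda>x. - (of_real \<alpha> * ip l z w) * w x)"
      using eqn_symmetric[OF _ y z Lf L2_cmult[OF w]] l by simp
    moreover have "ip l ?f z = of_real (nsq l z) - of_real \<alpha> * ip l y w * ip l w z"
      unfolding ip_add_left[OF Lz L2_cmult[OF w] Lz] ip_cmult_left by (simp add: ip_self)
    moreover have "ip l y (\<lambda>x. - (of_real \<alpha> * ip l z w) * w x) = - of_real \<alpha> * ip l w z * ip l y w"
      unfolding ip_cmult_right by (simp add: ip_cnj[of l w z])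
    ultimately have "nsq l z = 0" by simp
    then show ?thesis by (rule nsq_eq_0_imp[OF Lz])
  qed
  then have "gen_eig l \<alpha> w (complex_of_real r) (Suc 0) y"
    using * by (auto simp: Lop_def)
  then show ?case by blast
qed simp

definition eigenvec :: "real \<Rightarrow> real \<Rightarrow> (real \<Rightarrow> complex) \<Rightarrow> complex \<Rightarrow> (real \<Rightarrow> complex) \<Rightarrow> bool" where
  "eigenvec l \<alpha> w lam y \<longleftrightarrow> eqn l lam y (\<lambda>x. - (of_real \<alpha> * ip l y w) * w x)"

lemma root_space_cases:
  assumes "0 < l" "L2 l w" "y \<in> root_space l \<alpha> w (complex_of_real r)"
  shows "ae_eq l y (\<lambda>x. 0) \<or> eigenvec l \<alpha> w (complex_of_real r) y"
  using assms gen_eig_imp_eigenvector[OF assms(1,2)] unfolding root_space_def eigenvec_def gen_eig_1_iff by blast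

lemma eigenvec_root_space: "eigenvec l \<alpha> w lam y \<Longrightarrow> y \<in> root_space l \<alpha> w lam"
  unfolding root_space_def eigenvec_def using gen_eig_1_iff by blast

lemma alg_mult_ge:
  assumes "finite S" "S \<subseteq> root_space l \<alpha> w lam" "lin_indep_L2 l S"
  shows "enat (card S) \<le> alg_mult l \<alpha> w lam"
  unfolding alg_mult_def using assms by (intro Sup_upper) blast

lemma alg_mult_le:
  assumes "\<And>S. finite S \<Longrightarrow> S \<subseteq> root_space l \<alpha> w lam \<Longrightarrow> lin_indep_L2 l S \<Longrightarrow> card S \<le> n"
  shows "alg_mult l \<alpha> w lam \<le> enat n"
  unfolding alg_mult_def using assms by (intro Sup_least) auto

lemma lin_indep_L2_nonnull:
  assumes "lin_indep_L2 l S" "finite S" "s \<in> S"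
  shows "\<not> ae_eq l s (\<lambda>x. 0)"
proof
  assume 0: "ae_eq l s (\<lambda>x. 0)"
  have "(\<Sum>t\<in>S. (if t = s then 1 else 0) * t x) = s x" for x
    using assms by (simp add: if_distrib[of "\<lambda>c. c * _ x"] cong: if_cong)
  then have "ae_eq l (\<lambda>x. \<Sum>t\<in>S. (if t = s then 1 else 0) * t x) (\<lambda>x. 0)" using 0 by simp
  then have "\<forall>t\<in>S. (if t = s then 1 else 0 :: complex) = 0"
    using assms(1)[unfolded lin_indep_L2_def, rule_format, of "\<lambda>t. if t = s then 1 else 0"] by blast
  then show False using assms by auto
qed

lemma alg_mult_eq_0:
  assumes "\<And>y. y \<in> root_space l \<alpha> w lam \<Longrightarrow> ae_eq l y (\<lambda>x. 0)"
  shows "alg_mult l \<alpha> w lam = 0"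
proof -
  have "alg_mult l \<alpha> w lam \<le> enat 0"
    using lin_indep_L2_nonnull assms by (intro alg_mult_le) fastforce
  then show ?thesis by (simp add: zero_enat_def[symmetric])
qed

lemma alg_mult_le_1:
  assumes "\<And>y. y \<in> root_space l \<alpha> w lam \<Longrightarrow> \<exists>c. ae_eq l y (\<lambda>x. c * \<phi> x)"
  shows "alg_mult l \<alpha> w lam \<le> enat 1"
proof (rule alg_mult_le, rule ccontr)
  fix S assume S: "finite S" "S \<subseteq> root_space l \<alpha> w lam" "lin_indep_L2 l S" "\<not> card S \<le> 1"
  obtain s t where st: "s \<in> S" "t \<in> S" "s \<noteq> t"
    using S(4) by (metis One_nat_def card_le_Suc0_iff_eq[OF S(1)])
  obtain a b where ab: "ae_eq l s (\<lambda>x. a * \<phi> x)" "ae_eq l t (\<lambda>x. b * \<phi> x)"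
    using assms st S(2) by blast
  \<comment> \<open>For s = a phi and t = b phi the combination b s - a t is null; independence then
    forces a = 0, so s would be null.\<close>
  define c where "c = (\<lambda>k. if k = s then b else if k = t then - a else 0)"
  have "(\<Sum>k\<in>S. c k * k x) = b * s x - a * t x" for x
  proof -
    have "(\<Sum>k\<in>S. c k * k x) = (\<Sum>k\<in>{s, t}. c k * k x)"
      using st S(1) by (intro sum.mono_neutral_right) (auto simp: c_def)
    then show ?thesis using st by (simp add: c_def)
  qed
  moreover have "ae_eq l (\<lambda>x. b * s x - a * t x) (\<lambda>x. 0)"
    unfolding ae_eq_def using ab[unfolded ae_eq_def] by eventually_elim simp
  ultimately have "ae_eq l (\<lambda>x. \<Sum>k\<in>S. c k * k x) (\<lambda>x. 0)" by simp
  then have "\<forall>k\<in>S. c k = 0" using S(3) unfolding lin_indep_L2_def by blast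
  then have "a = 0" using st by (auto simp: c_def split: if_splits)
  then show False using ab(1) lin_indep_L2_nonnull[OF S(3,1) st(1)] by simp
qed

lemma lin_indep_L2_singleton:
  assumes "\<not> ae_eq l y (\<lambda>x. 0)"
  shows "lin_indep_L2 l {y}"
  unfolding lin_indep_L2_def
proof (intro allI impI)
  fix c :: "(real \<Rightarrow> complex) \<Rightarrow> complex"
  assume "ae_eq l (\<lambda>x. \<Sum>s\<in>{y}. c s * s x) (\<lambda>x. 0)"
  then have "ae_eq l (\<lambda>x. c y * y x) (\<lambda>x. 0)" by simp
  then have "c y \<noteq> 0 \<Longrightarrow> ae_eq l y (\<lambda>x. 0)"
    unfolding ae_eq_def by (auto elim: eventually_mono)
  then show "\<forall>s\<in>{y}. c s = 0" using assms by auto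
qed

text \<open>The multiplicity of r for \<open>L_0\<close>: it is at most 1 by
  \<open>kernel_dim_le_1\<close>.\<close>

definition mult0 :: "real \<Rightarrow> real \<Rightarrow> nat" where
  "mult0 l r = (if char_det l (complex_of_real r) = 0 then 1 else 0)"

text \<open>The kernel is orthogonal to the range, and \<open>eqn_res\<close> makes y itself an
  element of the range.\<close>

lemma kernel_trivial:
  assumes "0 < l" "char_det l (complex_of_real r) \<noteq> 0" "eqn l (complex_of_real r) y (\<lambda>x. 0)"
  shows "ae_eq l y (\<lambda>x. 0)"
proof -
  have L: "L2 l y" using assms eqn_L2 by blast
  have "ip l y y = 0"
    using eqn_range_perp_kernel(1)[OF _ assms(3) eqn_res[OF _ L assms(2)] L] assms by simp
  then show ?thesis using nsq_eq_0_imp[OF L] by (simp add: ip_self)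
qed

lemma eqn_zeroI: "eqn l lam y (\<lambda>x. c * w x) \<Longrightarrow> c = 0 \<Longrightarrow> eqn l lam y (\<lambda>x. 0)"
  by simp

text \<open>The perturbation removes this eigenvalue of \<open>L_0\<close>. Pairing the eigenvalue
  equation with \<open>\<phi>\<close> gives <y, w> = 0, so y lies in the kernel of L_0 - r and is a
  multiple of \<open>\<phi>\<close>; as <phi, w> is not 0, the multiple is 0.\<close>

lemma alg_mult_singular:
  assumes l: "0 < l" and w: "L2 l w" and \<alpha>: "\<alpha> \<noteq> 0"
    and \<phi>: "eqn l (complex_of_real r) \<phi> (\<lambda>x. 0)" "ip l w \<phi> \<noteq> 0"
  shows "alg_mult l \<alpha> w (complex_of_real r) = 0"
proof (rule alg_mult_eq_0)
  fix y assume "y \<in> root_space l \<alpha> w (complex_of_real r)"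
  then consider "ae_eq l y (\<lambda>x. 0)" | "eigenvec l \<alpha> w (complex_of_real r) y"
    using root_space_cases[OF l w] by blast
  then show "ae_eq l y (\<lambda>x. 0)"
  proof cases
    case 2
    have L\<phi>: "L2 l \<phi>" using \<phi> eqn_L2 by blast
    have "nsq l \<phi> \<noteq> 0"
    proof
      assume "nsq l \<phi> = 0"
      then have "ip l w \<phi> = ip l w (\<lambda>x. 0)"
        using nsq_eq_0_imp[OF L\<phi>] L\<phi> w by (intro ip_cong_right) auto
      then show False using \<phi> by simp
    qed
    note y = 2[unfolded eigenvec_def]
    have Ly: "L2 l y" using y eqn_L2 by blast
    have "ip l (\<lambda>x. - (of_real \<alpha> * ip l y w) * w x) \<phi> = 0"
      using eqn_range_perp_kernel(1)[OF _ \<phi>(1) y L2_cmult[OF w]] l by simp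
    then have k: "ip l y w = 0" using \<alpha> \<phi>(2) unfolding ip_cmult_left by simp
    have "eqn l (complex_of_real r) y (\<lambda>x. 0)"
      by (rule eqn_zeroI[OF y]) (simp add: k)
    then obtain c where c: "ae_eq l y (\<lambda>x. c * \<phi> x)"
      using kernel_dim_le_1[OF l \<phi>(1) \<open>nsq l \<phi> \<noteq> 0\<close>] by blast
    have "ip l y w = c * ip l \<phi> w"
      using ip_cong_left[OF c Ly L2_cmult[OF L\<phi>] w] by simp
    moreover have "ip l \<phi> w \<noteq> 0" using \<phi>(2) by (simp add: ip_cnj[of l \<phi> w])
    ultimately have "c = 0" using k by simp
    then show ?thesis using c by simp
  qed
qed

text \<open>For an eigenvector y the function y + alpha <y, w> z lies in the kernel of L_0 - r,
  which is orthogonal to w because w is in the range. Pairing with w gives <y, w> (1 + alpha <z, w>)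
  = 0, so the eigenvectors are exactly the kernel of L_0 - r.\<close>

lemma alg_mult_regular:
  assumes l: "0 < l" and w: "L2 l w"
    and z: "eqn l (complex_of_real r) z w" "1 + of_real \<alpha> * ip l z w \<noteq> 0"
  shows "alg_mult l \<alpha> w (complex_of_real r) = enat (mult0 l r)"
proof -
  have Lz: "L2 l z" using z eqn_L2 by blast
  have root: "ae_eq l y (\<lambda>x. 0) \<or> eqn l (complex_of_real r) y (\<lambda>x. 0)"
    if "y \<in> root_space l \<alpha> w (complex_of_real r)" for y
    using root_space_cases[OF l w that]
  proof
    assume "eigenvec l \<alpha> w (complex_of_real r) y"
    note y = this[unfolded eigenvec_def]
    have Ly: "L2 l y" using y eqn_L2 by blast
    define \<kappa> where "\<kappa> = of_real \<alpha> * ip l y w"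
    have "eqn l (complex_of_real r) (\<lambda>x. 1 * y x + \<kappa> * z x) (\<lambda>x. 1 * (- \<kappa> * w x) + \<kappa> * w x)"
      using eqn_lincomb[OF y z(1), of 1 \<kappa>] by (simp add: \<kappa>_def)
    then have "eqn l (complex_of_real r) (\<lambda>x. y x + \<kappa> * z x) (\<lambda>x. 0)" by simp
    then have "ip l (\<lambda>x. y x + \<kappa> * z x) w = 0"
      using eqn_range_perp_kernel(2)[OF _ _ z(1) w] l by simp
    then have "ip l y w * (1 + of_real \<alpha> * ip l z w) = 0"
      unfolding ip_add_left[OF Ly L2_cmult[OF Lz] w] ip_cmult_left by (simp add: \<kappa>_def algebra_simps)
    then have "ip l y w = 0" using z by simp
    then have "eqn l (complex_of_real r) y (\<lambda>x. 0)" by (intro eqn_zeroI[OF y]) simp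
    then show ?thesis by blast
  qed blast
  show ?thesis
  proof (cases "char_det l (complex_of_real r) = 0")
    case False
    then have "alg_mult l \<alpha> w (complex_of_real r) = 0"
      using root kernel_trivial[OF l False] by (intro alg_mult_eq_0) blast
    then show ?thesis using False by (simp add: mult0_def zero_enat_def)
  next
    case True
    obtain \<phi> where \<phi>: "eqn l (complex_of_real r) \<phi> (\<lambda>x. 0)" "nsq l \<phi> \<noteq> 0"
      using char_det_eq_0_eigenfunction[OF l True] by blast
    have L\<phi>: "L2 l \<phi>" using \<phi> eqn_L2 by blast
    have "\<exists>c. ae_eq l y (\<lambda>x. c * \<phi> x)" if "y \<in> root_space l \<alpha> w (complex_of_real r)" for y
      using root[OF that]
    proof
      assume "ae_eq l y (\<lambda>x. 0)"
      then show ?thesis by (intro exI[of _ 0]) simp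
    qed (use kernel_dim_le_1[OF l \<phi>] in blast)
    then have "alg_mult l \<alpha> w (complex_of_real r) \<le> enat 1" by (rule alg_mult_le_1)
    moreover have "ip l \<phi> w = 0"
      using eqn_range_perp_kernel(2)[OF _ \<phi>(1) z(1) w] l by simp
    then have "\<phi> \<in> root_space l \<alpha> w (complex_of_real r)"
      using \<phi>(1) by (intro eigenvec_root_space) (simp add: eigenvec_def)
    then have "enat (card {\<phi>}) \<le> alg_mult l \<alpha> w (complex_of_real r)"
      using \<phi>(2) nsq_eq_0_iff[OF L\<phi>] by (intro alg_mult_ge lin_indep_L2_singleton) auto
    ultimately show ?thesis using True by (simp add: mult0_def)
  qed
qed

text \<open>Now z itself is an eigenvector, as - alpha <z, w> = 1. It is independent of the kernel
  of L_0 - r, on which the pairing with w vanishes while <z, w> does not.\<close>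

lemma alg_mult_zero:
  assumes l: "0 < l" and w: "L2 l w"
    and z: "eqn l (complex_of_real r) z w" "1 + of_real \<alpha> * ip l z w = 0"
  shows "alg_mult l \<alpha> w (complex_of_real r) \<ge> enat (Suc (mult0 l r))"
proof -
  have Lz: "L2 l z" using z eqn_L2 by blast
  have k: "- (of_real \<alpha> * ip l z w) = 1" using z(2) by (simp add: add_eq_0_iff)
  have zw: "ip l z w \<noteq> 0" using z(2) by auto
  have zr: "z \<in> root_space l \<alpha> w (complex_of_real r)"
    using z(1) by (intro eigenvec_root_space) (simp only: eigenvec_def k mult_1)
  have zn: "\<not> ae_eq l z (\<lambda>x. 0)"
    using zw ip_cong_left[OF _ Lz L2_zero w] by auto
  show ?thesis
  proof (cases "char_det l (complex_of_real r) = 0")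
    case False
    have "enat (card {z}) \<le> alg_mult l \<alpha> w (complex_of_real r)"
      using zr zn by (intro alg_mult_ge lin_indep_L2_singleton) auto
    then show ?thesis using False by (simp add: mult0_def)
  next
    case True
    obtain \<phi> where \<phi>: "eqn l (complex_of_real r) \<phi> (\<lambda>x. 0)" "nsq l \<phi> \<noteq> 0"
      using char_det_eq_0_eigenfunction[OF l True] by blast
    have L\<phi>: "L2 l \<phi>" using \<phi> eqn_L2 by blast
    have pw: "ip l \<phi> w = 0"
      using eqn_range_perp_kernel(2)[OF _ \<phi>(1) z(1) w] l by simp
    then have pr: "\<phi> \<in> root_space l \<alpha> w (complex_of_real r)"
      using \<phi>(1) by (intro eigenvec_root_space) (simp add: eigenvec_def)
    have ne: "\<phi> \<noteq> z" using pw zw by auto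
    have "lin_indep_L2 l {\<phi>, z}"
      unfolding lin_indep_L2_def
    proof (intro allI impI)
      fix c :: "(real \<Rightarrow> complex) \<Rightarrow> complex"
      assume "ae_eq l (\<lambda>x. \<Sum>s\<in>{\<phi>, z}. c s * s x) (\<lambda>x. 0)"
      then have 0: "ae_eq l (\<lambda>x. c \<phi> * \<phi> x + c z * z x) (\<lambda>x. 0)" using ne by simp
      have "ip l (\<lambda>x. c \<phi> * \<phi> x + c z * z x) w = ip l (\<lambda>x. 0) w"
        by (intro ip_cong_left[OF 0] L2_add L2_cmult L\<phi> Lz w L2_zero)
      then have "c z * ip l z w = 0"
        using ip_add_left[OF L2_cmult[OF L\<phi>] L2_cmult[OF Lz] w] pw by simp
      then have cz: "c z = 0" using zw by simp
      have "c \<phi> = 0"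
      proof (rule ccontr)
        assume "c \<phi> \<noteq> 0"
        then have "ae_eq l \<phi> (\<lambda>x. 0)" using 0 cz unfolding ae_eq_def by (auto elim: eventually_mono)
        then show False using \<phi>(2) nsq_eq_0_iff[OF L\<phi>] by simp
      qed
      then show "\<forall>s\<in>{\<phi>, z}. c s = 0" using cz by simp
    qed
    then have "enat (card {\<phi>, z}) \<le> alg_mult l \<alpha> w (complex_of_real r)"
      using zr pr by (intro alg_mult_ge) auto
    then show ?thesis using True ne by (simp add: mult0_def)
  qed
qed

section \<open>Uniqueness\<close>

text \<open>If only one of w, w' is orthogonal to a nontrivial kernel, the multiplicities are 0 on
  one side and at least 1 on the other, which is excluded. If neither is, both expressions are of
  order 1/eta. If both functions have preimages, the limits t and t' vanish together, so either the
  left side is O(eta) or the right side stays away from 0.\<close>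

lemma one_plus_rform_vertical_comparison:
  fixes \<alpha> \<alpha>' :: real
  assumes l: "0 < l" and \<alpha>: "\<alpha> \<noteq> 0" "\<alpha>' \<noteq> 0" and w: "L2 l w" "L2 l w'"
    and eq: "alg_mult l \<alpha> w (complex_of_real r) = alg_mult l \<alpha>' w' (complex_of_real r)"
  shows "\<exists>K. \<forall>\<^sub>F \<eta> in at_right 0. cmod (1 + \<alpha> * rform l w (Complex r \<eta>)) \<le> K * cmod (1 + \<alpha>' * rform l w' (Complex r \<eta>))"
proof -
  let ?s = "\<lambda>\<eta>. 1 + \<alpha> * rform l w (Complex r \<eta>)"
  let ?s' = "\<lambda>\<eta>. 1 + \<alpha>' * rform l w' (Complex r \<eta>)"
  have ev: "\<forall>\<^sub>F \<eta> in at_right 0. 0 < \<eta> \<and> \<eta> < d" if "d > 0" for d :: real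
    using that eventually_at_right_real[OF that] by (auto elim: eventually_mono)
  have near: "\<exists>C\<ge>0. \<forall>\<eta>>0. cmod ((1 + of_real a * rform l u (Complex r \<eta>)) - (1 + of_real a * ip l z u)) \<le> C * \<eta>"
    if u: "L2 l u" and z: "eqn l (complex_of_real r) z u" "eqn l (complex_of_real r) z2 z" for a :: real and u z z2
  proof (intro exI conjI allI impI)
    define C where "C = cmod (ip l z2 u) + sqrt (nsq l z2 * nsq l u)"
    show "0 \<le> \<bar>a\<bar> * C" by (simp add: C_def)
    fix \<eta> :: real assume "\<eta> > 0"
    from rform_near_regular[OF l u z this]
    have "\<bar>a\<bar> * cmod (rform l u (Complex r \<eta>) - ip l z u) \<le> \<bar>a\<bar> * (C * \<eta>)"
      unfolding C_def by (intro mult_left_mono) auto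
    then show "cmod ((1 + of_real a * rform l u (Complex r \<eta>)) - (1 + of_real a * ip l z u)) \<le> \<bar>a\<bar> * C * \<eta>"
      by (simp add: right_diff_distrib[symmetric] norm_mult mult.assoc)
  qed
  show ?thesis
  proof (rule real_point_dichotomy[OF l w(1), of r]; rule real_point_dichotomy[OF l w(2), of r])
    fix \<phi> \<phi>'
    assume "eqn l (complex_of_real r) \<phi> (\<lambda>x. 0)" "ip l w \<phi> \<noteq> 0"
      and \<phi>': "eqn l (complex_of_real r) \<phi>' (\<lambda>x. 0)" "ip l w' \<phi>' \<noteq> 0"
    \<comment> \<open>A lower bound for eta |alpha' F_w'| from
      \<open>rform_near_singular\<close>.\<close>
    define c where "c = \<bar>\<alpha>'\<bar> * (cmod (ip l w' \<phi>'))\<^sup>2 / (nsq l \<phi>' + 1)"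
    have n1: "nsq l \<phi>' + 1 > 0" using nsq_nonneg[of l \<phi>'] by linarith
    have c: "c > 0" using \<phi>'(2) \<alpha> n1 by (simp add: c_def)
    have low: "c \<le> \<eta> * (\<bar>\<alpha>'\<bar> * cmod (rform l w' (Complex r \<eta>)))" if \<eta>: "\<eta> > 0" for \<eta>
    proof -
      have "(cmod (ip l w' \<phi>'))\<^sup>2 \<le> nsq l \<phi>' * \<eta> * cmod (rform l w' (Complex r \<eta>))"
        by (rule rform_near_singular[OF l w(2) \<phi>'(1) \<eta>])
      also have "\<dots> \<le> (nsq l \<phi>' + 1) * \<eta> * cmod (rform l w' (Complex r \<eta>))"
        using \<eta> by (intro mult_right_mono) auto
      finally have "\<bar>\<alpha>'\<bar> * (cmod (ip l w' \<phi>'))\<^sup>2 \<le> \<bar>\<alpha>'\<bar> * ((nsq l \<phi>' + 1) * \<eta> * cmod (rform l w' (Complex r \<eta>)))"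
        by (intro mult_left_mono) auto
      then show ?thesis using n1 by (simp add: c_def divide_le_eq mult_ac)
    qed
    define N where "N = 1 + \<bar>\<alpha>\<bar> * nsq l w"
    \<comment> \<open>eta < 1 gives the bound N on the left; eta < c / 2 ensures that the summand 1
      costs at most half of c on the right.\<close>
    have "min 1 (c / 2) > 0" using c by simp
    from ev[OF this] have "\<forall>\<^sub>F \<eta> in at_right 0. cmod (?s \<eta>) \<le> (2 * N / c) * cmod (?s' \<eta>)"
    proof (eventually_elim)
      case (elim \<eta>)
      then have \<eta>: "0 < \<eta>" "\<eta> < 1" "\<eta> < c / 2" by auto
      have "\<eta> * cmod (?s \<eta>) \<le> \<eta> * (1 + \<bar>\<alpha>\<bar> * cmod (rform l w (Complex r \<eta>)))"
        using \<eta> norm_triangle_ineq[of 1 "of_real \<alpha> * rform l w (Complex r \<eta>)"]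
        by (intro mult_left_mono) (auto simp: norm_mult)
      also have "\<dots> \<le> \<eta> * (1 + \<bar>\<alpha>\<bar> * (nsq l w / \<eta>))"
        using \<eta> rform_bound[OF l _ w(1), of "Complex r \<eta>"] by (intro mult_left_mono add_left_mono) auto
      also have "\<dots> \<le> N" using \<eta> by (simp add: N_def field_simps)
      finally have 1: "\<eta> * cmod (?s \<eta>) \<le> N" .
      have "\<bar>\<alpha>'\<bar> * cmod (rform l w' (Complex r \<eta>)) - 1 \<le> cmod (?s' \<eta>)"
        using norm_diff_ineq[of "of_real \<alpha>' * rform l w' (Complex r \<eta>)" 1] by (simp add: norm_mult add.commute)
      then have "\<eta> * (\<bar>\<alpha>'\<bar> * cmod (rform l w' (Complex r \<eta>)) - 1) \<le> \<eta> * cmod (?s' \<eta>)"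
        using \<eta> by (intro mult_left_mono) auto
      then have 2: "c / 2 \<le> \<eta> * cmod (?s' \<eta>)"
        using low[OF \<eta>(1)] \<eta>(3) by (simp add: right_diff_distrib)
      have "N \<ge> 0" by (simp add: N_def)
      have "\<eta> * cmod (?s \<eta>) \<le> (2 * N / c) * (c / 2)" using 1 c by simp
      also have "\<dots> \<le> (2 * N / c) * (\<eta> * cmod (?s' \<eta>))"
        using 2 c \<open>N \<ge> 0\<close> by (intro mult_left_mono) auto
      also have "\<dots> = \<eta> * ((2 * N / c) * cmod (?s' \<eta>))" by simp
      finally show ?case using \<eta>(1) by (simp only: mult_le_cancel_left_pos)
    qed
    then show ?thesis by blast
  next
    fix \<phi> z z2
    assume \<phi>: "char_det l (complex_of_real r) = 0" "eqn l (complex_of_real r) \<phi> (\<lambda>x. 0)" "ip l w \<phi> \<noteq> 0"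
      and z: "eqn l (complex_of_real r) z w'"
    have "alg_mult l \<alpha> w (complex_of_real r) = 0"
      by (rule alg_mult_singular[OF l w(1) \<alpha>(1) \<phi>(2,3)])
    moreover have "alg_mult l \<alpha>' w' (complex_of_real r) \<ge> enat 1"
    proof (cases "1 + of_real \<alpha>' * ip l z w' = 0")
      case True
      then show ?thesis
        using alg_mult_zero[OF l w(2) z True] order_trans[of "enat 1" "enat (Suc (mult0 l r))"] by simp
    next
      case False
      then show ?thesis using alg_mult_regular[OF l w(2) z False] \<phi>(1) by (simp add: mult0_def)
    qed
    ultimately show ?thesis using eq by (simp add: zero_enat_def)
  next
    fix \<phi> z z2
    assume \<phi>: "char_det l (complex_of_real r) = 0" "eqn l (complex_of_real r) \<phi> (\<lambda>x. 0)" "ip l w' \<phi> \<noteq> 0"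
      and z: "eqn l (complex_of_real r) z w"
    have "alg_mult l \<alpha>' w' (complex_of_real r) = 0"
      by (rule alg_mult_singular[OF l w(2) \<alpha>(2) \<phi>(2,3)])
    moreover have "alg_mult l \<alpha> w (complex_of_real r) \<ge> enat 1"
    proof (cases "1 + of_real \<alpha> * ip l z w = 0")
      case True
      then show ?thesis
        using alg_mult_zero[OF l w(1) z True] order_trans[of "enat 1" "enat (Suc (mult0 l r))"] by simp
    next
      case False
      then show ?thesis using alg_mult_regular[OF l w(1) z False] \<phi>(1) by (simp add: mult0_def)
    qed
    ultimately show ?thesis using eq by (simp add: zero_enat_def)
  next
    fix z z2 z' z2'
    assume z: "eqn l (complex_of_real r) z w" "eqn l (complex_of_real r) z2 z"
      and z': "eqn l (complex_of_real r) z' w'" "eqn l (complex_of_real r) z2' z'"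
    define t t' where "t = 1 + of_real \<alpha> * ip l z w" and "t' = 1 + of_real \<alpha>' * ip l z' w'"
    obtain C where C: "C \<ge> 0" "\<And>\<eta>. \<eta> > 0 \<Longrightarrow> cmod (?s \<eta> - t) \<le> C * \<eta>"
      using near[OF w(1) z, of \<alpha>] unfolding t_def by blast
    obtain C' where C': "C' \<ge> 0" "\<And>\<eta>. \<eta> > 0 \<Longrightarrow> cmod (?s' \<eta> - t') \<le> C' * \<eta>"
      using near[OF w(2) z', of \<alpha>'] unfolding t'_def by blast
    have "t = 0 \<longleftrightarrow> t' = 0"
      using alg_mult_regular[OF l w(1) z(1), of \<alpha>] alg_mult_zero[OF l w(1) z(1), of \<alpha>]
        alg_mult_regular[OF l w(2) z'(1), of \<alpha>'] alg_mult_zero[OF l w(2) z'(1), of \<alpha>'] eq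
      unfolding t_def t'_def by (metis Suc_n_not_le_n enat_ord_simps(1))
    then consider "t = 0" | "t' \<noteq> 0" by blast
    then show ?thesis
    proof cases
      case 1
      \<comment> \<open>The left side is at most C eta since t = 0, and
        \<open>one_plus_rform\<close> keeps the right side above eta / N for eta < 1.\<close>
      define N where "N = 2 + 4 * \<bar>\<alpha>'\<bar> * nsq l w'"
      have "\<forall>\<^sub>F \<eta> in at_right 0. cmod (?s \<eta>) \<le> (C * N) * cmod (?s' \<eta>)"
        using ev[OF zero_less_one]
      proof eventually_elim
        case (elim \<eta>)
        have "\<eta> * 1 \<le> \<eta> * ((2 + 4 * \<bar>\<alpha>'\<bar> * nsq l w' / \<eta>) * cmod (?s' \<eta>))"
          using one_plus_rform(2)[OF l _ w(2), of "Complex r \<eta>" \<alpha>'] elim by (intro mult_left_mono) auto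
        also have "\<dots> = (\<eta> * 2 + 4 * \<bar>\<alpha>'\<bar> * nsq l w') * cmod (?s' \<eta>)"
          using elim by (simp add: field_simps)
        also have "\<dots> \<le> N * cmod (?s' \<eta>)"
          using elim by (intro mult_right_mono) (auto simp: N_def)
        finally have "\<eta> \<le> N * cmod (?s' \<eta>)" by simp
        then have "C * \<eta> \<le> C * (N * cmod (?s' \<eta>))" using C by (intro mult_left_mono) auto
        moreover have "cmod (?s \<eta>) \<le> C * \<eta>" using C(2)[of \<eta>] elim 1 by simp
        ultimately show ?case by simp
      qed
      then show ?thesis by blast
    next
      case 2
      define b where "b = cmod t' / 2"
      have b: "b > 0" using 2 by (simp add: b_def)
      \<comment> \<open>Below this threshold the error C' eta is at most b, half of |t'|, so the
        right side is at least b.\<close>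
      have "min 1 (b / (C' + 1)) > 0" using b C'(1) by simp
      from ev[OF this] have "\<forall>\<^sub>F \<eta> in at_right 0. cmod (?s \<eta>) \<le> ((cmod t + C) / b) * cmod (?s' \<eta>)"
      proof eventually_elim
        case (elim \<eta>)
        then have \<eta>: "0 < \<eta>" "\<eta> < 1" "\<eta> * (C' + 1) < b" using C'(1) by (auto simp: pos_less_divide_eq)
        have "cmod (?s \<eta>) \<le> cmod t + cmod (?s \<eta> - t)" by (metis norm_triangle_sub)
        also have "\<dots> \<le> cmod t + C * 1"
          using C(2)[OF \<eta>(1)] mult_left_mono[of \<eta> 1 C] C(1) \<eta> by linarith
        finally have 1: "cmod (?s \<eta>) \<le> cmod t + C" by simp
        have "cmod t' \<le> cmod (?s' \<eta>) + cmod (t' - ?s' \<eta>)" by (metis norm_triangle_sub)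
        moreover have "cmod (t' - ?s' \<eta>) \<le> C' * \<eta>" using C'(2)[OF \<eta>(1)] by (simp add: norm_minus_commute)
        moreover have "C' * \<eta> \<le> b" using \<eta> by (simp add: algebra_simps)
        ultimately have 2: "b \<le> cmod (?s' \<eta>)" by (simp add: b_def)
        have "cmod (?s \<eta>) \<le> ((cmod t + C) / b) * b" using 1 b by simp
        also have "\<dots> \<le> ((cmod t + C) / b) * cmod (?s' \<eta>)"
          using 2 b C(1) by (intro mult_left_mono) auto
        finally show ?case .
      qed
      then show ?thesis by blast
    qed
  qed
qed

lemma rform_tendsto_0:
  assumes l: "0 < l" and w: "L2 l w"
  shows "((\<lambda>\<eta>. rform l w (Complex 0 \<eta>)) \<longlongrightarrow> 0) at_top"
proof (rule Lim_null_comparison)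
  show "\<forall>\<^sub>F \<eta> in at_top. norm (rform l w (Complex 0 \<eta>)) \<le> nsq l w / \<eta>"
    using eventually_gt_at_top[of "0::real"]
  proof eventually_elim
    case (elim \<eta>)
    then show ?case using rform_bound[OF l _ w, of "Complex 0 \<eta>"] by simp
  qed
  show "((\<lambda>\<eta>. nsq l w / \<eta>) \<longlongrightarrow> 0) at_top"
    by (intro tendsto_divide_0[OF tendsto_const] filterlim_at_top_imp_at_infinity filterlim_ident)
qed

lemma same_spectrum_rform:
  fixes \<alpha> \<alpha>' :: real
  assumes l: "0 < l" and \<alpha>: "\<alpha> \<noteq> 0" "\<alpha>' \<noteq> 0" and w: "L2 l w" "L2 l w'"
    and eq: "same_spectrum l \<alpha> w \<alpha>' w'" and lam: "Im lam \<noteq> 0"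
  shows "\<alpha> * rform l w lam = \<alpha>' * rform l w' lam"
proof -
  \<comment> \<open>The entire function \<open>char_det\<close> (1 + alpha F_w); the factor
    \<open>char_det\<close> cancels in the quotient of two of these.\<close>
  define N where "N = (\<lambda>(\<alpha>::real) w lam. char_det l lam + \<alpha> * ip l (res_num l lam w) w)"
  have Nh: "N \<alpha> w holomorphic_on UNIV" if "L2 l w" for \<alpha> w
    unfolding N_def using l that by (intro holomorphic_intros char_det_holomorphic ip_res_num_holomorphic) auto
  have NF: "N \<alpha> w lam = char_det l lam * (1 + \<alpha> * rform l w lam)" if "Im lam \<noteq> 0" for \<alpha> w lam
    using char_det_nonreal[OF l that] by (simp add: N_def rform_eq field_simps)
  obtain H where H: "H holomorphic_on UNIV" "\<And>z. Im z \<noteq> 0 \<Longrightarrow> H z = N \<alpha> w z / N \<alpha>' w' z"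
  proof (rule entire_quotient[OF Nh[OF w(1), of \<alpha>] Nh[OF w(2), of \<alpha>']])
    show "N \<alpha>' w' z \<noteq> 0" if "Im z \<noteq> 0" for z
      using NF[OF that] char_det_nonreal[OF l that] one_plus_rform(1)[OF l that w(2)] by simp
    show "\<exists>K. \<forall>\<^sub>F \<eta> in at_right 0. cmod (N \<alpha> w (Complex r \<eta>)) \<le> K * cmod (N \<alpha>' w' (Complex r \<eta>))" for r
    proof -
      obtain K where "\<forall>\<^sub>F \<eta> in at_right 0. cmod (1 + \<alpha> * rform l w (Complex r \<eta>)) \<le> K * cmod (1 + \<alpha>' * rform l w' (Complex r \<eta>))"
        using one_plus_rform_vertical_comparison[OF l \<alpha> w] eq unfolding same_spectrum_def by blast
      then have "\<forall>\<^sub>F \<eta> in at_right 0. cmod (N \<alpha> w (Complex r \<eta>)) \<le> K * cmod (N \<alpha>' w' (Complex r \<eta>))"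
        using eventually_at_right_less[of "0::real"]
      proof eventually_elim
        case (elim \<eta>)
        then have "cmod (char_det l (Complex r \<eta>)) * cmod (1 + \<alpha> * rform l w (Complex r \<eta>)) \<le> cmod (char_det l (Complex r \<eta>)) * (K * cmod (1 + \<alpha>' * rform l w' (Complex r \<eta>)))"
          by (intro mult_left_mono) auto
        then show ?case using elim by (simp add: NF norm_mult mult_ac)
      qed
      then show ?thesis by blast
    qed
  qed (rule that)
  have HF: "H z = (1 + \<alpha> * rform l w z) / (1 + \<alpha>' * rform l w' z)" if "Im z \<noteq> 0" for z
    using H(2)[OF that] char_det_nonreal[OF l that] by (simp add: NF[OF that])
  \<comment> \<open>Large enough for both the upper bound on 1 + alpha F_w and the bound on the
    inverse of 1 + alpha' F_w', so that the product is a square of the form in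
    \<open>entire_Im_bound_constant\<close>.\<close>
  define b where "b = \<bar>\<alpha>\<bar> * nsq l w + 4 * \<bar>\<alpha>'\<bar> * nsq l w'"
  have "cmod (H z) \<le> (2 + b / \<bar>Im z\<bar>)\<^sup>2" if z: "Im z \<noteq> 0" for z
  proof -
    have 1: "cmod (1 + \<alpha> * rform l w z) \<le> 2 + b / \<bar>Im z\<bar>"
    proof -
      have "cmod (1 + \<alpha> * rform l w z) \<le> 1 + \<bar>\<alpha>\<bar> * cmod (rform l w z)"
        using norm_triangle_ineq[of 1 "of_real \<alpha> * rform l w z"] by (simp add: norm_mult)
      also have "\<dots> \<le> 1 + \<bar>\<alpha>\<bar> * (nsq l w / \<bar>Im z\<bar>)"
        by (intro add_left_mono mult_left_mono rform_bound[OF l z w(1)]) auto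
      also have "\<dots> \<le> 2 + b / \<bar>Im z\<bar>"
        unfolding times_divide_eq_right by (intro add_mono divide_right_mono) (auto simp: b_def)
      finally show ?thesis .
    qed
    have "1 \<le> (2 + 4 * \<bar>\<alpha>'\<bar> * nsq l w' / \<bar>Im z\<bar>) * cmod (1 + \<alpha>' * rform l w' z)"
      by (rule one_plus_rform(2)[OF l z w(2)])
    also have "\<dots> \<le> (2 + b / \<bar>Im z\<bar>) * cmod (1 + \<alpha>' * rform l w' z)"
      by (intro mult_right_mono add_left_mono divide_right_mono) (auto simp: b_def)
    finally have 2: "1 \<le> (2 + b / \<bar>Im z\<bar>) * cmod (1 + \<alpha>' * rform l w' z)" .
    have p: "cmod (1 + \<alpha>' * rform l w' z) > 0" using one_plus_rform(1)[OF l z w(2)] by simp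
    have "b \<ge> 0" by (simp add: b_def)
    have "cmod (1 + \<alpha> * rform l w z) * 1 \<le> (2 + b / \<bar>Im z\<bar>) * ((2 + b / \<bar>Im z\<bar>) * cmod (1 + \<alpha>' * rform l w' z))"
      using 1 2 \<open>b \<ge> 0\<close> by (intro mult_mono) auto
    then show ?thesis
      using p by (simp add: HF[OF z] norm_divide pos_divide_le_eq power2_eq_square mult.assoc)
  qed
  then obtain c where c: "\<And>z. H z = c"
    using entire_Im_bound_constant[OF H(1), of 2 b] by (auto simp: b_def)
  have "((\<lambda>\<eta>. (1 + \<alpha> * rform l w (Complex 0 \<eta>)) / (1 + \<alpha>' * rform l w' (Complex 0 \<eta>))) \<longlongrightarrow> (1 + complex_of_real \<alpha> * 0) / (1 + complex_of_real \<alpha>' * 0)) at_top"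
    by (intro tendsto_intros rform_tendsto_0 l w) simp
  moreover have "\<forall>\<^sub>F \<eta> in at_top. (1 + \<alpha> * rform l w (Complex 0 \<eta>)) / (1 + \<alpha>' * rform l w' (Complex 0 \<eta>)) = c"
    using eventually_gt_at_top[of "0::real"]
  proof eventually_elim
    case (elim \<eta>)
    then show ?case using HF[of "Complex 0 \<eta>"] c by simp
  qed
  ultimately have "((\<lambda>\<eta>::real. c) \<longlongrightarrow> 1) at_top"
    using tendsto_cong by fastforce
  then have "c = 1" using tendsto_const_iff[of "at_top :: real filter" c 1] by simp
  then show ?thesis
    using HF[OF lam] c one_plus_rform(1)[OF l lam w(2)] by simp
qed

section \<open>Polarisation and completeness of the eigenfunctions\<close>

lemma ip_res_add:
  assumes l: "0 < l" and lam: "Im lam \<noteq> 0" and L: "L2 l f" "L2 l h" "L2 l k"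
  shows "ip l (res l lam (\<lambda>x. f x + c * h x)) k = ip l (res l lam f) k + c * ip l (res l lam h) k"
proof -
  note e = eqn_res_nonreal[OF l lam]
  have "eqn l lam (\<lambda>x. 1 * res l lam f x + c * res l lam h x) (\<lambda>x. 1 * f x + c * h x)"
    by (intro eqn_lincomb e L)
  then have "eqn l lam (\<lambda>x. res l lam f x + c * res l lam h x) (\<lambda>x. f x + c * h x)" by simp
  then have "ip l (res l lam (\<lambda>x. f x + c * h x)) k = ip l (\<lambda>x. res l lam f x + c * res l lam h x) k"
    by (intro eqn_unique_ip[OF l lam e] L2_add L2_cmult L)
  also have "\<dots> = ip l (res l lam f) k + c * ip l (res l lam h) k"
    unfolding ip_add_left[OF eqn_L2[OF e[OF L(1)]] L2_cmult[OF eqn_L2[OF e[OF L(2)]]] L(3)] ip_cmult_left ..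
  finally show ?thesis .
qed

text \<open>The two cross terms stay separate: for nonreal lam they are not conjugate to each
  other.\<close>

lemma rform_add:
  assumes l: "0 < l" and lam: "Im lam \<noteq> 0" and L: "L2 l f" "L2 l h"
  shows "rform l (\<lambda>x. f x + c * h x) lam = rform l f lam + cnj c * ip l (res l lam f) h
    + c * ip l (res l lam h) f + c * cnj c * rform l h lam"
proof -
  have R: "L2 l (res l lam k)" if "L2 l k" for k
    using eqn_L2[OF eqn_res_nonreal[OF l lam that]] .
  have r: "ip l (res l lam k) (\<lambda>x. f x + c * h x) = ip l (res l lam k) f + cnj c * ip l (res l lam k) h"
    if "L2 l k" for k
    unfolding ip_add_right[OF L(1) L2_cmult[OF L(2)] R[OF that]] ip_cmult_right ..
  have "rform l (\<lambda>x. f x + c * h x) lam = ip l (res l lam f) (\<lambda>x. f x + c * h x) + c * ip l (res l lam h) (\<lambda>x. f x + c * h x)"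
    unfolding rform_def by (intro ip_res_add l lam L L2_add L2_cmult)
  then show ?thesis by (simp add: r L rform_def algebra_simps)
qed

text \<open>Reads off the residue at r. With c phi the projection of u to the kernel and d = lam -
  r, R(lam) u = - (c / d) phi + y + d R(lam) y. The pairing with g is 0, so c <phi, g> is O(eta) and
  hence 0.\<close>

lemma resolvent_vanishing_imp_perp:
  assumes l: "0 < l" and L: "L2 l u" "L2 l g"
    and \<phi>: "eqn l (complex_of_real r) \<phi> (\<lambda>x. 0)" "nsq l \<phi> \<noteq> 0" "ip l \<phi> g \<noteq> 0"
    and z: "\<And>lam. Im lam \<noteq> 0 \<Longrightarrow> ip l (res l lam u) g = 0"
  shows "ip l u \<phi> = 0"
proof -
  have L\<phi>: "L2 l \<phi>" using \<phi> eqn_L2 by blast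
  define c where "c = ip l u \<phi> / nsq l \<phi>"
  define u' where "u' = (\<lambda>x. u x + (- c) * \<phi> x)"
  have Lu': "L2 l u'" unfolding u'_def by (intro L2_add L2_cmult L L\<phi>)
  have "ip l u' \<phi> = ip l u \<phi> + (- c) * ip l \<phi> \<phi>"
    unfolding u'_def ip_add_left[OF L(1) L2_cmult[OF L\<phi>] L\<phi>] ip_cmult_left ..
  then have "ip l u' \<phi> = 0" using \<phi>(2) by (simp add: c_def ip_self)
  then obtain y where y: "eqn l (complex_of_real r) y u'"
    using eqn_perp_kernel_solvable[OF l \<phi>(1,2) Lu'] by blast
  have Ly: "L2 l y" using y eqn_L2 by blast
  define K where "K = cmod (ip l y g) + sqrt (nsq l y * nsq l g)"
  have bound: "cmod (c * ip l \<phi> g) \<le> \<eta> * K" if \<eta>: "\<eta> > 0" for \<eta>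
  proof -
    define \<delta> where "\<delta> = \<i> * complex_of_real \<eta>"
    define lam where "lam = complex_of_real r + \<delta>"
    have Im: "Im lam = \<eta>" "Im lam \<noteq> 0" and d: "\<delta> \<noteq> 0" "cmod \<delta> = \<eta>"
      using \<eta> by (auto simp: lam_def \<delta>_def norm_mult)
    define Y where "Y = res l lam y"
    have Y: "eqn l lam Y y" unfolding Y_def by (rule eqn_res_nonreal[OF l Im(2) Ly])
    have LY: "L2 l Y" using Y eqn_L2 by blast
    have e1: "eqn l lam \<phi> (\<lambda>x. - \<delta> * \<phi> x)" using eqn_shift[OF \<phi>(1), of lam] by (simp add: lam_def)
    have e2: "eqn l lam y (\<lambda>x. u' x - \<delta> * y x)" using eqn_shift[OF y, of lam] by (simp add: lam_def)
    have "eqn l lam (\<lambda>x. (- c / \<delta>) * \<phi> x + 1 * (1 * y x + \<delta> * Y x))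
      (\<lambda>x. (- c / \<delta>) * (- \<delta> * \<phi> x) + 1 * (1 * (u' x - \<delta> * y x) + \<delta> * y x))"
      by (intro eqn_lincomb e1 e2 Y)
    also have "(\<lambda>x. (- c / \<delta>) * (- \<delta> * \<phi> x) + 1 * (1 * (u' x - \<delta> * y x) + \<delta> * y x)) = u"
      using d by (auto simp: u'_def)
    finally have "eqn l lam (\<lambda>x. (- c / \<delta>) * \<phi> x + (y x + \<delta> * Y x)) u" by simp
    then have "ip l (\<lambda>x. (- c / \<delta>) * \<phi> x + (y x + \<delta> * Y x)) g = 0"
      using eqn_unique_ip[OF l Im(2) _ eqn_res_nonreal[OF l Im(2) L(1)] L(2)] z[OF Im(2)] by simp
    then have "(- c / \<delta>) * ip l \<phi> g + (ip l y g + \<delta> * ip l Y g) = 0"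
      unfolding ip_add_left[OF L2_cmult[OF L\<phi>] L2_add[OF Ly L2_cmult[OF LY]] L(2)]
        ip_add_left[OF Ly L2_cmult[OF LY] L(2)] ip_cmult_left .
    then have "c * ip l \<phi> g = \<delta> * (ip l y g + \<delta> * ip l Y g)"
      using d by (simp add: field_simps)
    then have "cmod (c * ip l \<phi> g) = \<eta> * cmod (ip l y g + \<delta> * ip l Y g)"
      by (simp add: norm_mult d)
    also have "\<dots> \<le> \<eta> * (cmod (ip l y g) + \<eta> * cmod (ip l Y g))"
      using \<eta> norm_triangle_ineq[of "ip l y g" "\<delta> * ip l Y g"] by (intro mult_left_mono) (auto simp: norm_mult d)
    also have "\<dots> \<le> \<eta> * K"
      unfolding K_def using eqn_ip_bound[OF _ Y Ly L(2)] l \<eta> Im by (intro mult_left_mono add_left_mono) auto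
    finally show ?thesis .
  qed
  have "c * ip l \<phi> g = 0"
  proof (rule ccontr)
    assume "c * ip l \<phi> g \<noteq> 0"
    then have p: "cmod (c * ip l \<phi> g) > 0" by simp
    have "K \<ge> 0" by (simp add: K_def)
    \<comment> \<open>With this choice eta K is at most half of the positive quantity that
      \<open>bound\<close> places below it.\<close>
    define \<eta> where "\<eta> = cmod (c * ip l \<phi> g) / (2 * (K + 1))"
    have "\<eta> > 0" using p \<open>K \<ge> 0\<close> by (simp add: \<eta>_def)
    have "\<eta> * K \<le> \<eta> * (K + 1)" using \<open>\<eta> > 0\<close> by (intro mult_left_mono) auto
    also have "\<dots> = cmod (c * ip l \<phi> g) / 2" using \<open>K \<ge> 0\<close> by (simp add: \<eta>_def field_simps)
    finally show False using bound[OF \<open>\<eta> > 0\<close>] p by linarith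
  qed
  then show ?thesis using \<phi> by (simp add: c_def)
qed

text \<open>This is completeness of the eigenfunctions. Orthogonality excludes the singular case of
  \<open>real_point_dichotomy\<close>, so F_u is bounded above every real point and extends to an
  entire function.\<close>

lemma perp_eigenfunctions_imp_null:
  assumes l: "0 < l" and u: "L2 l u"
    and perp: "\<And>r \<phi>. eqn l (complex_of_real r) \<phi> (\<lambda>x. 0) \<Longrightarrow> ip l u \<phi> = 0"
  shows "ae_eq l u (\<lambda>x. 0)"
proof -
  obtain H where H: "H holomorphic_on UNIV" "\<And>z. Im z \<noteq> 0 \<Longrightarrow> H z = ip l (res_num l z u) u / char_det l z"
  proof (rule entire_quotient[OF ip_res_num_holomorphic[OF less_imp_le[OF l] u u] char_det_holomorphic[OF less_imp_le[OF l]]])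
    show "char_det l z \<noteq> 0" if "Im z \<noteq> 0" for z by (rule char_det_nonreal[OF l that])
    fix r
    show "\<exists>K. \<forall>\<^sub>F \<eta> in at_right 0. cmod (ip l (res_num l (Complex r \<eta>) u) u) \<le> K * cmod (char_det l (Complex r \<eta>))"
    proof (rule real_point_dichotomy[OF l u, of r])
      fix z z2 assume z: "eqn l (complex_of_real r) z u" "eqn l (complex_of_real r) z2 z"
      define C where "C = cmod (ip l z2 u) + sqrt (nsq l z2 * nsq l u)"
      have "C \<ge> 0" by (simp add: C_def)
      have "\<forall>\<^sub>F \<eta> in at_right 0. cmod (ip l (res_num l (Complex r \<eta>) u) u) \<le> (cmod (ip l z u) + C) * cmod (char_det l (Complex r \<eta>))"
        using eventually_at_right_real[OF zero_less_one]
      proof eventually_elim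
        case (elim \<eta>)
        then have \<eta>: "0 < \<eta>" "\<eta> < 1" by auto
        have "cmod (rform l u (Complex r \<eta>)) \<le> cmod (ip l z u) + cmod (rform l u (Complex r \<eta>) - ip l z u)"
          by (metis norm_triangle_sub)
        also have "\<dots> \<le> cmod (ip l z u) + C"
          using rform_near_regular[OF l u z \<eta>(1)] mult_left_mono[of \<eta> 1 C] \<eta> \<open>C \<ge> 0\<close>
          unfolding C_def[symmetric] by linarith
        finally have "cmod (rform l u (Complex r \<eta>)) * cmod (char_det l (Complex r \<eta>)) \<le> (cmod (ip l z u) + C) * cmod (char_det l (Complex r \<eta>))"
          by (intro mult_right_mono) auto
        moreover have "char_det l (Complex r \<eta>) \<noteq> 0" using char_det_nonreal[OF l] \<eta> by simp
        ultimately show ?case by (simp add: rform_eq norm_divide)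
      qed
      then show ?thesis by blast
    qed (use perp in blast)
  qed (rule that)
  have HF: "H z = rform l u z" if "Im z \<noteq> 0" for z using H(2)[OF that] by (simp add: rform_eq)
  have "cmod (H z) \<le> (1 + nsq l u / \<bar>Im z\<bar>)\<^sup>2" if "Im z \<noteq> 0" for z
  proof -
    \<comment> \<open>The inequality t <= (1 + t)^2 brings the resolvent bound into the squared form
      of \<open>entire_Im_bound_constant\<close>.\<close>
    define t where "t = nsq l u / \<bar>Im z\<bar>"
    have "t \<ge> 0" by (simp add: t_def)
    have "cmod (H z) \<le> t" unfolding t_def HF[OF that] by (rule rform_bound[OF l that u])
    also have "t \<le> (1 + t)\<^sup>2" using \<open>t \<ge> 0\<close> by (simp add: power2_eq_square algebra_simps)
    finally show ?thesis by (simp add: t_def)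
  qed
  then obtain c where c: "\<And>z. H z = c"
    using entire_Im_bound_constant[OF H(1), of 1 "nsq l u"] by auto
  have ev: "\<forall>\<^sub>F \<eta> in at_top. rform l u (Complex 0 \<eta>) = c"
    using eventually_gt_at_top[of "0::real"]
  proof eventually_elim
    case (elim \<eta>)
    then show ?case using HF[of "Complex 0 \<eta>"] c by simp
  qed
  then have "((\<lambda>\<eta>::real. c) \<longlongrightarrow> 0) at_top"
    using tendsto_cong[OF ev] rform_tendsto_0[OF l u] by blast
  then have "c = 0" using tendsto_const_iff[of "at_top :: real filter" c 0] by simp
  have "((\<lambda>\<eta>. Complex 0 \<eta> * rform l u (Complex 0 \<eta>)) \<longlongrightarrow> 0) at_top"
    using ev \<open>c = 0\<close> by (intro tendsto_eventually) (auto elim: eventually_mono)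
  then have "- complex_of_real (nsq l u) = 0"
    using tendsto_unique[OF _ rform_asymptotics[OF l u]] by simp
  then show ?thesis using nsq_eq_0_imp[OF u] by simp
qed

theorem theorem4p3:
  fixes l \<alpha> \<alpha>' :: real and v v' g :: "real \<Rightarrow> complex"
  assumes "0 < l"
    and "g = (\<lambda>x. complex_of_real (l - x))"
    and "\<alpha> \<noteq> 0" and "\<alpha>' \<noteq> 0"
    and "L2 l v" and "L2 l v'"
    and "L2norm l v = 1" and "L2norm l v' = 1"
    and "same_spectrum l \<alpha> v \<alpha>' v'"
    and "same_spectrum l \<alpha> (\<lambda>x. v x + g x) \<alpha>' (\<lambda>x. v' x + g x)"
    and "same_spectrum l \<alpha> (\<lambda>x. v x + \<i> * g x) \<alpha>' (\<lambda>x. v' x + \<i> * g x)"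
  shows "\<alpha> = \<alpha>' \<and> ae_eq l v v'"
proof -
  note l = assms(1) and L = assms(5,6)
  have Lg: "L2 l g" unfolding assms(2) by (intro L2_continuous continuous_intros)
  have n: "nsq l v = 1" "nsq l v' = 1"
    using assms(7,8) by (simp_all add: L2norm_def ip_self)
  have F0: "\<alpha> * rform l v lam = \<alpha>' * rform l v' lam" if "Im lam \<noteq> 0" for lam
    by (rule same_spectrum_rform[OF l assms(3,4) L assms(9) that])
  have lim: "((\<lambda>\<eta>. \<alpha> * (Complex 0 \<eta> * rform l v (Complex 0 \<eta>))) \<longlongrightarrow> complex_of_real \<alpha> * - of_real (nsq l v)) at_top"
    by (intro tendsto_intros rform_asymptotics l L)
  have lim': "((\<lambda>\<eta>. \<alpha>' * (Complex 0 \<eta> * rform l v' (Complex 0 \<eta>))) \<longlongrightarrow> complex_of_real \<alpha>' * - of_real (nsq l v')) at_top"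
    by (intro tendsto_intros rform_asymptotics l L)
  have ev: "\<forall>\<^sub>F \<eta> in at_top. \<alpha> * (Complex 0 \<eta> * rform l v (Complex 0 \<eta>)) = \<alpha>' * (Complex 0 \<eta> * rform l v' (Complex 0 \<eta>))"
    using eventually_gt_at_top[of "0::real"]
  proof eventually_elim
    case (elim \<eta>)
    then show ?case using F0[of "Complex 0 \<eta>"] by (simp add: mult.left_commute)
  qed
  have "complex_of_real \<alpha> * - complex_of_real (nsq l v) = complex_of_real \<alpha>' * - complex_of_real (nsq l v')"
    by (rule tendsto_unique[OF trivial_limit_at_top_linorder lim iffD2[OF tendsto_cong[OF ev] lim']])
  then have \<alpha>: "\<alpha> = \<alpha>'" using n by simp
  \<comment> \<open>Written with the factor - 1 so that \<open>ip_res_add\<close> applies literally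
    with c = - 1.\<close>
  define u where "u = (\<lambda>x. v x + (- 1) * v' x)"
  have Lu: "L2 l u" unfolding u_def by (intro L2_add L2_cmult L)
  have vanish: "ip l (res l lam u) g = 0" if lam: "Im lam \<noteq> 0" for lam
  proof -
    have eqc: "rform l (\<lambda>x. v x + c * g x) lam = rform l (\<lambda>x. v' x + c * g x) lam" if "c \<in> {1, \<i>}" for c
    proof -
      have "same_spectrum l \<alpha> (\<lambda>x. v x + c * g x) \<alpha>' (\<lambda>x. v' x + c * g x)"
        using that assms(10,11) by auto
      then have "\<alpha> * rform l (\<lambda>x. v x + c * g x) lam = \<alpha>' * rform l (\<lambda>x. v' x + c * g x) lam"
        by (intro same_spectrum_rform[OF l assms(3,4)] L2_add L2_cmult L Lg lam)
      then show ?thesis using \<alpha> assms(3) by simp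
    qed
    have Fv: "rform l v lam = rform l v' lam" using F0[OF lam] \<alpha> assms(3) by simp
    \<comment> \<open>c = 1 determines X + Y, and c = i determines i (Y - X) because cnj i = - i;
      together they determine X. The cross terms are comparable only after F_v = F_v' is
      known.\<close>
    define X Y X' Y' where "X = ip l (res l lam v) g" and "Y = ip l (res l lam g) v"
      and "X' = ip l (res l lam v') g" and "Y' = ip l (res l lam g) v'"
    have 1: "X + Y = X' + Y'"
      using eqc[of 1] rform_add[OF l lam L(1) Lg, of 1] rform_add[OF l lam L(2) Lg, of 1] Fv
      by (simp add: X_def Y_def X'_def Y'_def)
    have "- \<i> * X + \<i> * Y = - \<i> * X' + \<i> * Y'"
      using eqc[of \<i>] rform_add[OF l lam L(1) Lg, of \<i>] rform_add[OF l lam L(2) Lg, of \<i>] Fv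
      by (simp add: X_def Y_def X'_def Y'_def)
    then have "\<i> * (Y - X) = \<i> * (Y' - X')" by (simp add: algebra_simps)
    then have 2: "Y - X = Y' - X'" by simp
    have "(X + Y) - (Y - X) = (X' + Y') - (Y' - X')" using 1 2 by simp
    then have "X = X'" by simp
    then show ?thesis
      unfolding u_def using ip_res_add[OF l lam L Lg, of "- 1"] by (simp add: X_def X'_def)
  qed
  have "ae_eq l u (\<lambda>x. 0)"
  proof (rule perp_eigenfunctions_imp_null[OF l Lu])
    fix r \<psi> assume \<psi>: "eqn l (complex_of_real r) \<psi> (\<lambda>x. 0)"
    have L\<psi>: "L2 l \<psi>" using \<psi> eqn_L2 by blast
    show "ip l u \<psi> = 0"
    proof (cases "char_det l (complex_of_real r) = 0")
      case False
      then show ?thesis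
        using ip_cong_right[OF kernel_trivial[OF l False \<psi>] L\<psi> L2_zero Lu] by simp
    next
      case True
      obtain a b where ab: "a \<noteq> 0 \<or> b \<noteq> 0" "a * fund 1 (complex_of_real r) l + b * fund 2 (complex_of_real r) l = 0"
        "a * (fund 0 (complex_of_real r) l - 1) + b * fund 1 (complex_of_real r) l = 0"
        and \<phi>: "eqn l (complex_of_real r) (\<lambda>x. a * fund 1 (complex_of_real r) x + b * fund 2 (complex_of_real r) x) (\<lambda>x. 0)"
        "nsq l (\<lambda>x. a * fund 1 (complex_of_real r) x + b * fund 2 (complex_of_real r) x) \<noteq> 0"
        using char_det_eq_0_eigenfunction[OF l True] by blast
      \<comment> \<open>Nonvanishing of the pairing with g is known for this explicit eigenfunction;
        by simplicity \<open>\<psi>\<close> is a multiple of it.\<close>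
      define \<phi>' where "\<phi>' = (\<lambda>x. a * fund 1 (complex_of_real r) x + b * fund 2 (complex_of_real r) x)"
      have "ip l \<phi>' g \<noteq> 0"
        unfolding \<phi>'_def assms(2) by (rule ip_eigenfunction_linear_nonzero[OF l refl ab])
      then have 0: "ip l u \<phi>' = 0"
        using resolvent_vanishing_imp_perp[OF l Lu Lg \<phi>[folded \<phi>'_def] _ vanish] by blast
      obtain c where c: "ae_eq l \<psi> (\<lambda>x. c * \<phi>' x)"
        using kernel_dim_le_1[OF l \<phi>[folded \<phi>'_def] \<psi>] by blast
      have "ip l u \<psi> = cnj c * ip l u \<phi>'"
        using ip_cong_right[OF c L\<psi> L2_cmult[OF eqn_L2[OF \<phi>(1)[folded \<phi>'_def]]] Lu] by simp
      then show ?thesis using 0 by simp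
    qed
  qed
  then have "ae_eq l v v'"
    unfolding u_def ae_eq_def by (auto elim: eventually_mono)
  then show ?thesis using \<alpha> by blast
qed

end
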